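(* Let $n=2r-1$. 1) There exists a unique algebra automorphism $\tau_r^-$ of $U_q'(\mathfrak k)$ such that $\tau_r^-(x)=T_r(x)$ for $x\in kT_\theta$ and, for $j=1,\dots,n$, $$\tau_r^-(B_j)=\begin{cases}[B_r,B_j]_q & \text{if } j=r-1 \text{ or } j=r+1,\\ B_j & \text{else.}\end{cases}$$ 2) The inverse automorphism $\tau_r$ of $\tau_r^-$ is determined by $\tau_r(x)=T_r(x)$ for $x\in kT_\theta$ and $$\tau_r(B_j)=\begin{cases}[B_j,B_r]_q & \text{if } j=r-1 \text{ or } j=r+1,\\ B_j & \text{else.}\end{cases}$$ 3) The relation $\tau_{r-1}\tau_r\tau_{r-1}\tau_r=\tau_r\tau_{r-1}\tau_r\tau_{r-1}$ holds. Moreover, $\tau_r\tau_j=\tau_j\tau_r$ if $j=1,\dots,r-2$.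
   Context: Let $k$ be a field containing $q\neq0$, not a root of unity, and a square root $q^{1/2}$ of $q$. Let $\mathfrak g=\mathfrak{sl}_{n+1}(\mathbb C)$ with $n=2r-1$, $r\ge2$, standard ordering of simple roots $\alpha_1,\dots,\alpha_n$, Cartan matrix $(a_{ij})$, and $\tau(i)=n-i+1$. $U_q(\mathfrak g)$ is the $k$-algebra with generators $E_i,F_i,K_i^{\pm1}$ ($1\le i\le n$) and relations $K_iK_i^{-1}=K_i^{-1}K_i=1$, $K_iK_j=K_jK_i$, $K_iE_jK_i^{-1}=q^{a_{ij}}E_j$, $K_iF_jK_i^{-1}=q^{-a_{ij}}F_j$, $E_iF_j-F_jE_i=\delta_{ij}(K_i-K_i^{-1})/(q-q^{-1})$, and quantum Serre relations ($X_iX_j=X_jX_i$ if $a_{ij}=0$; $X_i^2X_j-(q+q^{-1})X_iX_jX_i+X_jX_i^2=0$ if $a_{ij}=-1$; for $X=E$ and $X=F$). $U_q'(\mathfrak k)$ is the $k$-subalgebra of $U_q(\mathfrak g)$ generated by $B_i=F_i-K_i^{-1}E_{\tau(i)}$ and $K_iK_{\tau(i)}^{-1}$ for $1\le i\le n$. $kT_\theta$ is the subalgebra generated by all $K_iK_{\tau(i)}^{-1}$. $T_i$ denotes the Lusztig automorphism of $U_q(\mathfrak g)$; on the $K_j$ it acts by $T_i(K_j)=K_jK_i^{-a_{ij}}$ (in particular $T_r(x)=x$ for all $x\in kT_\theta$). Write $[a,b]_q=ab-qba$. For $1\le i\le r-1$, $\tau_i$ is the algebra automorphism of $U_q'(\mathfrak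 k)$ determined by $\tau_i(x)=T_iT_{\tau(i)}(x)$ for $x\in kT_\theta$ and, for $1\le j\le n$, $$\tau_i(B_j)=\begin{cases} q^{-1/2}[B_j,B_i]_q & \text{if } a_{ij}=-1 \text{ and } a_{\tau(i)j}\ne-1,\\ q^{-1/2}[B_j,B_{\tau(i)}]_q & \text{if } a_{ij}\neq-1 \text{ and } a_{\tau(i)j}=-1,\\ q^{-1}[[B_j,B_i]_q,B_{\tau(i)}]_q+B_jK_iK_{\tau(i)}^{-1} & \text{if } a_{ij}=-1 \text{ and } a_{\tau(i)j}=-1,\\ qK_{\tau(i)}K_i^{-1}B_{\tau(i)} & \text{if } j=i,\\ qK_iK_{\tau(i)}^{-1}B_i & \text{if } j=\tau(i),\\ B_j & \text{else.}\end{cases}$$ *)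

theory Defs
  imports
    "HOL-Library.Poly_Mapping"
    "HOL-Algebra.Algebra"
    "HOL-Algebra.Algebraic_Closure_Type"
begin

section \<open>Free associative algebras\<close>

text \<open>Monomials of a free algebra: words under concatenation, written additively because
  \<^typ>\<open>'a \<Rightarrow>\<^sub>0 'b\<close> takes its convolution product from an additive monoid of exponents.\<close>

datatype 'g fmon = FMon (letters: "'g list")

instantiation fmon :: (type) monoid_add
begin

definition zero_fmon :: "'a fmon" where "0 = FMon []"

definition plus_fmon :: "'a fmon \<Rightarrow> 'a fmon \<Rightarrow> 'a fmon"
  where "u + v = FMon (letters u @ letters v)"

instance
  by standard (simp_all add: zero_fmon_def plus_fmon_def)

end

definition free_alg :: "'g set \<Rightarrow> ('g fmon \<Rightarrow>\<^sub>0 'k::field) ring" where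
  "free_alg G = ring_of_type_algebra
     \<lparr>carrier := {p. \<forall>w \<in> Poly_Mapping.keys p. set (letters w) \<subseteq> G}\<rparr>"

definition fgen :: "'g \<Rightarrow> ('g fmon \<Rightarrow>\<^sub>0 'k::field)" where
  "fgen g = Poly_Mapping.single (FMon [g]) 1"

definition fconst :: "'k \<Rightarrow> ('g fmon \<Rightarrow>\<^sub>0 'k::field)" where
  "fconst c = Poly_Mapping.single 0 c"


lemma free_alg_closed:
  "fgen g \<in> carrier (free_alg G) \<longleftrightarrow> g \<in> G"
  "(fconst c :: 'g fmon \<Rightarrow>\<^sub>0 'k::field) \<in> carrier (free_alg G)"
  "0 \<in> carrier (free_alg G)" "1 \<in> carrier (free_alg G)"
  "x \<in> carrier (free_alg G) \<Longrightarrow> y \<in> carrier (free_alg G) \<Longrightarrow> x + y \<in> carrier (free_alg G)"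
  "x \<in> carrier (free_alg G) \<Longrightarrow> y \<in> carrier (free_alg G) \<Longrightarrow> x - y \<in> carrier (free_alg G)"
  "x \<in> carrier (free_alg G) \<Longrightarrow> - x \<in> carrier (free_alg G)"
  "x \<in> carrier (free_alg G) \<Longrightarrow> y \<in> carrier (free_alg G) \<Longrightarrow> x * y \<in> carrier (free_alg G)"
proof -
  show "x \<in> carrier (free_alg G) \<Longrightarrow> y \<in> carrier (free_alg G) \<Longrightarrow> x * y \<in> carrier (free_alg G)"
    using keys_mult[of x y] by (fastforce simp: free_alg_def plus_fmon_def)
  show "x \<in> carrier (free_alg G) \<Longrightarrow> y \<in> carrier (free_alg G) \<Longrightarrow> x + y \<in> carrier (free_alg G)"
    using Poly_Mapping.keys_add[of x y] by (fastforce simp: free_alg_def)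
  show "x \<in> carrier (free_alg G) \<Longrightarrow> y \<in> carrier (free_alg G) \<Longrightarrow> x - y \<in> carrier (free_alg G)"
    using keys_diff[of x y] by (fastforce simp: free_alg_def)
qed (auto simp: free_alg_def fgen_def fconst_def zero_fmon_def single_one[symmetric] simp del: single_one)

lemma ring_free_alg: "ring (free_alg G :: ('g fmon \<Rightarrow>\<^sub>0 'k::field) ring)"
proof -
  define R where "R = (free_alg G :: ('g fmon \<Rightarrow>\<^sub>0 'k) ring)"
  have ops: "monoid.mult R = (*)" "monoid.one R = 1" "ring.zero R = 0" "ring.add R = (+)"
    by (auto simp: R_def free_alg_def ring_of_type_algebra_def)
  have cl: "0 \<in> carrier R" "1 \<in> carrier R" "\<And>x y. x \<in> carrier R \<Longrightarrow> y \<in> carrier R \<Longrightarrow> x + y \<in> carrier R" "\<And>x y. x \<in> carrier R \<Longrightarrow> y \<in> carrier R \<Longrightarrow> x * y \<in> carrier R" "\<And>x. x \<in> carrier R \<Longrightarrow> - x \<in> carrier R" by (auto simp: R_def intro: free_alg_closed)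
  have "ring R"
  proof (rule ringI)
    show "abelian_group R"
      by (rule abelian_groupI) (auto simp: ops algebra_simps cl intro: bexI[of _ "- _"] add.left_inverse)
    show "Group.monoid R" by (rule monoidI) (auto simp: ops algebra_simps cl)
  qed (auto simp: ops algebra_simps)
  then show ?thesis by (simp add: R_def)
qed


section \<open>Subalgebras and automorphisms\<close>

text \<open>A unital algebra over a field \<open>k\<close> is a ring \<open>R\<close> together with a (central) ring
  homomorphism \<open>\<iota>\<close> from \<open>k\<close> to \<open>R\<close>. A unital ring homomorphism is then \<open>k\<close>-linear
  iff it fixes every \<open>\<iota> c\<close>.\<close>

definition gen_subalgebra :: "'a ring \<Rightarrow> ('k \<Rightarrow> 'a) \<Rightarrow> 'a set \<Rightarrow> 'a set" where
  "gen_subalgebra R \<iota> S = generate_ring R (range \<iota> \<union> S)"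

text \<open>Automorphisms of the subalgebra \<open>V\<close>. The maps are taken extensional (undefined outside
  \<open>V\<close>), so that equality of automorphisms is equality of HOL functions.\<close>

definition alg_auts :: "'a ring \<Rightarrow> ('k \<Rightarrow> 'a) \<Rightarrow> 'a set \<Rightarrow> ('a \<Rightarrow> 'a) set" where
  "alg_auts R \<iota> V = {f \<in> extensional V.
     f \<in> ring_iso (R\<lparr>carrier := V\<rparr>) (R\<lparr>carrier := V\<rparr>) \<and> (\<forall>c. f (\<iota> c) = \<iota> c)}"

definition aut_inverse :: "'a set \<Rightarrow> ('a \<Rightarrow> 'a) \<Rightarrow> 'a \<Rightarrow> 'a" where
  "aut_inverse V f = restrict (inv_into V f) V"

text \<open>\<open>[a, b]\<^sub>c = a b - c b a\<close>, the scalar \<open>c\<close> being given as an element of the algebra.\<close>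

definition qcomm :: "'a ring \<Rightarrow> 'a \<Rightarrow> 'a \<Rightarrow> 'a \<Rightarrow> 'a" where
  "qcomm R c a b = (a \<otimes>\<^bsub>R\<^esub> b) \<ominus>\<^bsub>R\<^esub> (c \<otimes>\<^bsub>R\<^esub> (b \<otimes>\<^bsub>R\<^esub> a))"


section \<open>The quantized enveloping algebra of type A\<close>

definition cartan :: "nat \<Rightarrow> nat \<Rightarrow> int" where
  "cartan i j = (if i = j then 2 else if i = j + 1 \<or> j = i + 1 then -1 else 0)"

text \<open>\<open>GKi i\<close> stands for the inverse of \<open>K\<^sub>i\<close>.\<close>

datatype uq_gen = GE nat | GF nat | GK nat | GKi nat

definition uq_gens :: "nat \<Rightarrow> uq_gen set" where
  "uq_gens n = (\<Union>i\<in>{1..n}. {GE i, GF i, GK i, GKi i})"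

definition fserre :: "'k::field \<Rightarrow> ('g fmon \<Rightarrow>\<^sub>0 'k) \<Rightarrow> ('g fmon \<Rightarrow>\<^sub>0 'k) \<Rightarrow> ('g fmon \<Rightarrow>\<^sub>0 'k)" where
  "fserre q x y = x * x * y - fconst (q + inverse q) * (x * y * x) + y * x * x"

text \<open>A relation \<open>lhs = rhs\<close> is represented by \<open>lhs - rhs\<close>.\<close>

definition uq_rels :: "'k::field \<Rightarrow> nat \<Rightarrow> (uq_gen fmon \<Rightarrow>\<^sub>0 'k) set" where
  "uq_rels q n =
     {fgen (GK i) * fgen (GKi i) - 1 | i. i \<in> {1..n}} \<union>
     {fgen (GKi i) * fgen (GK i) - 1 | i. i \<in> {1..n}} \<union>
     {fgen (GK i) * fgen (GK j) - fgen (GK j) * fgen (GK i) | i j. i \<in> {1..n} \<and> j \<in> {1..n}} \<union>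
     {fgen (GK i) * fgen (GE j) * fgen (GKi i) - fconst (q powi cartan i j) * fgen (GE j)
        | i j. i \<in> {1..n} \<and> j \<in> {1..n}} \<union>
     {fgen (GK i) * fgen (GF j) * fgen (GKi i) - fconst (q powi (- cartan i j)) * fgen (GF j)
        | i j. i \<in> {1..n} \<and> j \<in> {1..n}} \<union>
     {fgen (GE i) * fgen (GF j) - fgen (GF j) * fgen (GE i)
        - (if i = j then fconst (1 / (q - inverse q)) * (fgen (GK i) - fgen (GKi i)) else 0)
        | i j. i \<in> {1..n} \<and> j \<in> {1..n}} \<union>
     {fgen (Y i) * fgen (Y j) - fgen (Y j) * fgen (Y i)
        | Y i j. Y \<in> {GE, GF} \<and> i \<in> {1..n} \<and> j \<in> {1..n} \<and> cartan i j = 0} \<union>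
     {fserre q (fgen (Y i)) (fgen (Y j))
        | Y i j. Y \<in> {GE, GF} \<and> i \<in> {1..n} \<and> j \<in> {1..n} \<and> cartan i j = -1}"

definition uq_ideal :: "'k::field \<Rightarrow> nat \<Rightarrow> (uq_gen fmon \<Rightarrow>\<^sub>0 'k) set" where
  "uq_ideal q n = genideal (free_alg (uq_gens n)) (uq_rels q n)"

definition Uq :: "'k::field \<Rightarrow> nat \<Rightarrow> (uq_gen fmon \<Rightarrow>\<^sub>0 'k) set ring" where
  "Uq q n = free_alg (uq_gens n) Quot uq_ideal q n"

lemma uq_rels_closed: "uq_rels q n \<subseteq> carrier (free_alg (uq_gens n))"
  unfolding uq_rels_def fserre_def
  by (auto intro!: free_alg_closed simp: free_alg_closed(1) uq_gens_def)

lemma ring_Uq: "ring (Uq q n)"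
  unfolding Uq_def uq_ideal_def
  by (intro ideal.quotient_is_ring ring.genideal_ideal ring_free_alg uq_rels_closed)

definition uq_class :: "'k::field \<Rightarrow> nat \<Rightarrow> (uq_gen fmon \<Rightarrow>\<^sub>0 'k) \<Rightarrow> (uq_gen fmon \<Rightarrow>\<^sub>0 'k) set" where
  "uq_class q n p = uq_ideal q n +>\<^bsub>free_alg (uq_gens n)\<^esub> p"

definition uscal :: "'k::field \<Rightarrow> nat \<Rightarrow> 'k \<Rightarrow> (uq_gen fmon \<Rightarrow>\<^sub>0 'k) set" where
  "uscal q n c = uq_class q n (fconst c)"

definition uE :: "'k::field \<Rightarrow> nat \<Rightarrow> nat \<Rightarrow> (uq_gen fmon \<Rightarrow>\<^sub>0 'k) set" where
  "uE q n i = uq_class q n (fgen (GE i))"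

definition uF :: "'k::field \<Rightarrow> nat \<Rightarrow> nat \<Rightarrow> (uq_gen fmon \<Rightarrow>\<^sub>0 'k) set" where
  "uF q n i = uq_class q n (fgen (GF i))"

definition uK :: "'k::field \<Rightarrow> nat \<Rightarrow> nat \<Rightarrow> (uq_gen fmon \<Rightarrow>\<^sub>0 'k) set" where
  "uK q n i = uq_class q n (fgen (GK i))"

definition uKi :: "'k::field \<Rightarrow> nat \<Rightarrow> nat \<Rightarrow> (uq_gen fmon \<Rightarrow>\<^sub>0 'k) set" where
  "uKi q n i = uq_class q n (fgen (GKi i))"

definition uKpow :: "'k::field \<Rightarrow> nat \<Rightarrow> nat \<Rightarrow> int \<Rightarrow> (uq_gen fmon \<Rightarrow>\<^sub>0 'k) set" where
  "uKpow q n i m =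
     (if 0 \<le> m then uK q n i [^]\<^bsub>Uq q n\<^esub> nat m else uKi q n i [^]\<^bsub>Uq q n\<^esub> nat (- m))"

text \<open>The Lusztig automorphism \<open>T\<^sub>i\<close>, in the normalization \<open>T''\<^bsub>i,1\<^esub>\<close> of Lusztig's book
  (\<open>T\<^sub>\<alpha>\<close> in Jantzen's Lectures on Quantum Groups, 8.14), given by its values on generators:
  \<open>E\<^sub>i \<mapsto> -F\<^sub>i K\<^sub>i\<close>, \<open>F\<^sub>i \<mapsto> -K\<^sub>i\<^sup>-\<^sup>1 E\<^sub>i\<close>, and for \<open>a\<^sub>i\<^sub>j = -1\<close>,
  \<open>E\<^sub>j \<mapsto> E\<^sub>i E\<^sub>j - q\<^sup>-\<^sup>1 E\<^sub>j E\<^sub>i\<close>, \<open>F\<^sub>j \<mapsto> F\<^sub>j F\<^sub>i - q F\<^sub>i F\<^sub>j\<close>.\<close>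

definition is_lusztig_aut ::
    "'k::field \<Rightarrow> nat \<Rightarrow> nat \<Rightarrow> ((uq_gen fmon \<Rightarrow>\<^sub>0 'k) set \<Rightarrow> (uq_gen fmon \<Rightarrow>\<^sub>0 'k) set) \<Rightarrow> bool" where
  "is_lusztig_aut q n i f \<longleftrightarrow>
     (let U = Uq q n; E = uE q n; F = uF q n; K = uK q n; Ki = uKi q n; \<iota> = uscal q n in
      f \<in> alg_auts U \<iota> (carrier U) \<and>
      (\<forall>j\<in>{1..n}.
         f (K j) = K j \<otimes>\<^bsub>U\<^esub> uKpow q n i (- cartan i j) \<and>
         f (E j) = (if j = i then \<ominus>\<^bsub>U\<^esub> (F i \<otimes>\<^bsub>U\<^esub> K i)
                    else if cartan i j = -1 then qcomm U (\<iota> (inverse q)) (E i) (E j)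
                    else E j) \<and>
         f (F j) = (if j = i then \<ominus>\<^bsub>U\<^esub> (Ki i \<otimes>\<^bsub>U\<^esub> E i)
                    else if cartan i j = -1 then qcomm U (\<iota> q) (F j) (F i)
                    else F j)))"


section \<open>The coideal subalgebra\<close>

definition dtau :: "nat \<Rightarrow> nat \<Rightarrow> nat" where
  "dtau n i = n + 1 - i"

definition uH :: "'k::field \<Rightarrow> nat \<Rightarrow> nat \<Rightarrow> (uq_gen fmon \<Rightarrow>\<^sub>0 'k) set" where
  "uH q n i = uK q n i \<otimes>\<^bsub>Uq q n\<^esub> uKi q n (dtau n i)"

definition uB :: "'k::field \<Rightarrow> nat \<Rightarrow> nat \<Rightarrow> (uq_gen fmon \<Rightarrow>\<^sub>0 'k) set" where
  "uB q n i = uF q n i \<ominus>\<^bsub>Uq q n\<^esub> (uKi q n i \<otimes>\<^bsub>Uq q n\<^esub> uE q n (dtau n i))"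

definition Uk :: "'k::field \<Rightarrow> nat \<Rightarrow> (uq_gen fmon \<Rightarrow>\<^sub>0 'k) set set" where
  "Uk q n = gen_subalgebra (Uq q n) (uscal q n) (uB q n ` {1..n} \<union> uH q n ` {1..n})"

definition kTtheta :: "'k::field \<Rightarrow> nat \<Rightarrow> (uq_gen fmon \<Rightarrow>\<^sub>0 'k) set set" where
  "kTtheta q n = gen_subalgebra (Uq q n) (uscal q n) (uH q n ` {1..n})"

abbreviation Uk_auts ::
    "'k::field \<Rightarrow> nat \<Rightarrow> ((uq_gen fmon \<Rightarrow>\<^sub>0 'k) set \<Rightarrow> (uq_gen fmon \<Rightarrow>\<^sub>0 'k) set) set" where
  "Uk_auts q n \<equiv> alg_auts (Uq q n) (uscal q n) (Uk q n)"

text \<open>In the following three predicates \<open>T\<close> is the family of Lusztig automorphisms. The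
  parameter \<open>s\<close> of the first is the chosen square root of \<open>q\<close>.\<close>

definition is_tau ::
    "'k::field \<Rightarrow> 'k \<Rightarrow> nat \<Rightarrow> (nat \<Rightarrow> (uq_gen fmon \<Rightarrow>\<^sub>0 'k) set \<Rightarrow> (uq_gen fmon \<Rightarrow>\<^sub>0 'k) set) \<Rightarrow> nat
      \<Rightarrow> ((uq_gen fmon \<Rightarrow>\<^sub>0 'k) set \<Rightarrow> (uq_gen fmon \<Rightarrow>\<^sub>0 'k) set) \<Rightarrow> bool" where
  "is_tau q s n T i f \<longleftrightarrow>
     (let U = Uq q n; B = uB q n; K = uK q n; Ki = uKi q n; \<iota> = uscal q n; i' = dtau n i in
      f \<in> Uk_auts q n \<and>
      (\<forall>x\<in>kTtheta q n. f x = T i (T i' x)) \<and>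
      (\<forall>j\<in>{1..n}. f (B j) =
         (if cartan i j = -1 \<and> cartan i' j \<noteq> -1 then
            \<iota> (inverse s) \<otimes>\<^bsub>U\<^esub> qcomm U (\<iota> q) (B j) (B i)
          else if cartan i j \<noteq> -1 \<and> cartan i' j = -1 then
            \<iota> (inverse s) \<otimes>\<^bsub>U\<^esub> qcomm U (\<iota> q) (B j) (B i')
          else if cartan i j = -1 \<and> cartan i' j = -1 then
            (\<iota> (inverse q) \<otimes>\<^bsub>U\<^esub> qcomm U (\<iota> q) (qcomm U (\<iota> q) (B j) (B i)) (B i'))
              \<oplus>\<^bsub>U\<^esub> (B j \<otimes>\<^bsub>U\<^esub> K i \<otimes>\<^bsub>U\<^esub> Ki i')
          else if j = i then \<iota> q \<otimes>\<^bsub>U\<^esub> K i' \<otimes>\<^bsub>U\<^esub> Ki i \<otimes>\<^bsub>U\<^esub> B i'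
          else if j = i' then \<iota> q \<otimes>\<^bsub>U\<^esub> K i \<otimes>\<^bsub>U\<^esub> Ki i' \<otimes>\<^bsub>U\<^esub> B i
          else B j)))"

definition is_tau_r_minus ::
    "'k::field \<Rightarrow> nat \<Rightarrow> nat \<Rightarrow> (nat \<Rightarrow> (uq_gen fmon \<Rightarrow>\<^sub>0 'k) set \<Rightarrow> (uq_gen fmon \<Rightarrow>\<^sub>0 'k) set)
      \<Rightarrow> ((uq_gen fmon \<Rightarrow>\<^sub>0 'k) set \<Rightarrow> (uq_gen fmon \<Rightarrow>\<^sub>0 'k) set) \<Rightarrow> bool" where
  "is_tau_r_minus q n r T f \<longleftrightarrow>
     f \<in> Uk_auts q n \<and>
     (\<forall>x\<in>kTtheta q n. f x = T r x) \<and>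
     (\<forall>j\<in>{1..n}. f (uB q n j) =
        (if j = r - 1 \<or> j = r + 1 then qcomm (Uq q n) (uscal q n q) (uB q n r) (uB q n j)
         else uB q n j))"

definition is_tau_r ::
    "'k::field \<Rightarrow> nat \<Rightarrow> nat \<Rightarrow> (nat \<Rightarrow> (uq_gen fmon \<Rightarrow>\<^sub>0 'k) set \<Rightarrow> (uq_gen fmon \<Rightarrow>\<^sub>0 'k) set)
      \<Rightarrow> ((uq_gen fmon \<Rightarrow>\<^sub>0 'k) set \<Rightarrow> (uq_gen fmon \<Rightarrow>\<^sub>0 'k) set) \<Rightarrow> bool" where
  "is_tau_r q n r T f \<longleftrightarrow>
     f \<in> Uk_auts q n \<and>
     (\<forall>x\<in>kTtheta q n. f x = T r x) \<and>
     (\<forall>j\<in>{1..n}. f (uB q n j) =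
        (if j = r - 1 \<or> j = r + 1 then qcomm (Uq q n) (uscal q n q) (uB q n j) (uB q n r)
         else uB q n j))"

end

(*
The coideal subalgebra is presented by generators b_j, h_j and relations that deform the quantum
Serre relations by terms of lower degree in the b_j. That no further relations are needed follows by
looking at components of top degree: the right action of U_q(g) on functions dual to a universal
Verma module over the algebra without Serre relations shows that a combination of normally ordered
monomials b_u h^mu vanishing in U_q(g) has a top component in the ideal of the Serre relations.
Hence a map of generators extends to the coideal subalgebra as soon as it respects these relations.

Write R = b_r, A = b_{r-1}, A' = b_{r+1}. The two maps are mutually inverse because
[R,[A,R]_q]_q = A by the deformed Serre relation. The braid relation reduces to
tau_{r-1}([A,R]_q) = [R,A']_q, which gives tau_r tau_{r-1} tau_r (A) = A', together with
tau_{r-1} tau_r tau_{r-1} (R) = R, and to the fact that tau_r fixes [[N,A]_q,[R,A']_q]_q for N = b_{r-2}.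
*)
theory Submission
  imports Defs "HOL-Library.Function_Algebras"
begin

section \<open>Free algebras and their two-sided ideals\<close>

text \<open>The quotient U_q(g) comes without a basis, so nothing can be read off from normal forms
  there. The way around is a sandwich. Let \<open>kker\<close> be the ideal of all relations among
  the b_j and h_j that hold in U_q(g). Every two-sided ideal I with \<open>krels\<close> \<subseteq>
  I \<subseteq> \<open>kker\<close> equals \<open>kker\<close>. Taking for I those elements of
  \<open>kker\<close> whose image under the map of generators lies in \<open>kker\<close> again
  shows that the map preserves \<open>kker\<close>, and only the listed relations have to be
  checked, modulo \<open>kker\<close>. The functions of the module take values in the free algebra
  on the b_j and h_j. Hence one tautological function, sending F_w K_mu to b_w h^mu on words of
  length d, returns the whole component of degree d at once. It kills the Serre relations only up to
  terms with fewer letters, so orthogonality is taken modulo a subspace. The relations for the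
  images under tau_r are verified by rewriting. The defining relations are not confluent. The
  missing rules come from overlapping words, in two cases after division by q + q^{-1}, which is
  nonzero because q is not a root of unity.\<close>

type_synonym ('g, 'k) falg = "'g fmon \<Rightarrow>\<^sub>0 'k"

abbreviation fword :: "'g list \<Rightarrow> ('g, 'k::field) falg" where
  "fword u \<equiv> prod_list (map fgen u)"

lemma fconst_simps:
  "fconst (c + d) = fconst c + (fconst d :: ('g, 'k::field) falg)"
  "fconst (c - d) = fconst c - (fconst d :: ('g, 'k::field) falg)"
  "fconst (c * d) = fconst c * (fconst d :: ('g, 'k::field) falg)"
  "fconst (- c) = - (fconst c :: ('g, 'k::field) falg)"
  "fconst 0 = (0 :: ('g, 'k::field) falg)" "fconst 1 = (1 :: ('g, 'k::field) falg)"
  by (simp_all add: fconst_def single_add single_diff mult_single single_uminus)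

lemma single_eq_fconst_fword:
  "Poly_Mapping.single w c = fconst c * (fword (letters w) :: ('g, 'k::field) falg)"
proof -
  have "fword u = (Poly_Mapping.single (FMon u) 1 :: ('g, 'k) falg)" for u
  proof (induction u)
    case Nil
    then show ?case by (simp flip: zero_fmon_def)
  qed (simp add: fgen_def mult_single plus_fmon_def)
  from this[of "letters w"] show ?thesis by (simp add: fconst_def mult_single)
qed

lemma poly_mapping_induct_single [case_names zero single add]:
  fixes p :: "'a \<Rightarrow>\<^sub>0 'b::comm_monoid_add"
  assumes "P 0" "\<And>w c. P (Poly_Mapping.single w c)" "\<And>x y. P x \<Longrightarrow> P y \<Longrightarrow> P (x + y)"
  shows "P p"
proof (induction p rule: update_induct)
  case const
  then show ?case by (rule assms)
next
  case (update f a b)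
  have "Poly_Mapping.update a b f = f + Poly_Mapping.single a b"
    using update(1)
    by (intro poly_mapping_eqI)
      (auto simp: lookup_update lookup_add lookup_single not_in_keys_iff_lookup_eq_zero when_def)
  then show ?case using update assms by auto
qed

lemma falg_induct [case_names const gen add mult]:
  fixes x :: "('g, 'k::field) falg"
  assumes "\<And>c. P (fconst c)" "\<And>g. P (fgen g)"
    "\<And>x y. P x \<Longrightarrow> P y \<Longrightarrow> P (x + y)" "\<And>x y. P x \<Longrightarrow> P y \<Longrightarrow> P (x * y)"
  shows "P x"
proof (induction x rule: poly_mapping_induct_single)
  case zero
  show ?case using assms(1)[of 0] by (simp add: fconst_simps)
next
  case (single w c)
  have "P (fword u)" for u
    by (induction u) (use assms(1)[of 1] assms in \<open>simp_all add: fconst_simps\<close>)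
  then show ?case by (simp add: single_eq_fconst_fword assms)
qed (rule assms)

lemma fconst_central: "x * fconst c = fconst c * (x :: ('g, 'k::field) falg)"
  by (induction x rule: poly_mapping_induct_single)
    (simp_all add: fconst_def mult_single distrib_left distrib_right mult.commute)

lemma fconst_left_commute: "x * (fconst c * y) = fconst c * (x * (y :: ('g, 'k::field) falg))"
  by (metis fconst_central mult.assoc)

abbreviation fscale :: "'k::field \<Rightarrow> ('g, 'k) falg \<Rightarrow> ('g, 'k) falg" where
  "fscale c x \<equiv> fconst c * x"

interpretation falg: vector_space fscale
  by unfold_locales (simp_all add: fconst_simps distrib_left distrib_right mult.assoc)

section \<open>Linear extension and evaluation homomorphisms\<close>

definition lext :: "('m \<Rightarrow> ('g, 'k::field) falg) \<Rightarrow> ('m \<Rightarrow>\<^sub>0 'k) \<Rightarrow> ('g, 'k) falg" where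
  "lext f p = (\<Sum>w\<in>Poly_Mapping.keys p. fscale (Poly_Mapping.lookup p w) (f w))"

lemma lext_superset:
  assumes "finite A" "Poly_Mapping.keys p \<subseteq> A"
  shows "lext f p = (\<Sum>w\<in>A. fscale (Poly_Mapping.lookup p w) (f w))"
  unfolding lext_def using assms
  by (intro sum.mono_neutral_left) (auto simp: not_in_keys_iff_lookup_eq_zero fconst_simps)

lemma lext_add: "lext f (p + p') = lext f p + lext f p'"
proof -
  let ?A = "Poly_Mapping.keys p \<union> Poly_Mapping.keys p'"
  have "lext f (p + p') = (\<Sum>w\<in>?A. fscale (Poly_Mapping.lookup (p + p') w) (f w))"
    using Poly_Mapping.keys_add[of p p'] by (intro lext_superset) auto
  then show ?thesis
    by (simp add: lext_superset[of ?A] lookup_add fconst_simps distrib_right sum.distrib)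
qed

lemma lext_single: "lext f (Poly_Mapping.single w c) = fscale c (f w)"
  by (simp add: lext_def fconst_simps)

definition ev :: "('g \<Rightarrow> ('h, 'k) falg) \<Rightarrow> ('g, 'k::field) falg \<Rightarrow> ('h, 'k) falg" where
  "ev g = lext (\<lambda>w. prod_list (map g (letters w)))"

lemma ev_add: "ev g (x + y) = ev g x + ev g y"
  by (simp add: ev_def lext_add)

interpretation ev: additive "ev g"
  by unfold_locales (rule ev_add)

lemma ev_single: "ev g (Poly_Mapping.single w c) = fscale c (prod_list (map g (letters w)))"
  by (simp add: ev_def lext_single)

lemma ev_mult: "ev g (x * y) = ev g x * ev g y"
proof (induction x rule: poly_mapping_induct_single)
  case (single w c)
  show ?case
  proof (induction y rule: poly_mapping_induct_single)
    case (single v d)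
    let ?u = "\<lambda>w. prod_list (map g (letters w))"
    have "ev g (Poly_Mapping.single w c * Poly_Mapping.single v d) = fconst c * (fconst d * (?u w * ?u v))"
      by (simp only: mult_single ev_single plus_fmon_def fconst_simps mult.assoc fmon.sel map_append prod_list.append)
    also have "\<dots> = fconst c * (?u w * (fconst d * ?u v))"
      by (simp only: fconst_left_commute[of "?u w"])
    finally show ?case by (simp only: ev_single mult.assoc)
  qed (simp_all add: distrib_left ev.add ev.zero)
qed (simp_all add: ev.zero ev.add distrib_right)

lemma ev_fgen: "ev g (fgen a) = g a"
  by (simp add: fgen_def ev_single fconst_simps)

lemma ev_fconst: "ev g (fconst c) = fconst c"
  using ev_single[of g 0 c] by (simp add: fconst_def zero_fmon_def)

lemma ev_one: "ev g 1 = 1"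
  using ev_fconst[of g 1] by (simp add: fconst_simps)

lemmas ev_simps = ev.add ev.diff ev.minus ev.zero ev_mult ev_fgen ev_fconst ev_one

definition fcomm :: "'k::field \<Rightarrow> ('g, 'k) falg \<Rightarrow> ('g, 'k) falg \<Rightarrow> ('g, 'k) falg" where
  "fcomm c x y = x * y - fconst c * (y * x)"

lemma ev_fcomm: "ev g (fcomm c x y) = fcomm c (ev g x) (ev g y)"
  by (simp add: fcomm_def ev_simps)

text \<open>Ideals of the whole type rather than of a carrier, so that computations use the type
  class arithmetic and simp.\<close>

locale two_sided =
  fixes I :: "('g, 'k::field) falg set"
  assumes zero: "0 \<in> I" and add: "x \<in> I \<Longrightarrow> y \<in> I \<Longrightarrow> x + y \<in> I"
    and lmult: "x \<in> I \<Longrightarrow> y * x \<in> I" and rmult: "x \<in> I \<Longrightarrow> x * y \<in> I"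
begin

lemma neg: "x \<in> I \<Longrightarrow> - x \<in> I"
  using lmult[of x "-1"] by simp

lemma diff: "x \<in> I \<Longrightarrow> y \<in> I \<Longrightarrow> x - y \<in> I"
  using add[of x "- y"] neg by simp

lemma subspace: "falg.subspace I"
  by (intro falg.subspaceI zero add lmult)

text \<open>Over a field the subspace I has a complement: g is a projection onto I, and x - g x is
  the projection along I.\<close>

lemma proj_exists: "\<exists>h. Vector_Spaces.linear fscale fscale h \<and> h \<circ> h = h \<and> (\<forall>x. h x = 0 \<longleftrightarrow> x \<in> I)"
proof -
  interpret vector_space_pair fscale fscale ..
  obtain g where g: "g ` UNIV \<subseteq> I" "Vector_Spaces.linear fscale fscale g" "\<forall>v\<in>I. g v = v"
    using linear_exists_left_inverse_on[OF falg.linear_ident subspace] by (auto simp: inj_on_def)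
  have "Vector_Spaces.linear fscale fscale (\<lambda>x. x - g x)"
    by (intro linear_compose_sub falg.linear_ident g)
  moreover have "(\<lambda>x. x - g x) \<circ> (\<lambda>x. x - g x) = (\<lambda>x. x - g x)"
  proof
    fix x
    interpret g: Vector_Spaces.linear fscale fscale g by (rule g(2))
    have "g x \<in> I" using g(1) by auto
    then have "g (x - g x) = 0" using g(3) by (simp add: g.diff)
    then show "((\<lambda>x. x - g x) \<circ> (\<lambda>x. x - g x)) x = x - g x" by simp
  qed
  moreover have "x - g x = 0 \<longleftrightarrow> x \<in> I" for x
  proof
    assume "x - g x = 0"
    then have "x = g x" by simp
    moreover have "g x \<in> I" using g(1) by auto
    ultimately show "x \<in> I" by simp
  next
    assume "x \<in> I"
    then show "x - g x = 0" using g(3) by simp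
  qed
  ultimately show ?thesis by (intro exI[of _ "\<lambda>x. x - g x"]) blast
qed

text \<open>\<open>nu\<close> projects along the ideal, so the operators \<open>M x\<close> are the left multiplications of the
  quotient algebra. Computations modulo \<open>I\<close> become rewriting of composed operators, where the
  relations need no separate associative variants.\<close>

definition nu :: "('g, 'k) falg \<Rightarrow> ('g, 'k) falg" where
  "nu = (SOME h. Vector_Spaces.linear fscale fscale h \<and> h \<circ> h = h \<and> (\<forall>x. h x = 0 \<longleftrightarrow> x \<in> I))"

definition M :: "('g, 'k) falg \<Rightarrow> ('g, 'k) falg \<Rightarrow> ('g, 'k) falg" where
  "M x z = nu (x * z)"

lemma nu_props: "Vector_Spaces.linear fscale fscale nu" "nu \<circ> nu = nu" "nu x = 0 \<longleftrightarrow> x \<in> I"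
  using someI_ex[OF proj_exists] by (auto simp flip: nu_def)

lemma nu_lin: "nu (x + y) = nu x + nu y" "nu (x - y) = nu x - nu y" "nu (- x) = - nu x" "nu 0 = 0"
proof -
  interpret nu: Vector_Spaces.linear fscale fscale nu by (rule nu_props)
  show "nu (x + y) = nu x + nu y" "nu (x - y) = nu x - nu y" "nu (- x) = - nu x" "nu 0 = 0"
    by (simp_all add: nu.add nu.diff nu.neg nu.zero)
qed

lemma nu_eq_iff: "nu x = nu y \<longleftrightarrow> x - y \<in> I"
  using nu_props(3)[of "x - y"] by (simp add: nu_lin)

lemma nu_nu: "nu (nu x) = nu x"
  using nu_props(2) by (metis comp_apply)

lemma nu_M: "nu (M x z) = M x z"
  by (simp add: M_def nu_nu)

lemma M_nu: "M x (nu z) = M x z"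
proof -
  have "nu z - z \<in> I" by (simp add: nu_nu flip: nu_eq_iff)
  then have "x * (nu z - z) \<in> I" by (rule lmult)
  then show ?thesis by (simp add: M_def nu_eq_iff right_diff_distrib)
qed

lemma M_arg: "M x (y + z) = M x y + M x z" "M x (y - z) = M x y - M x z" "M x (- y) = - M x y" "M x 0 = 0"
  by (simp_all add: M_def nu_lin algebra_simps)

lemma M_poly:
  "M (x + y) z = M x z + M y z" "M (x - y) z = M x z - M y z" "M (- x) z = - M x z"
  "M 0 z = 0" "M 1 z = nu z"
  "M (x * y) z = M x (M y z)"
  using M_nu[of x "y * z"] by (simp_all add: M_def nu_lin algebra_simps)

lemma M_eqI: "(\<And>z. M x z = M y z) \<Longrightarrow> x - y \<in> I"
  using nu_eq_iff by (simp add: M_def) (metis mult.right_neutral)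

lemma M_eqD: "x - y \<in> I \<Longrightarrow> M x z = M y z"
  by (simp add: M_def nu_eq_iff rmult flip: left_diff_distrib)

lemma M_fconst_commute: "M x (M (fconst c) z) = M (fconst c) (M x z)"
  by (metis M_poly(6) fconst_central)

lemma M_fconst_mult: "M (fconst (c * d)) z = M (fconst c) (M (fconst d) z)"
  by (simp add: fconst_simps M_poly)

end

text \<open>Bridge to the ideals of HOL-Algebra: cut down to a carrier, the ideal can be compared
  with \<open>genideal\<close>, hence with \<open>uq_ideal\<close>.\<close>

lemma two_sided_ideal:
  assumes "two_sided I"
  shows "ideal (I \<inter> carrier (free_alg G)) (free_alg G)"
proof -
  interpret two_sided I by (rule assms)
  have ops: "monoid.mult (free_alg G) = (*)" "ring.zero (free_alg G) = 0" "ring.add (free_alg G) = (+)"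
    by (auto simp: free_alg_def ring_of_type_algebra_def)
  show ?thesis
  proof (rule idealI)
    show "subgroup (I \<inter> carrier (free_alg G)) (add_monoid (free_alg G))"
    proof (rule group.subgroupI)
      show "group (add_monoid (free_alg G))"
        by (intro abelian_group.a_group ring.is_abelian_group ring_free_alg)
    next
      fix x assume x: "x \<in> I \<inter> carrier (free_alg G)"
      have "\<ominus>\<^bsub>free_alg G\<^esub> x = - x"
        using x free_alg_closed(7)[of x G]
        by (intro abelian_group.minus_equality ring.is_abelian_group ring_free_alg) (auto simp: ops)
      then show "inv\<^bsub>add_monoid (free_alg G)\<^esub> x \<in> I \<inter> carrier (free_alg G)"
        using x neg free_alg_closed(7)[of x G] by (simp add: a_inv_def)
    next
      show "I \<inter> carrier (free_alg G) \<noteq> {}"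
        using zero free_alg_closed(3)[of G] by blast
    qed (use add free_alg_closed(5) in \<open>auto simp: ops\<close>)
  qed (use lmult rmult free_alg_closed(8) ring_free_alg in \<open>auto simp: ops\<close>)
qed

section \<open>A module detecting the relations of the negative part\<close>

text \<open>Functions on pairs of a word \<open>w\<close> and an exponent vector \<open>\<mu>\<close>, standing for
  \<open>F\<^sub>w K\<^sub>\<mu>\<close>. They are dual to the universal Verma-type module of the quantum group without the
  Serre relations for the \<open>F\<^sub>i\<close>, hence carry a right action.\<close>

type_synonym ('g, 'k) wfun = "nat list \<Rightarrow> (nat \<Rightarrow> int) \<Rightarrow> ('g, 'k) falg"

text \<open>The weight of a word: K_i F_w = q^{-cw i w} F_w K_i.\<close>

definition cw :: "nat \<Rightarrow> nat list \<Rightarrow> int" where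
  "cw i w = sum_list (map (cartan i) w)"

lemma cw_simps [simp]: "cw i [] = 0" "cw i (j # w) = cartan i j + cw i w" "cw i (u @ w) = cw i u + cw i w"
  by (simp_all add: cw_def)

definition Sc :: "'k::field \<Rightarrow> ('g, 'k) wfun \<Rightarrow> ('g, 'k) wfun" where
  "Sc c f = (\<lambda>w \<mu>. fconst c * f w \<mu>)"

text \<open>The operators \<open>Fa\<close>, \<open>Ka\<close>, \<open>Ea\<close> are transposes of
  left multiplication: \<open>Fa j f\<close> sends v to f(F_j v), and likewise for K_i^e and E_i. In
  \<open>Ka\<close> the scalar arises from moving K_i^e past F_w.\<close>

definition Fa :: "nat \<Rightarrow> ('g, 'k::field) wfun \<Rightarrow> ('g, 'k) wfun" where
  "Fa j f = (\<lambda>w. f (j # w))"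

definition Ka :: "'k::field \<Rightarrow> nat \<Rightarrow> int \<Rightarrow> ('g, 'k) wfun \<Rightarrow> ('g, 'k) wfun" where
  "Ka q i e f = (\<lambda>w \<mu>. fconst (q powi (- e * cw i w)) * f w (\<mu>(i := \<mu> i + e)))"

text \<open>This is f applied to E_i F_w K_mu, computed by moving E_i to the right past the letters
  of w. The empty word is the highest weight vector, killed by E_i.\<close>

primrec Ew :: "'k::field \<Rightarrow> nat \<Rightarrow> nat list \<Rightarrow> ('g, 'k) wfun \<Rightarrow> (nat \<Rightarrow> int) \<Rightarrow> ('g, 'k) falg" where
  "Ew q i [] f = 0"
| "Ew q i (j # w) f = Ew q i w (Fa j f) +
     (if i = j then Sc (1 / (q - inverse q)) (Ka q i 1 f - Ka q i (-1) f) w else 0)"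

definition Ea :: "'k::field \<Rightarrow> nat \<Rightarrow> ('g, 'k) wfun \<Rightarrow> ('g, 'k) wfun" where
  "Ea q i f = (\<lambda>w. Ew q i w f)"

lemma fconst_fconst: "fconst a * (fconst b * x) = fconst (a * b) * (x :: ('g, 'k::field) falg)"
  by (simp only: fconst_simps(3) mult.assoc)

lemma Sc_lin: "Sc c (f + g) = Sc c f + Sc c g" "Sc c (f - g) = Sc c f - Sc c g" "Sc c (- f) = - Sc c f" "Sc c 0 = 0"
  by (auto simp: Sc_def fun_eq_iff algebra_simps)

lemma Sc_Sc: "Sc c (Sc d f) = Sc (c * d) f"
  by (rule ext)+ (simp add: Sc_def fconst_fconst)

lemma Sc_scalar:
  "Sc (c + d) f = Sc c f + Sc d f" "Sc (c - d) f = Sc c f - Sc d f" "Sc (- c) f = - Sc c f"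
  "Sc 0 f = 0" "Sc 1 f = f"
  by (auto simp: Sc_def fun_eq_iff fconst_simps algebra_simps)

lemma Fa_lin: "Fa j (f + g) = Fa j f + Fa j g" "Fa j (f - g) = Fa j f - Fa j g" "Fa j 0 = 0" "Fa j (Sc c f) = Sc c (Fa j f)"
  by (auto simp: Fa_def Sc_def fun_eq_iff)

lemma Ka_lin: "Ka q i e (f + g) = Ka q i e f + Ka q i e g" "Ka q i e (f - g) = Ka q i e f - Ka q i e g"
  "Ka q i e 0 = 0"
  by (auto simp: Ka_def fun_eq_iff algebra_simps)

lemma Ka_Sc: "Ka q i e (Sc c f) = Sc c (Ka q i e f)"
  by (rule ext)+ (simp add: Ka_def Sc_def fconst_fconst mult.commute)

lemma Ew_lin: "Ew q i w (f + g) = Ew q i w f + Ew q i w g" "Ew q i w (f - g) = Ew q i w f - Ew q i w g"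
  "Ew q i w 0 = 0"
  by (induction w arbitrary: f g) (simp_all add: Fa_lin Sc_lin Ka_lin)

lemma Ea_lin: "Ea q i (f + g) = Ea q i f + Ea q i g" "Ea q i (f - g) = Ea q i f - Ea q i g" "Ea q i 0 = 0"
  by (auto simp: Ea_def fun_eq_iff Ew_lin)

lemma Ea_Sc: "Ea q i (Sc c f) = Sc c (Ea q i f)"
proof -
  have "Ew q i w (Sc c f) \<mu> = fconst c * Ew q i w f \<mu>" for w \<mu>
  proof (induction w arbitrary: f)
    case Nil
    show ?case by simp
  next
    case (Cons j w)
    let ?D = "\<lambda>f. if i = j then Sc (1 / (q - inverse q)) (Ka q i 1 f - Ka q i (- 1) f) else 0"
    have D: "?D (Sc c f) = Sc c (?D f)"
      by (simp only: Ka_Sc Sc_Sc Sc_lin mult.commute if_distrib[of "Sc c"])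
    have "Ew q i (j # w) (Sc c f) \<mu> = Ew q i w (Sc c (Fa j f)) \<mu> + ?D (Sc c f) w \<mu>"
      by (simp add: Fa_lin)
    also have "\<dots> = fconst c * Ew q i w (Fa j f) \<mu> + fconst c * ?D f w \<mu>"
      unfolding D Cons by (simp only: Sc_def)
    finally show ?case by (simp add: distrib_left)
  qed
  then have "Ea q i (Sc c f) w \<mu> = Sc c (Ea q i f) w \<mu>" for w \<mu>
    by (simp only: Ea_def Sc_def[of c "\<lambda>w. Ew q i w f"])
  then show ?thesis by (intro ext)
qed

text \<open>Transposed form of the relation for E_i F_m - F_m E_i. Together with
  \<open>Ea_Nil\<close> it permits inductions on the word that never unfold
  \<open>Ew\<close>.\<close>

lemma Fa_Ea: "Fa m (Ea q i f) =
    Ea q i (Fa m f) + (if i = m then Sc (1 / (q - inverse q)) (Ka q i 1 f - Ka q i (-1) f) else 0)"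
proof (intro ext)
  fix w \<mu>
  have "Fa m (Ea q i f) w \<mu> = Ew q i (m # w) f \<mu>" by (simp add: Fa_def Ea_def)
  then show "Fa m (Ea q i f) w \<mu> = (Ea q i (Fa m f) +
      (if i = m then Sc (1 / (q - inverse q)) (Ka q i 1 f - Ka q i (-1) f) else 0)) w \<mu>"
    by (simp add: Ea_def)
qed

lemma Ea_Nil [simp]: "Ea q i f [] = 0"
  by (simp add: Ea_def)

lemma wfun_Cons: "f (m # w) = Fa m f w"
  by (simp add: Fa_def)

locale quantum =
  fixes q :: "'k::field"
  assumes q0: "q \<noteq> 0"
begin

abbreviation "cq \<equiv> 1 / (q - inverse q)"

text \<open>Powers of q are kept apart from the other scalars so that rewriting can add their
  exponents.\<close>

definition Qs :: "int \<Rightarrow> ('g, 'k) wfun \<Rightarrow> ('g, 'k) wfun" where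
  "Qs a = Sc (q powi a)"

lemma Sc_Qs: "Sc cq (Qs a f) = Qs a (Sc cq f)"
  by (simp add: Qs_def Sc_Sc mult.commute)

lemma Qs_lin: "Qs a (f + g) = Qs a f + Qs a g" "Qs a (f - g) = Qs a f - Qs a g" "Qs a 0 = 0"
  "Fa j (Qs a f) = Qs a (Fa j f)" "Ka q i e (Qs a f) = Qs a (Ka q i e f)" "Ea q i (Qs a f) = Qs a (Ea q i f)"
  by (simp_all add: Qs_def Sc_lin Fa_lin Ka_Sc Ea_Sc)

lemma Qs_Qs: "Qs a (Qs b f) = Qs (a + b) f"
  by (simp add: Qs_def Sc_Sc q0 power_int_add)

lemma Qs_0: "Qs 0 f = f"
  by (simp add: Qs_def Sc_scalar)

lemma fconst_powi: "fconst (q powi a) * (fconst (q powi b) * x) = fconst (q powi (a + b)) * (x :: ('g, 'k) falg)"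
  by (simp only: fconst_fconst power_int_add[OF disjI1[OF q0]])

lemma Fa_Ka: "Fa m (Ka q i e f) = Qs (- e * cartan i m) (Ka q i e (Fa m f))"
  by (rule ext)+ (simp only: Fa_def Ka_def Qs_def Sc_def fconst_powi cw_simps distrib_left)

lemma Ka_Ka: "Ka q i e (Ka q j d f) = Ka q j d (Ka q i e f)"
proof (intro ext)
  fix w \<mu>
  have "\<mu>(i := \<mu> i + e, j := (\<mu>(i := \<mu> i + e)) j + d) = \<mu>(j := \<mu> j + d, i := (\<mu>(j := \<mu> j + d)) i + e)"
    by auto
  then show "Ka q i e (Ka q j d f) w \<mu> = Ka q j d (Ka q i e f) w \<mu>"
    by (simp only: Ka_def fconst_powi add.commute)
qed

lemma Ka_inverse: "Ka q i e (Ka q i (- e) f) = f"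
proof (intro ext)
  fix w \<mu>
  have "\<mu>(i := \<mu> i + e, i := (\<mu>(i := \<mu> i + e)) i + - e) = \<mu>" by auto
  then show "Ka q i e (Ka q i (- e) f) w \<mu> = f w \<mu>"
    by (simp only: Ka_def fconst_powi) (simp add: fconst_simps(6))
qed

lemma Ea_Ka: "Ea q j (Ka q i e f) = Qs (e * cartan i j) (Ka q i e (Ea q j f))"
proof -
  have "Ea q j (Ka q i e f) w = Qs (e * cartan i j) (Ka q i e (Ea q j f)) w" for w and f :: "('g, 'k) wfun"
  proof (induction w arbitrary: f)
    case Nil
    show ?case by (intro ext) (simp add: Qs_def Sc_def Ka_def)
  next
    case (Cons m w)
    define D where "D = (if j = m then Sc cq (Ka q j 1 (Ka q i e f) - Ka q j (-1) (Ka q i e f)) else 0)"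
    have L: "Fa m (Ea q j (Ka q i e f)) = Qs (- e * cartan i m) (Ea q j (Ka q i e (Fa m f))) + D"
      by (simp add: Fa_Ea Fa_Ka Qs_lin D_def)
    have R: "Fa m (Qs (e * cartan i j) (Ka q i e (Ea q j f)))
        = Qs (- e * cartan i m) (Qs (e * cartan i j) (Ka q i e (Ea q j (Fa m f)))) + D"
      by (simp add: Fa_Ea Fa_lin Fa_Ka Ka_lin Ka_Sc Sc_lin Qs_lin Qs_Qs Qs_0 Sc_Qs Ka_Ka D_def)
    have "Qs c (Ea q j (Ka q i e (Fa m f))) w = Qs c (Qs (e * cartan i j) (Ka q i e (Ea q j (Fa m f)))) w" for c
      using Cons[of "Fa m f"] by (simp add: Qs_def[of c] Sc_def[of "q powi c"])
    then show ?case by (simp only: wfun_Cons[of "Ea q j (Ka q i e f)"] wfun_Cons[of "Qs _ _"] L R plus_fun_apply)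
  qed
  then show ?thesis by blast
qed

text \<open>The commutator of E_i and E_j commutes with every F_m and kills the highest weight
  vector, so it vanishes on each word by induction.\<close>

lemma Ea_commuting:
  assumes "cartan i j = 0" "cartan j i = 0"
  shows "Ea q i (Ea q j f) = Ea q j (Ea q i f)"
proof -
  have "(Ea q i (Ea q j f) - Ea q j (Ea q i f)) w = 0" for w and f :: "('g, 'k) wfun"
  proof (induction w arbitrary: f)
    case Nil
    show ?case by simp
  next
    case (Cons m w)
    have "Fa m (Ea q i (Ea q j f) - Ea q j (Ea q i f))
        = Ea q i (Ea q j (Fa m f)) - Ea q j (Ea q i (Fa m f))"
      using assms by (cases "i = m"; cases "j = m") (simp_all add: Fa_Ea Fa_lin Ea_lin Ea_Sc Ea_Ka Qs_0)
    with Cons[of "Fa m f"] show ?case by (simp only: wfun_Cons[of "_ - _"])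
  qed
  then have "Ea q i (Ea q j f) - Ea q j (Ea q i f) = 0" by - (rule ext, simp only: zero_fun_apply)
  then show ?thesis by simp
qed

text \<open>Transposition reverses products, so \<open>b (a (a f))\<close> stands for the product a
  a b. The coefficient q + q^{-1} is split into two powers of q.\<close>

definition serre_op :: "((('g, 'k) wfun \<Rightarrow> ('g, 'k) wfun) \<Rightarrow> (('g, 'k) wfun \<Rightarrow> ('g, 'k) wfun) \<Rightarrow> ('g, 'k) wfun \<Rightarrow> ('g, 'k) wfun)"
  where "serre_op a b f = b (a (a f)) - (Qs 1 (a (b (a f))) + Qs (-1) (a (b (a f)))) + a (a (b f))"

lemmas op_simps = Fa_Ea Fa_lin Fa_Ka Ea_lin Ea_Sc Ea_Ka Ka_lin Ka_Sc Sc_lin Qs_lin Qs_Qs Sc_Qs Qs_0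

lemma Fa_serre_Ea:
  assumes "cartan i j = -1" "cartan j i = -1"
  shows "Fa m (serre_op (Ea q i) (Ea q j) f) = serre_op (Ea q i) (Ea q j) (Fa m f)"
proof -
  have "i \<noteq> j" using assms by (auto simp: cartan_def)
  moreover have "cartan i i = 2" "cartan j j = 2" by (simp_all add: cartan_def)
  ultimately show ?thesis using assms
    by (cases "i = m"; cases "j = m") (simp_all add: serre_op_def op_simps algebra_simps)
qed

text \<open>The Serre element in the E's commutes with every F_m by \<open>Fa_serre_Ea\<close> and
  kills the highest weight vector. So these Serre relations hold on the whole module.\<close>

lemma Ea_serre:
  assumes "cartan i j = -1" "cartan j i = -1"
  shows "serre_op (Ea q i) (Ea q j) f = 0"
proof -
  have "serre_op (Ea q i) (Ea q j) f w = 0" for w and f :: "('g, 'k) wfun"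
  proof (induction w arbitrary: f)
    case Nil
    show ?case by (rule ext) (simp add: serre_op_def Qs_def Sc_def)
  next
    case (Cons m w)
    then show ?case by (simp only: wfun_Cons[of "serre_op _ _ _"] Fa_serre_Ea[OF assms])
  qed
  then show ?thesis by - (rule ext, simp only: zero_fun_apply)
qed

text \<open>The mirror image of \<open>Fa_serre_Ea\<close>. The Serre elements in the F's do not act
  as zero, since words are free, but commuting with all E_m makes the set of functions that they
  annihilate stable under the action.\<close>

lemma serre_Fa_Ea:
  assumes "cartan i j = -1" "cartan j i = -1"
  shows "serre_op (Fa i) (Fa j) (Ea q m f) = Ea q m (serre_op (Fa i) (Fa j) f)"
proof -
  have "i \<noteq> j" using assms by (auto simp: cartan_def)
  moreover have "cartan i i = 2" "cartan j j = 2" by (simp_all add: cartan_def)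
  ultimately show ?thesis using assms
    by (cases "i = m"; cases "j = m") (simp_all add: serre_op_def op_simps algebra_simps)
qed

lemma commuting_Fa_Ea:
  assumes "cartan i j = 0" "cartan j i = 0"
  shows "Fa i (Fa j (Ea q m f)) - Fa j (Fa i (Ea q m f)) = Ea q m (Fa i (Fa j f) - Fa j (Fa i f))"
proof -
  have "i \<noteq> j" using assms by (auto simp: cartan_def)
  then show ?thesis using assms by (cases "i = m"; cases "j = m") (simp_all add: op_simps)
qed

section \<open>The right action of the free algebra on functions\<close>

primrec actl :: "uq_gen \<Rightarrow> ('g, 'k) wfun \<Rightarrow> ('g, 'k) wfun" where
  "actl (GE i) = Ea q i"
| "actl (GF i) = Fa i"
| "actl (GK i) = Ka q i 1"
| "actl (GKi i) = Ka q i (-1)"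

lemma actl_lin: "actl g (f + h) = actl g f + actl g h" "actl g 0 = 0" "actl g (Sc c f) = Sc c (actl g f)"
  by (cases g; simp add: Ea_lin Ea_Sc Fa_lin Ka_lin Ka_Sc)+

lemma fold_actl_lin:
  "fold actl v (f + h) = fold actl v f + fold actl v h" "fold actl v 0 = 0"
  "fold actl v (Sc c f) = Sc c (fold actl v f)"
  by (induction v arbitrary: f h) (simp_all add: actl_lin)

definition act :: "(uq_gen, 'k) falg \<Rightarrow> ('g, 'k) wfun \<Rightarrow> ('g, 'k) wfun" where
  "act p f = (\<lambda>w \<mu>. \<Sum>v\<in>Poly_Mapping.keys p. fscale (Poly_Mapping.lookup p v) (fold actl (letters v) f w \<mu>))"

lemma act_single: "act (Poly_Mapping.single v c) f = Sc c (fold actl (letters v) f)"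
  by (intro ext) (simp add: act_def Sc_def fconst_simps)

lemma act_add_left: "act (x + y) f = act x f + act y f"
proof (intro ext)
  fix w \<mu>
  let ?A = "Poly_Mapping.keys x \<union> Poly_Mapping.keys y"
  let ?g = "\<lambda>p v. fscale (Poly_Mapping.lookup p v) (fold actl (letters v) f w \<mu>)"
  have *: "act p f w \<mu> = (\<Sum>v\<in>?A. ?g p v)" if "Poly_Mapping.keys p \<subseteq> ?A" for p
    unfolding act_def using that
    by (intro sum.mono_neutral_left) (auto simp: not_in_keys_iff_lookup_eq_zero fconst_simps)
  show "act (x + y) f w \<mu> = (act x f + act y f) w \<mu>"
    using Poly_Mapping.keys_add[of x y]
    by (simp add: * lookup_add fconst_simps distrib_right sum.distrib)
qed

lemma act_zero_left: "act 0 f = 0"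
  by (intro ext) (simp add: act_def)

lemma act_add: "act x (f + h) = act x f + act x h"
  by (intro ext) (simp add: act_def fold_actl_lin distrib_left sum.distrib)

lemma act_Sc: "act x (Sc c f) = Sc c (act x f)"
proof (induction x rule: poly_mapping_induct_single)
  case (add x y)
  then show ?case by (simp only: act_add_left Sc_lin)
qed (simp_all only: act_zero_left Sc_lin act_single fold_actl_lin Sc_Sc mult.commute)

lemma act_zero: "act x 0 = 0"
  using act_Sc[of x 0 0] by (simp add: Sc_scalar)

lemma act_mult: "act (x * y) f = act y (act x f)"
proof (induction x rule: poly_mapping_induct_single)
  case (single w c)
  show ?case
  proof (induction y rule: poly_mapping_induct_single)
    case (add y z)
    then show ?case by (simp only: distrib_left act_add_left)
  qed (simp_all add: act_zero_left mult_single act_single fold_actl_lin plus_fmon_def Sc_Sc mult.commute)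
next
  case (add x z)
  then show ?case by (simp only: distrib_right act_add_left act_add)
qed (simp only: act_zero_left act_zero mult_zero_left)

lemma act_fgen: "act (fgen g) f = actl g f"
  by (simp add: fgen_def act_single Sc_scalar)

lemma act_fconst: "act (fconst c) f = Sc c f"
  by (simp add: fconst_def act_single zero_fmon_def)

lemma act_one: "act 1 f = f"
  using act_fconst[of 1 f] by (simp add: fconst_simps Sc_scalar)

lemma act_minus_left: "act (- x) f = - act x f"
  using act_add_left[of "- x" x f] by (simp add: act_zero_left eq_neg_iff_add_eq_0)

lemma act_diff_left: "act (x - y) f = act x f - act y f"
  using act_add_left[of x "- y" f] by (simp add: act_minus_left)

lemmas act_simps = act_add_left act_diff_left act_minus_left act_zero_left act_mult act_fgen act_fconst act_one

end

section \<open>Functions orthogonal to the Serre relations modulo a subspace\<close>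

lemma cartan_sym: "cartan i j = cartan j i"
  by (auto simp: cartan_def)

text \<open>L will be the span of the terms with fewer letters: only modulo such terms do the
  relations of the coideal subalgebra agree with the Serre relations.\<close>

locale perp_space = quantum q for q :: "'k::field" +
  fixes n :: nat and L :: "('g, 'k) falg set"
  assumes L: "falg.subspace L"
begin

definition Lval :: "('g, 'k) wfun \<Rightarrow> bool" where
  "Lval f \<longleftrightarrow> (\<forall>w \<mu>. f w \<mu> \<in> L)"

definition base :: "('g, 'k) wfun \<Rightarrow> bool" where
  "base f \<longleftrightarrow> (\<forall>i\<in>{1..n}. \<forall>j\<in>{1..n}.
     (cartan i j = 0 \<longrightarrow> Lval (Fa i (Fa j f) - Fa j (Fa i f))) \<and>
     (cartan i j = -1 \<longrightarrow> Lval (serre_op (Fa i) (Fa j) f)))"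

text \<open>Says that f sends F_u S F_w K_mu into L for every Serre element S in the F's: the prefix
  u enters through \<open>fold\<close>, the suffix w and mu through \<open>Lval\<close>.\<close>

definition perp :: "('g, 'k) wfun \<Rightarrow> bool" where
  "perp f \<longleftrightarrow> (\<forall>u. base (fold Fa u f))"

lemma Lval_add: "Lval f \<Longrightarrow> Lval h \<Longrightarrow> Lval (f + h)"
  and Lval_diff: "Lval f \<Longrightarrow> Lval h \<Longrightarrow> Lval (f - h)"
  and Lval_zero: "Lval 0"
  and Lval_Sc: "Lval f \<Longrightarrow> Lval (Sc c f)"
  and Lval_Qs: "Lval f \<Longrightarrow> Lval (Qs a f)"
  and Lval_Fa: "Lval f \<Longrightarrow> Lval (Fa i f)"
  and Lval_Ka: "Lval f \<Longrightarrow> Lval (Ka q i e f)"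
  using falg.subspace_add[OF L] falg.subspace_diff[OF L] falg.subspace_0[OF L] falg.subspace_scale[OF L]
  by (auto simp: Lval_def Sc_def Qs_def Fa_def Ka_def)

lemma Lval_Ea: "Lval f \<Longrightarrow> Lval (Ea q i f)"
proof -
  have "Ew q i w f \<mu> \<in> L" if "Lval f" for w \<mu> and f :: "('g, 'k) wfun"
    using that
  proof (induction w arbitrary: f)
    case Nil
    show ?case by (simp add: falg.subspace_0[OF L])
  next
    case (Cons j w)
    have "Lval (Sc cq (Ka q i 1 f - Ka q i (-1) f))"
      by (intro Lval_Sc Lval_diff Lval_Ka Cons.prems)
    then have "(if i = j then Sc cq (Ka q i 1 f - Ka q i (-1) f) w else 0) \<mu> \<in> L"
      using falg.subspace_0[OF L] by (cases "i = j") (auto simp: Lval_def)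
    with Cons.IH[OF Lval_Fa[OF Cons.prems]] show ?case
      using falg.subspace_add[OF L] by simp
  qed
  then show "Lval f \<Longrightarrow> Lval (Ea q i f)" by (simp add: Lval_def Ea_def)
qed

lemma base_add: assumes "base f" "base h" shows "base (f + h)"
proof -
  have "serre_op (Fa i) (Fa j) (f + h) = serre_op (Fa i) (Fa j) f + serre_op (Fa i) (Fa j) h" for i j
    by (simp add: serre_op_def Fa_lin Qs_lin algebra_simps)
  moreover have "Fa i (Fa j (f + h)) - Fa j (Fa i (f + h)) =
      (Fa i (Fa j f) - Fa j (Fa i f)) + (Fa i (Fa j h) - Fa j (Fa i h))" for i j
    by (simp add: Fa_lin algebra_simps)
  ultimately show ?thesis using assms unfolding base_def by (metis Lval_add)
qed

lemma base_Sc: assumes "base f" shows "base (Sc c f)"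
proof -
  have Q: "Qs a (Sc c h) = Sc c (Qs a h)" for a h
    by (simp add: Qs_def Sc_Sc mult.commute)
  have "serre_op (Fa i) (Fa j) (Sc c f) = Sc c (serre_op (Fa i) (Fa j) f)" for i j
    by (simp add: serre_op_def Fa_lin Q Sc_lin)
  moreover have "Fa i (Fa j (Sc c f)) - Fa j (Fa i (Sc c f)) = Sc c (Fa i (Fa j f) - Fa j (Fa i f))" for i j
    by (simp add: Fa_lin Sc_lin)
  ultimately show ?thesis using assms unfolding base_def by (metis Lval_Sc)
qed

lemma base_Ka: assumes "base f" shows "base (Ka q m e f)"
proof -
  have "serre_op (Fa i) (Fa j) (Ka q m e f) =
      Qs (- (e * (2 * cartan m i + cartan m j))) (Ka q m e (serre_op (Fa i) (Fa j) f))" for i j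
    by (simp add: serre_op_def Fa_Ka Fa_lin Ka_lin Qs_lin Qs_Qs distrib_left add_ac mult.left_commute)
  moreover have "Fa i (Fa j (Ka q m e f)) - Fa j (Fa i (Ka q m e f)) =
      Qs (- (e * (cartan m i + cartan m j))) (Ka q m e (Fa i (Fa j f) - Fa j (Fa i f)))" for i j
    by (simp add: Fa_Ka Fa_lin Ka_lin Qs_lin Qs_Qs algebra_simps)
  ultimately show ?thesis using assms unfolding base_def by (metis Lval_Ka Lval_Qs)
qed

lemma base_Ea: "base f \<Longrightarrow> base (Ea q m f)"
  unfolding base_def using serre_Fa_Ea[of _ _ m f] commuting_Fa_Ea[of _ _ m f] cartan_sym Lval_Ea
  by metis

lemma fold_Fa_lin: "fold Fa u (f + h) = fold Fa u f + fold Fa u h" "fold Fa u (Sc c f) = Sc c (fold Fa u f)"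
  "fold Fa u 0 = 0"
  by (induction u arbitrary: f h) (simp_all add: Fa_lin)

lemma perp_base: "perp f \<Longrightarrow> base f"
  unfolding perp_def by (metis fold_Nil id_apply)

lemma perp_Fa: "perp f \<Longrightarrow> perp (Fa m f)"
  unfolding perp_def by (metis comp_apply fold_Cons)

lemma perp_add: "perp f \<Longrightarrow> perp h \<Longrightarrow> perp (f + h)"
  by (simp add: perp_def fold_Fa_lin base_add)

lemma perp_Sc: "perp f \<Longrightarrow> perp (Sc c f)"
  by (simp add: perp_def fold_Fa_lin base_Sc)

lemma perp_diff: "perp f \<Longrightarrow> perp h \<Longrightarrow> perp (f - h)"
  using perp_add[of f "Sc (-1) h"] perp_Sc[of h "-1"] by (simp add: Sc_scalar)

lemma perp_zero: "perp 0"
  by (simp add: perp_def fold_Fa_lin base_def serre_op_def Fa_lin Qs_lin Lval_zero)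

lemma perp_Ka: assumes "perp f" shows "perp (Ka q m e f)"
proof -
  have "fold Fa u (Ka q m e f) = Qs (- e * cw m u) (Ka q m e (fold Fa u f))" for u
  proof (induction u arbitrary: f)
    case (Cons i u)
    have "fold Fa u (Qs a h) = Qs a (fold Fa u h)" for a and h :: "('g, 'k) wfun"
      by (simp add: Qs_def fold_Fa_lin)
    then show ?case using Cons by (simp add: Fa_Ka Qs_Qs algebra_simps)
  qed (simp add: Qs_0)
  then show ?thesis using assms by (simp add: perp_def Qs_def base_Sc base_Ka)
qed

text \<open>Moving E_m past the prefix u leaves K terms, which preserve \<open>perp\<close>; what
  then reaches the Serre element passes it by \<open>base_Ea\<close>.\<close>

lemma perp_Ea: assumes "perp f" shows "perp (Ea q m f)"
proof -
  have "base (fold Fa u (Ea q m f))" for u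
    using assms
  proof (induction u arbitrary: f)
    case Nil
    then show ?case by (simp add: base_Ea perp_base)
  next
    case (Cons i u)
    have "perp (if m = i then Sc cq (Ka q m 1 f - Ka q m (-1) f) else 0)"
      using Cons.prems by (simp add: perp_zero perp_Sc perp_diff perp_Ka)
    then show ?case using Cons.IH[OF perp_Fa[OF Cons.prems, of i]]
      by (simp only: fold_Cons comp_apply Fa_Ea fold_Fa_lin perp_def base_add)
  qed
  then show ?thesis by (simp add: perp_def)
qed

lemma perp_act: "perp f \<Longrightarrow> perp (act x f)"
proof (induction x arbitrary: f rule: falg_induct)
  case (gen g)
  then show ?case by (cases g) (simp_all add: act_fgen perp_Ea perp_Fa perp_Ka)
qed (simp_all add: act_fconst perp_Sc act_add_left perp_add act_mult)

lemma Lval_act: "Lval f \<Longrightarrow> Lval (act x f)"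
proof (induction x arbitrary: f rule: falg_induct)
  case (gen g)
  then show ?case by (cases g) (simp_all add: act_fgen Lval_Ea Lval_Fa Lval_Ka)
qed (simp_all add: act_fconst Lval_Sc act_add_left Lval_add act_mult)

lemma act_fserre: "act (fserre q (fgen a) (fgen b)) f = serre_op (actl a) (actl b) f"
  by (simp add: fserre_def serre_op_def act_simps Sc_scalar Qs_def actl_lin)

lemma act_uq_rels:
  assumes "x \<in> uq_rels q n" "perp f"
  shows "Lval (act x f)"
  using assms(1) unfolding uq_rels_def
proof (elim UnE CollectE exE conjE, goal_cases)
  case (1 i)
  have "act x f = 0" using 1 Ka_inverse[of i "-1" f] by (simp add: act_simps)
  then show ?case by (simp add: Lval_zero)
next
  case (2 i)
  have "act x f = 0" using 2 Ka_inverse[of i 1 f] by (simp add: act_simps)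
  then show ?case by (simp add: Lval_zero)
next
  case (3 i j)
  then show ?case by (simp add: act_simps Lval_zero Ka_Ka)
next
  case (4 i j)
  have "act x f = 0" using 4 Ka_inverse[of i "-1" "Ea q j f"]
    by (simp add: act_simps Ea_Ka Qs_lin) (simp add: Qs_def Ea_Sc)
  then show ?case by (simp add: Lval_zero)
next
  case (5 i j)
  have "act x f = 0" using 5 Ka_inverse[of i "-1" "Fa j f"]
    by (simp add: act_simps Fa_Ka Qs_lin) (simp add: Qs_def Fa_lin)
  then show ?case by (simp add: Lval_zero)
next
  case (6 i j)
  then show ?case by (auto simp: act_simps Fa_Ea Lval_zero Ka_Sc Ka_lin Sc_lin)
next
  case (7 a i j)
  then show ?case using perp_base[OF assms(2)] cartan_sym[of i j]
    by (auto simp: act_simps Lval_zero base_def Ea_commuting)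
next
  case (8 a i j)
  then show ?case using perp_base[OF assms(2)] cartan_sym[of i j]
    by (auto simp: act_fserre Lval_zero base_def Ea_serre)
qed

text \<open>The elements that send \<open>perp\<close> functions to functions with values in L form
  a two-sided ideal. As the action is on the right, left multiples are covered by
  \<open>perp_act\<close> and right multiples by \<open>Lval_act\<close>.\<close>

lemma act_uq_ideal:
  assumes "x \<in> uq_ideal q n" "perp f"
  shows "Lval (act x f)"
proof -
  define I where "I = {x. \<forall>f. perp f \<longrightarrow> Lval (act x f)}"
  have "two_sided I"
    by unfold_locales (auto simp: I_def act_simps Lval_zero Lval_add perp_act Lval_act)
  then have "ideal (I \<inter> carrier (free_alg (uq_gens n))) (free_alg (uq_gens n))"
    by (rule two_sided_ideal)
  moreover have "uq_rels q n \<subseteq> I \<inter> carrier (free_alg (uq_gens n))"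
    using uq_rels_closed act_uq_rels by (auto simp: I_def)
  ultimately have "uq_ideal q n \<subseteq> I"
    unfolding uq_ideal_def using ring.genideal_minimal[OF ring_free_alg] by blast
  then show ?thesis using assms by (auto simp: I_def)
qed

end

section \<open>Generators and relations for the coideal subalgebra\<close>

datatype kgen = KB nat | KH nat

abbreviation kb :: "nat \<Rightarrow> (kgen, 'k::field) falg" where "kb j \<equiv> fgen (KB j)"
abbreviation kh :: "nat \<Rightarrow> (kgen, 'k::field) falg" where "kh j \<equiv> fgen (KH j)"
abbreviation bword :: "nat list \<Rightarrow> (kgen, 'k::field) falg" where "bword u \<equiv> prod_list (map kb u)"

locale aiii = quantum q for q :: "'k::field" +
  fixes n r :: nat
  assumes q_root: "\<forall>m::nat. m > 0 \<longrightarrow> q ^ m \<noteq> 1" and r2: "r \<ge> 2" and n_def: "n = 2 * r - 1"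
begin

abbreviation "tau \<equiv> dtau n"

lemma tau_props:
  "i \<in> {1..n} \<Longrightarrow> tau i \<in> {1..n}" "i \<in> {1..n} \<Longrightarrow> tau (tau i) = i" "tau r = r"
  "i \<in> {1..n} \<Longrightarrow> tau i < r \<longleftrightarrow> r < i" "i \<in> {1..n} \<Longrightarrow> tau i = r \<longleftrightarrow> i = r"
  using r2 by (auto simp: dtau_def n_def)

text \<open>Generators are indexed by all natural numbers; an index outside the diagram gets the
  value 0 or 1, and \<open>b_junk\<close> and \<open>h_junk\<close> record this among the
  relations.\<close>

definition kgen_img :: "kgen \<Rightarrow> (uq_gen, 'k) falg" where
  "kgen_img g = (case g of
     KB j \<Rightarrow> if j \<in> {1..n} then fgen (GF j) - fgen (GKi j) * fgen (GE (tau j)) else 0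
   | KH j \<Rightarrow> if j \<in> {1..n} then fgen (GK j) * fgen (GKi (tau j)) else 1)"

definition kimg :: "(kgen, 'k) falg \<Rightarrow> (uq_gen, 'k) falg" where
  "kimg = ev kgen_img"

text \<open>The exponent in \<open>h_b\<close> is the common weight of F_j and E_{tau j} under K_i
  K_{tau i}^{-1}. The corrections in \<open>b_comm\<close> and \<open>b_serre\<close> come from E_k
  F_k - F_k E_k: in the first the E part of one factor meets the F part of the other, in the second
  this happens only at the node r fixed by tau.\<close>

inductive_set krels :: "(kgen, 'k) falg set" where
  h_inv: "i \<in> {1..n} \<Longrightarrow> kh i * kh (tau i) - 1 \<in> krels"
| h_r: "kh r - 1 \<in> krels"
| h_comm: "i \<in> {1..n} \<Longrightarrow> j \<in> {1..n} \<Longrightarrow> kh i * kh j - kh j * kh i \<in> krels"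
| h_b: "i \<in> {1..n} \<Longrightarrow> j \<in> {1..n} \<Longrightarrow>
    kh i * kb j - fconst (q powi (cartan (tau i) j - cartan i j)) * (kb j * kh i) \<in> krels"
| b_comm: "i \<in> {1..n} \<Longrightarrow> j \<in> {1..n} \<Longrightarrow> cartan i j = 0 \<Longrightarrow>
    kb i * kb j - kb j * kb i - (if j = tau i then fconst cq * (kh i - kh j) else 0) \<in> krels"
| b_serre: "i \<in> {1..n} \<Longrightarrow> j \<in> {1..n} \<Longrightarrow> cartan i j = -1 \<Longrightarrow>
    fserre q (kb i) (kb j) + (if i = r then fconst (inverse q) * kb j else 0) \<in> krels"
| b_junk: "j \<notin> {1..n} \<Longrightarrow> kb j \<in> krels"
| h_junk: "j \<notin> {1..n} \<Longrightarrow> kh j - 1 \<in> krels"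

definition kker :: "(kgen, 'k) falg set" where
  "kker = {x. kimg x \<in> uq_ideal q n}"

definition hpow :: "nat \<Rightarrow> int \<Rightarrow> (kgen, 'k) falg" where
  "hpow j m = (if 0 \<le> m then kh j ^ nat m else kh (tau j) ^ nat (- m))"

end

section \<open>Normally ordered monomials and the filtration by the number of letters b\<close>

locale kideal = aiii q n r + two_sided I for q :: "'k::field" and n r and I :: "(kgen, 'k) falg set" +
  assumes krels: "krels \<subseteq> I"
begin

lemmas I_rels = krels.intros[THEN subsetD[OF krels]]
lemmas h_inv = I_rels(1) and h_r = I_rels(2) and h_comm = I_rels(3) and h_b = I_rels(4)
  and b_comm = I_rels(5) and b_serre = I_rels(6) and b_junk = I_rels(7) and h_junk = I_rels(8)

lemma M_h_commute: "M (kh i) (M (kh j) z) = M (kh j) (M (kh i) z)"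
proof -
  have triv: "M (kh i) z = nu z" if "i \<notin> {1..n}" for i z
    using M_eqD[OF h_junk[OF that]] by (simp add: M_poly)
  consider "i \<in> {1..n}" "j \<in> {1..n}" | "i \<notin> {1..n}" | "j \<notin> {1..n}" by blast
  then show ?thesis
  proof cases
    case 1
    then show ?thesis using M_eqD[OF h_comm[of i j]] by (simp only: M_poly)
  next
    case 2
    show ?thesis by (simp only: triv[OF 2] M_nu nu_M)
  next
    case 3
    show ?thesis by (simp only: triv[OF 3] M_nu nu_M)
  qed
qed

lemma M_h_inv: "i \<in> {1..n} \<Longrightarrow> M (kh i) (M (kh (tau i)) z) = nu z"
  using M_eqD[OF h_inv[of i]] by (simp only: M_poly)

lemma M_h_inv': "i \<in> {1..n} \<Longrightarrow> M (kh (tau i)) (M (kh i) z) = nu z"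
  using M_h_inv[of i] M_h_commute[of "tau i" i] by simp

text \<open>Exponents at 1, ..., r - 1 suffice, because h_r = 1 and h_{tau j} is the inverse of
  h_j.\<close>

definition hmon :: "(nat \<Rightarrow> int) \<Rightarrow> (kgen, 'k) falg" where
  "hmon \<mu> = prod_list (map (\<lambda>j. hpow j (\<mu> j)) [1..<r])"

lemma M_h_power: "M (kh i) (M (kh j ^ m) z) = M (kh j ^ m) (M (kh i) z)"
proof (induction m arbitrary: z)
  case (Suc m)
  then show ?case by (simp only: power_Suc M_poly(6) M_h_commute[of i j])
qed (simp add: M_poly nu_M M_nu)

lemma M_h_hpow: "M (kh i) (M (hpow j m) z) = M (hpow j m) (M (kh i) z)"
  by (simp add: hpow_def M_h_power)

lemma M_hpow_Suc: assumes "j \<in> {1..n}" shows "M (kh j) (M (hpow j m) z) = M (hpow j (m + 1)) z"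
proof (cases "0 \<le> m")
  case True
  then have "nat (m + 1) = Suc (nat m)" by simp
  then show ?thesis using True by (simp add: hpow_def M_poly)
next
  case False
  define k where "k = nat (- (m + 1))"
  have k: "nat (- m) = Suc k" "nat (- (m + 1)) = k" "m + 1 = 0 \<longleftrightarrow> k = 0"
    using False by (auto simp: k_def)
  show ?thesis
  proof (cases "k = 0")
    case True
    then have "m + 1 = 0" using k by simp
    then show ?thesis using k True False assms by (simp add: hpow_def M_poly M_h_inv M_nu)
  next
    case k0: False
    then have "\<not> 0 \<le> m + 1" using False k by linarith
    then show ?thesis using k False assms by (simp add: hpow_def M_poly M_h_inv nu_M)
  qed
qed

lemma M_hpow_pred: assumes "j \<in> {1..n}" shows "M (kh (tau j)) (M (hpow j m) z) = M (hpow j (m - 1)) z"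
proof -
  have "M (kh (tau j)) (M (hpow j m) z) = M (kh (tau j)) (M (kh j) (M (hpow j (m - 1)) z))"
    using M_hpow_Suc[OF assms, of "m - 1"] by simp
  then show ?thesis by (simp add: M_h_inv'[OF assms] nu_M)
qed

lemma M_h_hprod:
  assumes g: "\<And>z. M (kh g) (M (hpow i (\<mu> i)) z) = M (hpow i (\<mu> i + e)) z"
    and xs: "distinct xs" "i \<in> set xs"
  shows "M (kh g) (M (prod_list (map (\<lambda>j. hpow j (\<mu> j)) xs)) z)
       = M (prod_list (map (\<lambda>j. hpow j ((\<mu>(i := \<mu> i + e)) j)) xs)) z"
  using xs
proof (induction xs)
  case (Cons a xs)
  show ?case
  proof (cases "a = i")
    case True
    then have eq: "map (\<lambda>j. hpow j ((\<mu>(i := \<mu> i + e)) j)) xs = map (\<lambda>j. hpow j (\<mu> j)) xs"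
      using Cons.prems by (intro map_cong) auto
    show ?thesis
      unfolding list.map prod_list.Cons M_poly(6) eq True fun_upd_same g by (rule refl)
  next
    case False
    then show ?thesis using Cons by (simp add: M_poly M_h_hpow)
  qed
qed simp

lemma M_h_hmon: "\<exists>\<mu>'. \<forall>z. M (kh i) (M (hmon \<mu>) z) = M (hmon \<mu>') z"
proof -
  consider "i \<notin> {1..n} \<or> i = r" | "i \<in> {1..<r}" | "i \<in> {r<..n}" by force
  then show ?thesis
  proof cases
    case 1
    have "kh i - 1 \<in> I" using 1 h_r h_junk by auto
    then have "M (kh i) z = nu z" for z using M_eqD[of "kh i" 1] by (simp add: M_poly)
    then show ?thesis by (intro exI[of _ \<mu>]) (simp add: nu_M)
  next
    case 2
    then have "i \<in> {1..n}" by (auto simp: n_def)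
    with 2 have "M (kh i) (M (hmon \<mu>) z) = M (hmon (\<mu>(i := \<mu> i + 1))) z" for z
      unfolding hmon_def by (intro M_h_hprod M_hpow_Suc) auto
    then show ?thesis by blast
  next
    case 3
    then have i: "i \<in> {1..n}" "tau i \<in> {1..n}" by (auto simp: dtau_def)
    moreover have "tau i \<in> {1..<r}" using tau_props(4)[OF i(1)] i 3 by auto
    ultimately have "M (kh i) (M (hmon \<mu>) z) = M (hmon (\<mu>(tau i := \<mu> (tau i) + - 1))) z" for z
      unfolding hmon_def using M_hpow_pred[OF i(2)] tau_props(2)[OF i(1)] by (intro M_h_hprod) auto
    then show ?thesis by blast
  qed
qed

lemma M_h_bword: "\<exists>c. \<forall>z. M (kh i) (M (bword u) z) = M (fconst c) (M (bword u) (M (kh i) z))"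
proof (induction u)
  case Nil
  show ?case by (intro exI[of _ 1]) (simp add: fconst_simps(6) M_poly M_nu nu_M)
next
  case (Cons j u)
  then obtain c where c: "\<And>z. M (kh i) (M (bword u) z) = M (fconst c) (M (bword u) (M (kh i) z))" by blast
  have "\<exists>d. \<forall>z. M (kh i) (M (kb j) z) = M (fconst d) (M (kb j) (M (kh i) z))"
  proof -
    consider "j \<notin> {1..n}" | "i \<notin> {1..n}" | "i \<in> {1..n}" "j \<in> {1..n}" by blast
    then show ?thesis
    proof cases
      case 1
      then have "M (kb j) z = 0" for z using M_eqD[of "kb j" 0] b_junk by (simp add: M_poly)
      then show ?thesis by (simp add: M_arg)
    next
      case 2
      then have "M (kh i) z = nu z" for z using M_eqD[of "kh i" 1] h_junk by (simp add: M_poly)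
      then show ?thesis by (intro exI[of _ 1]) (simp add: fconst_simps(6) M_poly M_nu nu_M)
    next
      case 3
      from M_eqD[OF h_b[OF this]] show ?thesis by (simp add: M_poly) blast
    qed
  qed
  then obtain d where d: "\<And>z. M (kh i) (M (kb j) z) = M (fconst d) (M (kb j) (M (kh i) z))" by blast
  show ?case
    by (intro exI[of _ "d * c"]) (simp add: M_poly d c M_fconst_commute[of "kb j"] M_fconst_mult)
qed

text \<open>Only letters b count for the degree. Since I is included, the descending argument in
  \<open>kker_subset\<close> ends at \<open>Lspan 0\<close> = I.\<close>

definition Lspan :: "nat \<Rightarrow> (kgen, 'k) falg set" where
  "Lspan d = falg.span (I \<union> {bword u * hmon \<mu> | u \<mu>. set u \<subseteq> {1..n} \<and> length u < d})"

lemma Lspan_subspace: "falg.subspace (Lspan d)"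
  unfolding Lspan_def by (rule falg.subspace_span)

lemmas Lspan_add = falg.subspace_add[OF Lspan_subspace]
  and Lspan_diff = falg.subspace_diff[OF Lspan_subspace]
  and Lspan_scale = falg.subspace_scale[OF Lspan_subspace]
  and Lspan_zero = falg.subspace_0[OF Lspan_subspace]

lemma I_Lspan: "x \<in> I \<Longrightarrow> x \<in> Lspan d"
  unfolding Lspan_def by (rule falg.span_base) simp

lemma Lspan_mono: "d \<le> e \<Longrightarrow> Lspan d \<subseteq> Lspan e"
  unfolding Lspan_def by (rule falg.span_mono) auto

lemma Lspan_0: "Lspan 0 = I"
  unfolding Lspan_def using falg.span_eq_iff[THEN iffD2, OF subspace] by simp

lemma Lspan_cong: "x \<in> Lspan d \<Longrightarrow> y - x \<in> I \<Longrightarrow> y \<in> Lspan d"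
  using Lspan_add[of x d "y - x"] I_Lspan by simp

lemma prod_list_I: "a \<in> set xs \<Longrightarrow> a \<in> I \<Longrightarrow> prod_list xs \<in> I"
  by (induction xs) (auto intro: lmult rmult)

lemma bword_hmon: assumes "length u < d" shows "bword u * hmon \<mu> \<in> Lspan d"
proof (cases "set u \<subseteq> {1..n}")
  case True
  then show ?thesis unfolding Lspan_def using assms by (intro falg.span_base) blast
next
  case False
  then obtain j where "j \<in> set u" "j \<notin> {1..n}" by blast
  then have "bword u \<in> I" by (intro prod_list_I[of "kb j"] b_junk) auto
  then show ?thesis by (intro I_Lspan rmult)
qed

lemma h_bword_hmon: "\<exists>c \<mu>'. kh i * (bword u * hmon \<mu>) - fconst c * (bword u * hmon \<mu>') \<in> I"
proof -
  obtain c where c: "\<And>z. M (kh i) (M (bword u) z) = M (fconst c) (M (bword u) (M (kh i) z))"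
    using M_h_bword by blast
  obtain \<mu>' where \<mu>': "\<And>z. M (kh i) (M (hmon \<mu>) z) = M (hmon \<mu>') z"
    using M_h_hmon by blast
  have "kh i * (bword u * hmon \<mu>) - fconst c * (bword u * hmon \<mu>') \<in> I"
    by (rule M_eqI) (simp only: M_poly c \<mu>')
  then show ?thesis by blast
qed

text \<open>The right side of \<open>b_comm\<close> leaves a letter h inside a word; moving it to
  the end changes only a scalar and the exponents of the h part.\<close>

lemma bword_h_bword_hmon:
  assumes "length u + length w < d"
  shows "bword u * (kh i * (bword w * hmon \<mu>)) \<in> Lspan d"
proof -
  obtain c \<mu>' where "kh i * (bword w * hmon \<mu>) - fconst c * (bword w * hmon \<mu>') \<in> I"
    using h_bword_hmon by blast
  then have "bword u * (kh i * (bword w * hmon \<mu>) - fconst c * (bword w * hmon \<mu>')) \<in> I"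
    by (rule lmult)
  then have "bword u * (kh i * (bword w * hmon \<mu>)) - fconst c * (bword (u @ w) * hmon \<mu>') \<in> I"
    using fconst_left_commute[of "bword u" c] by (simp add: right_diff_distrib mult.assoc)
  moreover have "fconst c * (bword (u @ w) * hmon \<mu>') \<in> Lspan d"
    using assms by (intro Lspan_scale bword_hmon) simp
  ultimately show ?thesis by (rule Lspan_cong[rotated])
qed

lemma Lspan_letter: assumes "x \<in> Lspan d" shows "fgen g * x \<in> Lspan (Suc d)"
  using assms unfolding Lspan_def[of d]
proof (induction rule: falg.span_induct_alt)
  case base
  show ?case by (simp add: Lspan_zero)
next
  case (step c x y)
  have "fgen g * x \<in> Lspan (Suc d)"
  proof (cases "x \<in> I")
    case True
    then show ?thesis by (intro I_Lspan lmult)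
  next
    case False
    then obtain u \<mu> where u: "x = bword u * hmon \<mu>" "length u < d" using step by blast
    show ?thesis
    proof (cases g)
      case (KB j)
      then show ?thesis using bword_hmon[of "j # u" "Suc d" \<mu>] u by (simp add: mult.assoc)
    next
      case (KH i)
      then show ?thesis using bword_h_bword_hmon[of "[]" u "Suc d" i \<mu>] u by simp
    qed
  qed
  then show ?case
    using step fconst_left_commute[of "fgen g" c x] by (simp add: distrib_left Lspan_add Lspan_scale)
qed

lemma in_Lspan: "\<exists>d. x \<in> Lspan d"
proof (induction x rule: poly_mapping_induct_single)
  case zero
  show ?case using Lspan_zero by blast
next
  case (single w c)
  have "fword u \<in> Lspan (Suc (length u))" for u
  proof (induction u)
    case Nil
    have "prod_list (map (\<lambda>j. hpow j 0) xs) = 1" for xs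
      by (induction xs) (simp_all add: hpow_def)
    then have "hmon (\<lambda>_. 0) = 1" by (simp add: hmon_def)
    then show ?case using bword_hmon[of "[]" "Suc 0" "\<lambda>_. 0"] by simp
  qed (simp add: Lspan_letter)
  then show ?case by (metis single_eq_fconst_fword Lspan_scale)
next
  case (add x y)
  then obtain d e where "x \<in> Lspan d" "y \<in> Lspan e" by blast
  then have "x + y \<in> Lspan (max d e)"
    using Lspan_mono[of d "max d e"] Lspan_mono[of e "max d e"] by (intro Lspan_add) auto
  then show ?case by blast
qed

section \<open>The tautological function and completeness of the relations\<close>

definition fd :: "nat \<Rightarrow> (kgen, 'k) wfun" where
  "fd d = (\<lambda>w \<mu>. if length w = d then bword w * hmon \<mu> else 0)"

lemma fold_Fa: "fold Fa u f w = f (u @ w)"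
  by (induction u arbitrary: f) (simp_all add: Fa_def)

text \<open>Modulo I a Serre relation becomes a correction with two letters b fewer, which lies in
  \<open>Lspan d\<close>.\<close>

lemma perp_fd: "perp_space.perp q n (Lspan d) (fd d)"
proof -
  interpret perp_space q n "Lspan d" by unfold_locales (rule Lspan_subspace)
  have "Lval (Fa i (Fa j (fold Fa u (fd d))) - Fa j (Fa i (fold Fa u (fd d))))"
    if ij: "i \<in> {1..n}" "j \<in> {1..n}" "cartan i j = 0" for i j u
    unfolding Lval_def
  proof (intro allI)
    fix w \<mu>
    show "(Fa i (Fa j (fold Fa u (fd d))) - Fa j (Fa i (fold Fa u (fd d)))) w \<mu> \<in> Lspan d"
    proof (cases "length u + length w + 2 = d")
      case False
      then show ?thesis by (simp add: fold_Fa Fa_def fd_def Lspan_zero)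
    next
      case True
      define c where "c = (if i = tau j then cq else 0)"
      \<comment> \<open>The transposed operators reverse the order: the words read are u j i w and u
        i j w, hence \<open>b_comm\<close> for the pair j, i.\<close>
      have "kb j * kb i - kb i * kb j - fconst c * (kh j - kh i) \<in> I"
        using b_comm[of j i] ij by (simp add: c_def cartan_def fconst_simps(5) split: if_splits)
      then have "bword u * (kb j * kb i - kb i * kb j - fconst c * (kh j - kh i)) * (bword w * hmon \<mu>) \<in> I"
        by (intro lmult rmult)
      then have *: "(Fa i (Fa j (fold Fa u (fd d))) - Fa j (Fa i (fold Fa u (fd d)))) w \<mu>
          - fconst c * (bword u * (kh j * (bword w * hmon \<mu>)) - bword u * (kh i * (bword w * hmon \<mu>))) \<in> I"
        using True fconst_left_commute[of "bword u" c] by (simp add: fold_Fa Fa_def fd_def algebra_simps)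
      have "bword u * (kh m * (bword w * hmon \<mu>)) \<in> Lspan d" for m
        using True by (intro bword_h_bword_hmon) simp
      then have "fconst c * (bword u * (kh j * (bword w * hmon \<mu>)) - bword u * (kh i * (bword w * hmon \<mu>))) \<in> Lspan d"
        by (intro Lspan_scale Lspan_diff)
      then show ?thesis using * by (rule Lspan_cong)
    qed
  qed
  moreover have "Lval (serre_op (Fa i) (Fa j) (fold Fa u (fd d)))"
    if ij: "i \<in> {1..n}" "j \<in> {1..n}" "cartan i j = -1" for i j u
    unfolding Lval_def
  proof (intro allI)
    fix w \<mu>
    show "serre_op (Fa i) (Fa j) (fold Fa u (fd d)) w \<mu> \<in> Lspan d"
    proof (cases "length u + length w + 3 = d")
      case False
      then show ?thesis by (simp add: serre_op_def Qs_def Sc_def fold_Fa Fa_def fd_def Lspan_zero)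
    next
      case True
      define c where "c = (if i = r then - inverse q else 0)"
      have "fserre q (kb i) (kb j) - fconst c * kb j \<in> I"
        using b_serre[of i j] ij by (simp add: c_def fconst_simps(4,5) split: if_splits)
      then have "bword u * (fserre q (kb i) (kb j) - fconst c * kb j) * (bword w * hmon \<mu>) \<in> I"
        by (intro lmult rmult)
      moreover have "serre_op (Fa i) (Fa j) (fold Fa u (fd d)) w \<mu>
          = bword u * fserre q (kb i) (kb j) * (bword w * hmon \<mu>)"
      proof -
        let ?z = "bword w * hmon \<mu>" and ?U = "bword u :: (kgen, 'k) falg"
        have "serre_op (Fa i) (Fa j) (fold Fa u (fd d)) w \<mu> = ?U * (kb i * (kb i * (kb j * ?z)))
          - (fconst q * (?U * (kb i * (kb j * (kb i * ?z)))) + fconst (inverse q) * (?U * (kb i * (kb j * (kb i * ?z)))))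
          + ?U * (kb j * (kb i * (kb i * ?z)))"
          using True by (simp add: serre_op_def Qs_def Sc_def fold_Fa Fa_def fd_def mult.assoc)
        also have "\<dots> = ?U * fserre q (kb i) (kb j) * ?z"
          by (simp only: fserre_def fconst_simps(1) distrib_left distrib_right left_diff_distrib
              right_diff_distrib mult.assoc fconst_left_commute[of ?U])
        finally show ?thesis .
      qed
      ultimately have *: "serre_op (Fa i) (Fa j) (fold Fa u (fd d)) w \<mu>
          - fconst c * (bword (u @ j # w) * hmon \<mu>) \<in> I"
        using fconst_left_commute[of "bword u" c] by (simp add: algebra_simps)
      have "fconst c * (bword (u @ j # w) * hmon \<mu>) \<in> Lspan d"
        using True by (intro Lspan_scale bword_hmon) simp
      then show ?thesis using * by (rule Lspan_cong)
    qed
  qed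
  ultimately show ?thesis by (simp add: perp_def base_def)
qed

text \<open>On the shortest words where f may be nonzero, B_j acts like F_j: E_{tau j} removes a
  letter, so its term sees f only on words that are too short.\<close>

lemma act_kimg_b:
  fixes f :: "(kgen, 'k) wfun"
  assumes "j \<in> {1..n}" and f: "\<And>w \<mu>. length w < Suc d \<Longrightarrow> f w \<mu> = 0" and "length w \<le> d"
  shows "act (kimg (kb j)) f w \<mu> = f (j # w) \<mu>"
proof -
  have E0: "Ew q i w f \<mu> = 0" if "\<And>w \<mu>. length w < d \<Longrightarrow> f w \<mu> = 0" "length w \<le> d"
    for i w d \<mu> and f :: "(kgen, 'k) wfun"
    using that
  proof (induction w arbitrary: f d)
    case (Cons m w)
    then obtain e where e: "d = Suc e" by (cases d) auto
    have "Ew q i w (Fa m f) \<mu> = 0"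
      using Cons.prems by (intro Cons.IH[of e]) (auto simp: Fa_def e)
    moreover have "Sc cq (Ka q i 1 f - Ka q i (-1) f) w \<mu> = 0"
      using Cons.prems by (simp add: Sc_def Ka_def)
    ultimately show ?case by (cases "i = m") simp_all
  qed simp
  have "Ea q (tau j) (Ka q j (-1) f) w \<mu> = 0"
    unfolding Ea_def by (rule E0[of d]) (use f assms(3) in \<open>simp_all add: Ka_def\<close>)
  then show ?thesis
    using assms(1) by (simp add: kimg_def ev_fgen kgen_img_def act_simps Fa_def)
qed

text \<open>Each letter lowers by one the length below which the function vanishes, so
  \<open>act_kimg_b\<close> applies again.\<close>

lemma act_kimg_bword:
  fixes f :: "(kgen, 'k) wfun"
  assumes "set u \<subseteq> {1..n}" "\<And>w \<mu>. length w < d \<Longrightarrow> f w \<mu> = 0" "length u + length w \<le> d"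
  shows "act (kimg (bword u)) f w \<mu> = f (u @ w) \<mu>"
  using assms
proof (induction u arbitrary: f d)
  case Nil
  then show ?case by (simp add: kimg_def ev_simps act_one)
next
  case (Cons j u)
  then obtain e where e: "d = Suc e" by (cases d) auto
  have j: "j \<in> {1..n}" using Cons.prems by simp
  have g: "act (kimg (kb j)) f v \<nu> = f (j # v) \<nu>" if "length v \<le> e" for v \<nu>
    using j Cons.prems(2) that by (intro act_kimg_b[of j e]) (simp_all add: e)
  have "act (kimg (bword (j # u))) f w \<mu> = act (kimg (bword u)) (act (kimg (kb j)) f) w \<mu>"
    by (simp add: kimg_def ev_simps act_mult)
  also have "\<dots> = act (kimg (kb j)) f (u @ w) \<mu>"
    using Cons.prems by (intro Cons.IH[of e]) (auto simp: g e)
  also have "\<dots> = f (j # u @ w) \<mu>"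
    using Cons.prems by (intro g) (simp add: e)
  finally show ?case by simp
qed

lemma act_kimg_h:
  "act (kimg (kh j)) f [] \<mu> =
    f [] (if j \<in> {1..n} then (\<mu>(tau j := \<mu> (tau j) - 1))(j := (\<mu>(tau j := \<mu> (tau j) - 1)) j + 1) else \<mu>)"
  by (simp add: kimg_def ev_fgen kgen_img_def act_simps Ka_def fconst_simps(6) del: fun_upd_apply)

text \<open>The factor K_{tau j} also moves the exponent at tau j, which lies above r and is not
  seen by \<open>hmon\<close>. Hence only the entries below r are described.\<close>

lemma act_kimg_hpow:
  assumes "j \<in> {1..<r}"
  shows "\<exists>\<mu>'. (\<forall>i\<in>{1..<r}. \<mu>' i = (\<mu>(j := \<mu> j + m)) i) \<and> (\<forall>f::(kgen, 'k) wfun. act (kimg (hpow j m)) f [] \<mu> = f [] \<mu>')"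
proof -
  have j: "j \<in> {1..n}" "tau j \<in> {1..n}" "tau (tau j) = j" "r < tau j" "j \<noteq> tau j"
    using assms by (auto simp: n_def dtau_def)
  have pow: "\<exists>\<mu>'. (\<forall>i\<in>{1..<r}. \<mu>' i = (\<mu>(j := \<mu> j + e * int k)) i)
      \<and> (\<forall>f::(kgen, 'k) wfun. act (kimg (kh g ^ k)) f [] \<mu> = f [] \<mu>')"
    if "g = j \<and> e = 1 \<or> g = tau j \<and> e = -1" for g e k \<mu>
  proof (induction k)
    case 0
    show ?case by (intro exI[of _ \<mu>]) (simp add: kimg_def ev_simps act_one)
  next
    case (Suc k)
    from Suc.IH obtain \<mu>' where \<mu>': "(\<forall>i\<in>{1..<r}. \<mu>' i = (\<mu>(j := \<mu> j + e * int k)) i)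
      \<and> (\<forall>f::(kgen, 'k) wfun. act (kimg (kh g ^ k)) f [] \<mu> = f [] \<mu>')" ..
    note \<mu>' = conjunct1[OF \<mu>'] conjunct2[OF \<mu>', rule_format]
    have g: "g \<in> {1..n}" using that j(1,2) by auto
    let ?\<nu> = "(\<mu>'(tau g := \<mu>' (tau g) - 1))(g := (\<mu>'(tau g := \<mu>' (tau g) - 1)) g + 1)"
    have A: "act (kimg (kh g ^ Suc k)) f [] \<mu> = f [] ?\<nu>" for f :: "(kgen, 'k) wfun"
    proof -
      have "act (kimg (kh g ^ Suc k)) f [] \<mu> = act (kimg (kh g ^ k)) (act (kimg (kh g)) f) [] \<mu>"
        by (simp add: kimg_def ev_simps act_mult)
      also have "\<dots> = f [] (if g \<in> {1..n} then ?\<nu> else \<mu>')"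
        by (simp only: \<mu>'(2) act_kimg_h)
      finally show ?thesis using g by (simp only: if_True)
    qed
    have B: "?\<nu> i = (\<mu>(j := \<mu> j + e * int (Suc k))) i" if i: "i \<in> {1..<r}" for i
    proof -
      have "i \<noteq> tau j" using j(4) i by auto
      moreover have "\<mu>' i = (\<mu>(j := \<mu> j + e * int k)) i" using \<mu>'(1) i by blast
      ultimately show ?thesis
        using \<open>g = j \<and> e = 1 \<or> g = tau j \<and> e = -1\<close> j(3,5) by (elim disjE conjE) (simp_all split: if_splits)
    qed
    show ?case by (intro exI[of _ ?\<nu>] conjI ballI allI A B)
  qed
  show ?thesis
  proof (cases "0 \<le> m")
    case True
    then have "1 * int (nat m) = m" "hpow j m = kh j ^ nat m" by (simp_all add: hpow_def)
    with pow[of j 1 \<mu> "nat m"] show ?thesis by (simp only: simp_thms)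
  next
    case False
    then have "- 1 * int (nat (- m)) = m" "hpow j m = kh (tau j) ^ nat (- m)" by (simp_all add: hpow_def)
    with pow[of "tau j" "-1" \<mu> "nat (- m)"] show ?thesis by (simp only: simp_thms)
  qed
qed

lemma act_kimg_hmon:
  "\<exists>\<mu>'. (\<forall>i\<in>{1..<r}. \<mu>' i = \<mu> i) \<and> (\<forall>f::(kgen, 'k) wfun. act (kimg (hmon \<mu>)) f [] (\<lambda>_. 0) = f [] \<mu>')"
proof -
  have "\<exists>\<mu>'. (\<forall>i\<in>{1..<r}. \<mu>' i = (if i \<in> set xs then \<mu> i else 0)) \<and>
      (\<forall>f::(kgen, 'k) wfun. act (kimg (prod_list (map (\<lambda>j. hpow j (\<mu> j)) xs))) f [] (\<lambda>_. 0) = f [] \<mu>')"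
    if "set xs \<subseteq> {1..<r}" "distinct xs" for xs
    using that
  proof (induction xs)
    case Nil
    show ?case by (intro exI[of _ "\<lambda>_. 0"]) (simp add: kimg_def ev_simps act_one)
  next
    case (Cons j xs)
    let ?p = "\<lambda>xs. prod_list (map (\<lambda>j. hpow j (\<mu> j)) xs)"
    have "set xs \<subseteq> {1..<r}" "distinct xs" using Cons.prems by auto
    from Cons.IH[OF this] obtain \<mu>' where \<mu>': "\<forall>i\<in>{1..<r}. \<mu>' i = (if i \<in> set xs then \<mu> i else 0)"
      "\<And>f::(kgen, 'k) wfun. act (kimg (?p xs)) f [] (\<lambda>_. 0) = f [] \<mu>'"
      by blast
    obtain \<nu> where \<nu>: "\<forall>i\<in>{1..<r}. \<nu> i = (\<mu>'(j := \<mu>' j + \<mu> j)) i"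
      "\<And>f::(kgen, 'k) wfun. act (kimg (hpow j (\<mu> j))) f [] \<mu>' = f [] \<nu>"
      using act_kimg_hpow[of j \<mu>' "\<mu> j"] Cons.prems by auto
    have "act (kimg (?p (j # xs))) f [] (\<lambda>_. 0) = f [] \<nu>" for f :: "(kgen, 'k) wfun"
      using \<mu>'(2) \<nu>(2) by (simp add: kimg_def ev_mult act_mult)
    moreover have "\<forall>i\<in>{1..<r}. \<nu> i = (if i \<in> set (j # xs) then \<mu> i else 0)"
      using \<nu>(1) \<mu>'(1) Cons.prems by auto
    ultimately show ?case by blast
  qed
  from this[of "[1..<r]"] show ?thesis by (simp add: hmon_def)
qed

text \<open>A monomial with d letters b reproduces itself, a shorter one gives 0 and lies in
  \<open>Lspan d\<close> anyway.\<close>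

lemma act_fd:
  assumes "set u \<subseteq> {1..n}" "length u < Suc d"
  shows "act (kimg (bword u * hmon \<mu>)) (fd d) [] (\<lambda>_. 0) - bword u * hmon \<mu> \<in> Lspan d"
proof -
  obtain \<nu> where \<nu>: "\<forall>i\<in>{1..<r}. \<nu> i = \<mu> i"
    "\<And>f::(kgen, 'k) wfun. act (kimg (hmon \<mu>)) f [] (\<lambda>_. 0) = f [] \<nu>"
    using act_kimg_hmon[of \<mu>] by blast
  have "act (kimg (bword u * hmon \<mu>)) (fd d) [] (\<lambda>_. 0) = act (kimg (bword u)) (fd d) [] \<nu>"
    using \<nu>(2) by (simp add: kimg_def ev_mult act_mult)
  also have "\<dots> = fd d (u @ []) \<nu>"
    using assms by (intro act_kimg_bword[of _ d]) (simp_all add: fd_def)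
  finally have eq: "act (kimg (bword u * hmon \<mu>)) (fd d) [] (\<lambda>_. 0) = fd d u \<nu>" by simp
  have "map (\<lambda>j. hpow j (\<nu> j)) [1..<r] = map (\<lambda>j. hpow j (\<mu> j)) [1..<r]"
    using \<nu>(1) by (intro map_cong) auto
  then have "hmon \<nu> = hmon \<mu>" by (simp only: hmon_def)
  then show ?thesis
    unfolding eq using Lspan_zero[of d] Lspan_scale[OF bword_hmon[of u d \<mu>], of "-1"] assms
    by (cases "length u = d") (simp_all add: fd_def fconst_simps(4,6))
qed

text \<open>Pair x with \<open>fd d\<close> at the highest weight vector. The result lies in
  \<open>Lspan d\<close> if x is in \<open>kker\<close>, and equals x modulo \<open>Lspan d\<close>
  if x is in \<open>Lspan (Suc d)\<close>. So an element of \<open>kker\<close> descends through the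
  filtration down to I.\<close>

theorem kker_subset:
  assumes "I \<subseteq> kker"
  shows "kker \<subseteq> I"
proof
  have Lval: "act (kimg x) (fd d) [] (\<lambda>_. 0) \<in> Lspan d" if "x \<in> kker" for x d
  proof -
    interpret perp_space q n "Lspan d" by unfold_locales (rule Lspan_subspace)
    show ?thesis using act_uq_ideal[OF _ perp_fd[of d], of "kimg x"] that
      by (auto simp: kker_def Lval_def)
  qed
  have top: "act (kimg x) (fd d) [] (\<lambda>_. 0) - x \<in> Lspan d" if "x \<in> Lspan (Suc d)" for x d
    using that unfolding Lspan_def[of "Suc d"]
  proof (induction rule: falg.span_induct_alt)
    case base
    show ?case by (simp add: kimg_def ev_simps act_simps Lspan_zero)
  next
    case (step c x y)
    have "act (kimg x) (fd d) [] (\<lambda>_. 0) - x \<in> Lspan d"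
    proof (cases "x \<in> I")
      case True
      then show ?thesis using Lval[of x d] I_Lspan[of x d] assms by (intro Lspan_diff) auto
    next
      case False
      then show ?thesis using step(1) act_fd by auto
    qed
    then have "fconst c * (act (kimg x) (fd d) [] (\<lambda>_. 0) - x) + (act (kimg y) (fd d) [] (\<lambda>_. 0) - y) \<in> Lspan d"
      using step by (intro Lspan_add Lspan_scale)
    moreover have "act (kimg (fconst c * x + y)) (fd d) [] (\<lambda>_. 0)
        = fconst c * act (kimg x) (fd d) [] (\<lambda>_. 0) + act (kimg y) (fd d) [] (\<lambda>_. 0)"
      by (simp add: kimg_def ev_simps act_simps act_Sc) (simp add: Sc_def)
    ultimately show ?case by (simp add: algebra_simps)
  qed
  fix x assume x: "x \<in> kker"
  have "x \<in> Lspan d \<Longrightarrow> x \<in> Lspan 0" for d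
  proof (induction d)
    case (Suc d)
    have "x \<in> Lspan d"
      using Lspan_diff[OF Lval[OF x, of d] top[OF Suc.prems]] by simp
    then show ?case by (rule Suc.IH)
  qed simp
  then show "x \<in> I" using in_Lspan[of x] Lspan_0 by blast
qed

end

section \<open>Computing modulo an ideal\<close>

locale qideal = quantum q + two_sided I for q :: "'k::field" and I :: "('g, 'k) falg set"
begin

text \<open>Scalars are operators too: \<open>Q\<close> collects powers of q by adding exponents,
  and \<open>C\<close> is the constant from the relation for E_i F_i - F_i E_i.\<close>

definition Q :: "int \<Rightarrow> ('g, 'k) falg \<Rightarrow> ('g, 'k) falg" where
  "Q a = M (fconst (q powi a))"

definition C :: "('g, 'k) falg \<Rightarrow> ('g, 'k) falg" where
  "C = M (fconst cq)"

lemma Q_lin: "Q a (y + z) = Q a y + Q a z" "Q a (y - z) = Q a y - Q a z" "Q a (- y) = - Q a y" "Q a 0 = 0"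
  by (simp_all add: Q_def M_arg)

lemma C_lin: "C (y + z) = C y + C z" "C (y - z) = C y - C z" "C (- y) = - C y" "C 0 = 0"
  by (simp_all add: C_def M_arg)

lemma Q_Q: "Q a (Q b z) = Q (a + b) z"
  by (simp only: Q_def M_fconst_mult[symmetric] power_int_add[OF disjI1[OF q0]])

lemma Q_0: "Q 0 z = nu z"
  by (simp add: Q_def fconst_simps(6) M_poly)

lemma M_Q: "M x (Q a z) = Q a (M x z)"
  unfolding Q_def by (rule M_fconst_commute)

lemma M_C: "M x (C z) = C (M x z)"
  unfolding C_def by (rule M_fconst_commute)

lemma C_Q: "C (Q a z) = Q a (C z)"
  unfolding C_def by (rule M_Q)

lemma nu_QC: "nu (Q a z) = Q a z" "Q a (nu z) = Q a z" "nu (C z) = C z" "C (nu z) = C z"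
  by (simp_all add: Q_def C_def nu_M M_nu)

lemma M_fconst: "M (fconst (q powi a)) z = Q a z" "M (fconst q) z = Q 1 z"
  "M (fconst (inverse q)) z = Q (-1) z" "M (fconst cq) z = C z"
  by (simp_all add: Q_def C_def)

lemma M_fserre: "M (fserre q x y) z = M x (M x (M y z))
    - (Q 1 (M x (M y (M x z))) + Q (-1) (M x (M y (M x z)))) + M y (M x (M x z))"
  by (simp add: fserre_def M_poly fconst_simps(1) M_fconst)

lemma M_fcomm: "M (fcomm q x y) z = M x (M y z) - Q 1 (M y (M x z))"
  by (simp add: fcomm_def M_poly M_fconst)

lemmas M_simps = M_poly M_arg M_fconst M_fserre M_fcomm M_nu nu_M nu_nu nu_QC nu_lin
  Q_lin C_lin Q_Q Q_0 M_Q M_C C_Q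

end

section \<open>The defining ideal of U_q(g) as an ideal of the whole type\<close>

context aiii
begin

text \<open>\<open>uq_ideal\<close> is an ideal only of the algebra on generators with index in
  1..n. Killing all other generators pulls it back to a two-sided ideal \<open>uker\<close> of the
  whole type, which meets that algebra in \<open>uq_ideal\<close>.\<close>

definition upart :: "uq_gen \<Rightarrow> (uq_gen, 'k) falg" where
  "upart g = (if g \<in> uq_gens n then fgen g else 0)"

definition uker :: "(uq_gen, 'k) falg set" where
  "uker = {x. ev upart x \<in> uq_ideal q n}"

lemma ev_in_carrier: "(\<And>g. f g \<in> carrier (free_alg G)) \<Longrightarrow> ev f x \<in> carrier (free_alg G)"
  by (induction x rule: falg_induct) (simp_all add: ev_simps free_alg_closed)

lemma kimg_carrier: "kimg x \<in> carrier (free_alg (uq_gens n))"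
  unfolding kimg_def
  by (rule ev_in_carrier)
    (auto simp: kgen_img_def uq_gens_def dtau_def intro!: free_alg_closed free_alg_closed(1)[THEN iffD2] split: kgen.split)

lemma uq_ideal: "ideal (uq_ideal q n) (free_alg (uq_gens n))"
  unfolding uq_ideal_def by (intro ring.genideal_ideal ring_free_alg uq_rels_closed)

lemma two_sided_vimage:
  assumes "\<And>g. f g \<in> carrier (free_alg (uq_gens n))"
  shows "two_sided {x. ev f x \<in> uq_ideal q n}"
proof -
  interpret J: ideal "uq_ideal q n" "free_alg (uq_gens n)" by (rule uq_ideal)
  have ops: "monoid.mult (free_alg G) = (*)" "ring.zero (free_alg G) = 0" "ring.add (free_alg G) = (+)" for G
    by (auto simp: free_alg_def ring_of_type_algebra_def)
  have f: "ev f x \<in> carrier (free_alg (uq_gens n))" for x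
    by (rule ev_in_carrier) (rule assms)
  note add = additive_subgroup.zero_closed[OF J.additive_subgroup_axioms]
    additive_subgroup.a_closed[OF J.additive_subgroup_axioms]
  show ?thesis
    using add J.I_l_closed[OF _ f] J.I_r_closed[OF _ f] by unfold_locales (auto simp: ev_simps ops)
qed

lemma two_sided_uker: "two_sided uker"
  unfolding uker_def by (rule two_sided_vimage) (simp add: upart_def free_alg_closed)

lemma two_sided_kker: "two_sided kker"
  unfolding kker_def kimg_def
proof (rule two_sided_vimage)
  show "kgen_img g \<in> carrier (free_alg (uq_gens n))" for g
    using kimg_carrier[of "fgen g"] by (simp add: kimg_def ev_fgen)
qed

lemma uq_rels_uker: "x \<in> uq_rels q n \<Longrightarrow> x \<in> uker"
proof -
  assume x: "x \<in> uq_rels q n"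
  have "ev upart x = x"
    using x by (auto simp: uq_rels_def uq_gens_def upart_def ev_simps fserre_def)
  then show ?thesis
    using x ring.genideal_self[OF ring_free_alg uq_rels_closed] by (auto simp: uker_def uq_ideal_def)
qed

lemma kimg_uker: "kimg x \<in> uker \<longleftrightarrow> x \<in> kker"
proof -
  have "ev upart (kimg x) = kimg x"
    unfolding kimg_def
    by (induction x rule: falg_induct)
      (auto simp: ev_simps kgen_img_def upart_def uq_gens_def dtau_def split: kgen.split)
  then show ?thesis by (simp add: uker_def kker_def)
qed

lemma uq_relsI:
  assumes "i \<in> {1..n}" "j \<in> {1..n}"
  shows "fgen (GK i) * fgen (GKi i) - 1 \<in> uq_rels q n"
    and "fgen (GKi i) * fgen (GK i) - 1 \<in> uq_rels q n"
    and "fgen (GK i) * fgen (GK j) - fgen (GK j) * fgen (GK i) \<in> uq_rels q n"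
    and "fgen (GK i) * fgen (GE j) * fgen (GKi i) - fconst (q powi cartan i j) * fgen (GE j) \<in> uq_rels q n"
    and "fgen (GK i) * fgen (GF j) * fgen (GKi i) - fconst (q powi (- cartan i j)) * fgen (GF j) \<in> uq_rels q n"
    and "fgen (GE i) * fgen (GF j) - fgen (GF j) * fgen (GE i)
        - (if i = j then fconst (1 / (q - inverse q)) * (fgen (GK i) - fgen (GKi i)) else 0) \<in> uq_rels q n"
    and "Y \<in> {GE, GF} \<Longrightarrow> cartan i j = 0 \<Longrightarrow>
      fgen (Y i) * fgen (Y j) - fgen (Y j) * fgen (Y i) \<in> uq_rels q n"
    and "Y \<in> {GE, GF} \<Longrightarrow> cartan i j = -1 \<Longrightarrow> fserre q (fgen (Y i)) (fgen (Y j)) \<in> uq_rels q n"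
proof -
  show "fgen (GK i) * fgen (GKi i) - 1 \<in> uq_rels q n"
    unfolding uq_rels_def
    by (rule UnI1, rule UnI1, rule UnI1, rule UnI1, rule UnI1, rule UnI1, rule UnI1, rule CollectI, rule exI, rule conjI, rule refl) (use assms in simp)
  show "fgen (GKi i) * fgen (GK i) - 1 \<in> uq_rels q n"
    unfolding uq_rels_def
    by (rule UnI1, rule UnI1, rule UnI1, rule UnI1, rule UnI1, rule UnI1, rule UnI2, rule CollectI, rule exI, rule conjI, rule refl) (use assms in simp)
  show "fgen (GK i) * fgen (GK j) - fgen (GK j) * fgen (GK i) \<in> uq_rels q n"
    unfolding uq_rels_def
    by (rule UnI1, rule UnI1, rule UnI1, rule UnI1, rule UnI1, rule UnI2, rule CollectI, rule exI, rule exI, rule conjI, rule refl) (use assms in simp)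
  show "fgen (GK i) * fgen (GE j) * fgen (GKi i) - fconst (q powi cartan i j) * fgen (GE j) \<in> uq_rels q n"
    unfolding uq_rels_def
    by (rule UnI1, rule UnI1, rule UnI1, rule UnI1, rule UnI2, rule CollectI, rule exI, rule exI, rule conjI, rule refl) (use assms in simp)
  show "fgen (GK i) * fgen (GF j) * fgen (GKi i) - fconst (q powi (- cartan i j)) * fgen (GF j) \<in> uq_rels q n"
    unfolding uq_rels_def
    by (rule UnI1, rule UnI1, rule UnI1, rule UnI2, rule CollectI, rule exI, rule exI, rule conjI, rule refl) (use assms in simp)
  show "fgen (GE i) * fgen (GF j) - fgen (GF j) * fgen (GE i)
        - (if i = j then fconst (1 / (q - inverse q)) * (fgen (GK i) - fgen (GKi i)) else 0) \<in> uq_rels q n"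
    unfolding uq_rels_def
    by (rule UnI1, rule UnI1, rule UnI2, rule CollectI, rule exI, rule exI, rule conjI, rule refl) (use assms in simp)
  show "fgen (Y i) * fgen (Y j) - fgen (Y j) * fgen (Y i) \<in> uq_rels q n" if "Y \<in> {GE, GF}" "cartan i j = 0"
    unfolding uq_rels_def
    by (rule UnI1, rule UnI2, rule CollectI, rule exI, rule exI, rule exI, rule conjI, rule refl) (use assms that in simp)
  show "fserre q (fgen (Y i)) (fgen (Y j)) \<in> uq_rels q n" if "Y \<in> {GE, GF}" "cartan i j = -1"
    unfolding uq_rels_def
    by (rule UnI2, rule CollectI, rule exI, rule exI, rule exI, rule conjI, rule refl) (use assms that in simp)
qed

end

section \<open>The relations of U_q(g) as rewriting rules for operators\<close>

locale uideal = aiii q n r + qideal q I for q :: "'k::field" and n r and I :: "(uq_gen, 'k) falg set" +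
  assumes uq_rels: "uq_rels q n \<subseteq> I"
begin

abbreviation "E i \<equiv> M (fgen (GE i))"
abbreviation "F i \<equiv> M (fgen (GF i))"
abbreviation "K i \<equiv> M (fgen (GK i))"
abbreviation "K' i \<equiv> M (fgen (GKi i))"

lemma K_inv: "i \<in> {1..n} \<Longrightarrow> K i (K' i z) = nu z" "i \<in> {1..n} \<Longrightarrow> K' i (K i z) = nu z"
proof -
  assume i: "i \<in> {1..n}"
  have "fgen (GK i) * fgen (GKi i) - 1 \<in> I" "fgen (GKi i) * fgen (GK i) - 1 \<in> I"
    using uq_relsI(1,2)[OF i i] uq_rels by auto
  from this[THEN M_eqD] show "K i (K' i z) = nu z" "K' i (K i z) = nu z" by (simp_all add: M_poly)
qed

lemma K_commute: "i \<in> {1..n} \<Longrightarrow> j \<in> {1..n} \<Longrightarrow> K i (K j z) = K j (K i z)"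
proof -
  assume "i \<in> {1..n}" "j \<in> {1..n}"
  then have "fgen (GK i) * fgen (GK j) - fgen (GK j) * fgen (GK i) \<in> I"
    by (intro subsetD[OF uq_rels] uq_relsI(3))
  from M_eqD[OF this] show ?thesis by (simp only: M_poly)
qed

text \<open>One conjugation relation yields the rules for K_i and for its inverse. It serves E_j and
  F_j, and with a = 0 also the K_j.\<close>

lemma K_conj:
  assumes i: "i \<in> {1..n}" and "\<And>z. K i (M x (K' i z)) = Q a (M x z)"
  shows "K i (M x z) = Q a (M x (K i z))" "K' i (M x z) = Q (- a) (M x (K' i z))"
proof -
  have *: "K i (M x z) = Q a (M x (K i z))" for z
    using assms(2)[of "K i z"] K_inv(2)[OF i] by (simp add: M_nu)
  then show "K i (M x z) = Q a (M x (K i z))" .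
  have "K' i (M x z) = K' i (M x (K i (K' i z)))" using K_inv(1)[OF i] by (simp add: M_nu)
  also have "\<dots> = K' i (Q (- a) (Q a (M x (K i (K' i z)))))" by (simp add: Q_Q Q_0 nu_M)
  also have "\<dots> = Q (- a) (K' i (K i (M x (K' i z))))" by (simp only: * M_Q)
  finally show "K' i (M x z) = Q (- a) (M x (K' i z))" using K_inv(2)[OF i] by (simp add: nu_M)
qed

lemma K_E_conj: "i \<in> {1..n} \<Longrightarrow> j \<in> {1..n} \<Longrightarrow> K i (E j (K' i z)) = Q (cartan i j) (E j z)"
proof -
  assume "i \<in> {1..n}" "j \<in> {1..n}"
  then have "fgen (GK i) * fgen (GE j) * fgen (GKi i) - fconst (q powi cartan i j) * fgen (GE j) \<in> I"
    by (intro subsetD[OF uq_rels] uq_relsI(4))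
  from M_eqD[OF this] show ?thesis by (simp only: M_poly M_fconst)
qed

lemma K_F_conj: "i \<in> {1..n} \<Longrightarrow> j \<in> {1..n} \<Longrightarrow> K i (F j (K' i z)) = Q (- cartan i j) (F j z)"
proof -
  assume "i \<in> {1..n}" "j \<in> {1..n}"
  then have "fgen (GK i) * fgen (GF j) * fgen (GKi i) - fconst (q powi - cartan i j) * fgen (GF j) \<in> I"
    by (intro subsetD[OF uq_rels] uq_relsI(5))
  from M_eqD[OF this] show ?thesis by (simp only: M_poly M_fconst)
qed

lemma K'_commute: assumes "i \<in> {1..n}" "j \<in> {1..n}" shows "K' i (K j z) = K j (K' i z)" "K' i (K' j z) = K' j (K' i z)"
proof -
  have a: "K' i (K j z) = K j (K' i z)" if "i \<in> {1..n}" "j \<in> {1..n}" for i j z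
  proof -
    have "K i (K j (K' i z)) = Q 0 (K j z)" for z
      using that K_commute[of i j] K_inv[of i] by (simp add: M_nu Q_0 nu_M)
    from K_conj(2)[OF that(1) this] show ?thesis by (simp add: Q_0 nu_M)
  qed
  then show "K' i (K j z) = K j (K' i z)" using assms by blast
  have "K j (K' i (K' j z)) = Q 0 (K' i z)" for z
    using assms a[of i j] K_inv[of j] by (simp add: M_nu Q_0 nu_M flip: a)
  from K_conj(2)[OF assms(2) this] show "K' i (K' j z) = K' j (K' i z)" by (simp add: Q_0 nu_M)
qed

lemmas K_EF = K_conj[OF _ K_E_conj] K_conj[OF _ K_F_conj]

lemma E_F: "i \<in> {1..n} \<Longrightarrow> j \<in> {1..n} \<Longrightarrow>
    E i (F j z) = F j (E i z) + (if i = j then C (K i z) - C (K' i z) else 0)"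
proof -
  assume "i \<in> {1..n}" "j \<in> {1..n}"
  then have "fgen (GE i) * fgen (GF j) - fgen (GF j) * fgen (GE i)
        - (if i = j then fconst (1 / (q - inverse q)) * (fgen (GK i) - fgen (GKi i)) else 0) \<in> I"
    by (intro subsetD[OF uq_rels] uq_relsI(6))
  from M_eqD[OF this, of z] show ?thesis by (auto simp add: M_poly M_fconst C_lin diff_eq_eq add.commute)
qed

lemma EF_commute:
  assumes "i \<in> {1..n}" "j \<in> {1..n}" "cartan i j = 0"
  shows "E i (E j z) = E j (E i z)" "F i (F j z) = F j (F i z)"
proof -
  have "fgen (Y i) * fgen (Y j) - fgen (Y j) * fgen (Y i) \<in> I" if "Y \<in> {GE, GF}" for Y
    using assms that by (intro subsetD[OF uq_rels] uq_relsI(7))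
  from this[of GE, THEN M_eqD] this[of GF, THEN M_eqD]
  show "E i (E j z) = E j (E i z)" "F i (F j z) = F j (F i z)" by (simp_all add: M_poly)
qed

lemma EF_serre:
  assumes "i \<in> {1..n}" "j \<in> {1..n}" "cartan i j = -1"
  shows "E i (E i (E j z)) = Q 1 (E i (E j (E i z))) + Q (-1) (E i (E j (E i z))) - E j (E i (E i z))"
    "F i (F i (F j z)) = Q 1 (F i (F j (F i z))) + Q (-1) (F i (F j (F i z))) - F j (F i (F i z))"
proof -
  have "fserre q (fgen (Y i)) (fgen (Y j)) \<in> I" if "Y \<in> {GE, GF}" for Y
    using assms that by (intro subsetD[OF uq_rels] uq_relsI(8))
  from this[of GE, THEN M_eqD[of _ 0, simplified]] this[of GF, THEN M_eqD[of _ 0, simplified]]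
  show "E i (E i (E j z)) = Q 1 (E i (E j (E i z))) + Q (-1) (E i (E j (E i z))) - E j (E i (E i z))"
    "F i (F i (F j z)) = Q 1 (F i (F j (F i z))) + Q (-1) (F i (F j (F i z))) - F j (F i (F i z))"
    by (simp_all add: M_fserre M_poly algebra_simps)
qed

end

context qideal
begin

text \<open>From (q - q^{-1}) c = 1 for c = 1/(q - q^{-1}), the multiples of c by the powers of q
  that occur are reduced to c or q^{-1} c plus a Laurent polynomial in q. This gives terms with
  \<open>C\<close> a normal form.\<close>

lemma QC_reduce:
  assumes "q - inverse q \<noteq> 0"
  shows "Q 1 (C z) = Q (-1) (C z) + nu z" "Q 2 (C z) = C z + Q 1 z" "Q 3 (C z) = Q (-1) (C z) + nu z + Q 2 z"
    "Q (-2) (C z) = C z - Q (-1) z" "Q (-3) (C z) = Q (-1) (C z) - Q (-2) z"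
proof -
  have "fconst cq * fconst q - fconst cq * fconst (inverse q) = (1 :: ('g, 'k) falg)"
  proof -
    have "cq * q - cq * inverse q = 1" using assms by (simp add: diff_divide_distrib[symmetric])
    then have "fconst (cq * q - cq * inverse q) = (fconst 1 :: ('g, 'k) falg)" by (rule arg_cong)
    then show ?thesis by (simp only: fconst_simps(2,3,6))
  qed
  then have "M (fconst cq * fconst q - fconst cq * fconst (inverse q)) z = M 1 z" for z by simp
  then have 1: "Q 1 (C z) = Q (-1) (C z) + nu z" for z
    by (simp add: M_simps diff_eq_eq add.commute)
  have 2: "Q (a + 1) (C z) = Q (a - 1) (C z) + Q a z" for a z
    using arg_cong[OF 1[of z], of "Q a"] by (simp add: M_simps)
  show "Q 1 (C z) = Q (-1) (C z) + nu z" by (rule 1)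
  show "Q 2 (C z) = C z + Q 1 z" using 2[of 1 z] by (simp add: M_simps)
  then show "Q 3 (C z) = Q (-1) (C z) + nu z + Q 2 z" using 2[of 2 z] 1 by simp
  show "Q (-2) (C z) = C z - Q (-1) z" using 2[of "-1" z] by (simp add: M_simps algebra_simps)
  show "Q (-3) (C z) = Q (-1) (C z) - Q (-2) z" using 2[of "-2" z] by (simp add: algebra_simps)
qed

end

section \<open>The relations hold in U_q(g)\<close>

context aiii
begin

lemma q_diff: "q - inverse q \<noteq> 0"
proof
  assume "q - inverse q = 0"
  then have "q ^ 2 = 1" using q0 by (simp add: power2_eq_square field_simps)
  then show False using q_root by (metis zero_less_numeral)
qed

lemma cartan_tau:
  assumes "i \<in> {1..n}" "j \<in> {1..n}"
  shows "cartan (tau i) (tau j) = cartan i j" "cartan i (tau j) = cartan (tau i) j"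
proof -
  have t: "tau i + i = n + 1" "tau j + j = n + 1" using assms by (auto simp: dtau_def)
  have "tau i = tau j \<longleftrightarrow> i = j" "tau i = tau j + 1 \<longleftrightarrow> j = i + 1" "tau j = tau i + 1 \<longleftrightarrow> i = j + 1"
    using t by linarith+
  then show "cartan (tau i) (tau j) = cartan i j" by (auto simp: cartan_def)
  have "i = tau j \<longleftrightarrow> tau i = j" "i = tau j + 1 \<longleftrightarrow> j = tau i + 1" "tau j = i + 1 \<longleftrightarrow> tau i = j + 1"
    using t by linarith+
  then show "cartan i (tau j) = cartan (tau i) j" by (auto simp: cartan_def)
qed

lemma cartan_tau_self: assumes "i \<in> {1..n}" "i \<noteq> r" shows "cartan (tau i) i = 0" "tau i \<noteq> i"
proof -
  have "tau i + i = 2 * r" using assms by (auto simp: dtau_def n_def)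
  then show "cartan (tau i) i = 0" "tau i \<noteq> i" using assms unfolding cartan_def by (simp_all; presburger)+
qed

text \<open>Two neighbours that avoid the middle node r lie on the same side of it, so the mirror
  image of one is far from the other.\<close>

lemma cartan_tau_adjacent:
  assumes "i \<in> {1..n}" "j \<in> {1..n}" "cartan i j = -1" "i \<noteq> r" "j \<noteq> r"
  shows "cartan (tau i) j = 0" "tau i \<noteq> j" "tau j \<noteq> i"
proof -
  have "tau i + i = 2 * r" "tau j + j = 2 * r" using assms by (auto simp: dtau_def n_def)
  moreover have "j = i + 1 \<or> i = j + 1" using assms(3) by (auto simp: cartan_def split: if_splits)
  moreover have "a \<noteq> j \<and> a \<noteq> j + 1 \<and> j \<noteq> a + 1 \<and> b \<noteq> i"
    if "a + i = 2 * r" "b + j = 2 * r" "j = i + 1 \<or> i = j + 1" for a b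
    using that(3)
  proof
    assume "j = i + 1"
    then have "a + i = 2 * r" "b + i + 1 = 2 * r" "i \<noteq> r" "i + 1 \<noteq> r"
      using that assms(4,5) by linarith+
    then show ?thesis using \<open>j = i + 1\<close> by (intro conjI notI) linarith+
  next
    assume "i = j + 1"
    then have "a + j + 1 = 2 * r" "b + j = 2 * r" "j \<noteq> r" "j + 1 \<noteq> r"
      using that assms(4,5) by linarith+
    then show ?thesis using \<open>i = j + 1\<close> by (intro conjI notI) linarith+
  qed
  ultimately have "tau i \<noteq> j" "tau i \<noteq> j + 1" "j \<noteq> tau i + 1" "tau j \<noteq> i" by blast+
  then show "cartan (tau i) j = 0" "tau i \<noteq> j" "tau j \<noteq> i" by (simp_all add: cartan_def)
qed

text \<open>Each relation is expanded through B_j = F_j - K_j^{-1} E_{tau j} and brought to the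
  order F, E, K.\<close>

lemma krels_kker: "krels \<subseteq> kker"
proof
  interpret two_sided uker by (rule two_sided_uker)
  interpret uideal q n r uker by unfold_locales (use uq_rels_uker in auto)
  have B: "M (kimg (kb j)) z = F j z - K' j (E (tau j) z)" if "j \<in> {1..n}" for j z
    using that by (simp add: kimg_def ev_fgen kgen_img_def M_poly)
  have H: "M (kimg (kh j)) z = K j (K' (tau j) z)" if "j \<in> {1..n}" for j z
    using that by (simp add: kimg_def ev_fgen kgen_img_def M_poly)
  have kimg_simps: "kimg (x + y) = kimg x + kimg y" "kimg (x - y) = kimg x - kimg y"
    "kimg (x * y) = kimg x * kimg y" "kimg (fconst c) = fconst c" "kimg 1 = 1" "kimg 0 = 0" for x y c
    by (simp_all add: kimg_def ev_simps)
  have kimg_serre: "kimg (fserre q x y) = fserre q (kimg x) (kimg y)" for x y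
    by (simp add: fserre_def kimg_simps)
  have uI: "x \<in> kker" if "\<And>z. M (kimg x) z = 0" for x
    using M_eqI[of "kimg x" 0] that kimg_uker[of x] by (simp add: M_poly)
  have r_in: "r \<in> {1..n}" using r2 by (simp add: n_def)
  note [simp del] = atLeastAtMost_iff One_nat_def
  note K_rules = K_inv K_EF K_commute K'_commute
  fix x assume "x \<in> krels"
  then show "x \<in> kker"
  proof (cases rule: krels.cases)
    case (h_inv i)
    then show ?thesis
      by (intro uI) (simp add: kimg_simps M_simps H tau_props K_rules)
  next
    case h_r
    then show ?thesis
      unfolding h_r using r_in by (intro uI) (simp add: kimg_simps M_simps H tau_props K_rules)
  next
    case (h_comm i j)
    then show ?thesis
      by (intro uI) (simp add: kimg_simps M_simps H tau_props K_rules)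
  next
    case (h_b i j)
    then show ?thesis
      by (intro uI) (simp add: kimg_simps M_simps H B tau_props K_rules cartan_tau add.commute)
  next
    case (b_comm i j)
    have [simp]: "i \<in> {1..n}" "j \<in> {1..n}" "tau i \<in> {1..n}" "tau j \<in> {1..n}" using b_comm tau_props by blast+
    have "i \<noteq> j" using b_comm by (auto simp: cartan_def)
    moreover have "tau i \<noteq> tau j" using \<open>i \<noteq> j\<close> tau_props(2)[of i] tau_props(2)[of j] b_comm by metis
    ultimately have [simp]: "cartan i j = 0" "cartan j i = 0" "i \<noteq> j" "tau i \<noteq> tau j"
      "cartan (tau i) (tau j) = 0" "cartan (tau j) (tau i) = 0"
      using b_comm cartan_sym[of i j] cartan_sym[of "tau i" "tau j"] cartan_tau[of i j] by auto
    have [simp]: "cartan i (tau j) = cartan (tau i) j" "cartan j (tau i) = cartan (tau i) j"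
      using cartan_tau[of i j] cartan_sym[of j "tau i"] by auto
    show ?thesis
    proof (cases "j = tau i")
      case True
      then have t: "tau j = i" "cartan i (tau i) = 0" "cartan (tau i) i = 0" "tau i \<in> {1..n}"
          "i \<noteq> tau i" "tau i \<noteq> i" "cartan k k = 2" for k
        using tau_props(2)[of i] \<open>cartan i j = 0\<close> \<open>cartan j i = 0\<close> \<open>i \<noteq> j\<close> by (auto simp: cartan_def[of k k])
      show ?thesis unfolding b_comm(1)
        by (intro uI) (use True t in \<open>simp add: kimg_simps M_simps H B K_rules E_F EF_commute[of i "tau i"]\<close>)
    next
      case False
      then have "tau j \<noteq> i" using tau_props(2)[of j] by auto
      then show ?thesis unfolding b_comm(1)
        by (intro uI, use False in \<open>simp add: kimg_simps M_simps H B K_rules E_F EF_commute[of i j] EF_commute[of "tau i" "tau j"]\<close>)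
          (rule arg_cong2[where f = Q], simp_all)
    qed
  next
    case (b_serre i j)
    have ij: "i \<in> {1..n}" "j \<in> {1..n}" using b_serre by auto
    note tau_in = tau_props(1)[OF ij(1)] tau_props(1)[OF ij(2)]
    have "i \<noteq> j" using b_serre(4) by (auto simp: cartan_def)
    then have n: "i \<noteq> j" "tau i \<noteq> tau j"
      using tau_props(2)[OF ij(1)] tau_props(2)[OF ij(2)] by metis+
    have c2: "cartan k k = 2" for k by (simp add: cartan_def)
    have c: "cartan i j = -1" "cartan j i = -1" "cartan (tau i) (tau j) = -1" "cartan (tau j) (tau i) = -1"
      using b_serre(4) cartan_sym[of i j] cartan_sym[of "tau i" "tau j"] cartan_tau(1)[OF ij] by simp_all
    have ct: "cartan i (tau j) = cartan (tau i) j" "cartan j (tau i) = cartan (tau i) j"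
        "cartan (tau j) i = cartan (tau i) j"
      using cartan_tau(2)[OF ij] cartan_sym[of j "tau i"] cartan_sym[of i "tau j"] by simp_all
    note facts = ij tau_in n n[symmetric] c2 c ct
    note ii = cartan_tau_self[OF ij(1)] cartan_tau_self(2)[OF ij(1), symmetric] trans[OF cartan_sym cartan_tau_self(1)[OF ij(1)]]
    note jj = cartan_tau_self[OF ij(2)] cartan_tau_self(2)[OF ij(2), symmetric] trans[OF cartan_sym cartan_tau_self(1)[OF ij(2)]]
    have "cartan r r \<noteq> -1" by (simp add: cartan_def)
    \<comment> \<open>Terms with \<open>C\<close> arise where E_{tau i} meets F_i or F_j, or E_{tau
      j} meets F_i. This happens only for i = r, between the two factors b_r, and is the source of
      the term q^{-1} b_j.\<close>
    then consider "i \<noteq> r" "j \<noteq> r" | "i = r" "j \<noteq> r" | "i \<noteq> r" "j = r" using b_serre(4) by metis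
    then show ?thesis
    proof cases
      case 1
      note adj = cartan_tau_adjacent[OF ij b_serre(4) 1]
      show ?thesis unfolding b_serre(1)
        by (intro uI) (simp add: kimg_simps kimg_serre M_simps H B K_rules E_F
            EF_serre[of i j] EF_serre[of "tau i" "tau j"] facts ii[OF 1(1)] jj[OF 1(2)] adj adj(2,3)[symmetric] 1)
    next
      case 2
      have t: "tau i = i" using 2 tau_props(3) by simp
      show ?thesis unfolding b_serre(1)
        by (intro uI) (simp add: kimg_simps kimg_serre M_simps H B K_rules E_F QC_reduce[OF q_diff]
            EF_serre[of i j] EF_serre[of i "tau j"] facts facts[unfolded t] t jj[OF 2(2)] 2(1)[symmetric])
    next
      case 3
      have t: "tau j = j" using 3 tau_props(3) by simp
      show ?thesis unfolding b_serre(1)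
        by (intro uI) (simp add: kimg_simps kimg_serre M_simps H B K_rules E_F QC_reduce[OF q_diff]
            EF_serre[of i j] EF_serre[of "tau i" j] facts facts[unfolded t] t ii[OF 3(1)] 3(1) 3(1)[unfolded 3(2)[symmetric]])
    qed
  next
    case (b_junk j)
    have "kimg (kb j) = 0" using b_junk by (simp add: kimg_def ev_fgen kgen_img_def)
    then show ?thesis unfolding b_junk(1) by (intro uI) (simp add: M_poly)
  next
    case (h_junk j)
    have "kimg (kh j) = 1" using h_junk by (simp add: kimg_def ev_fgen kgen_img_def)
    then show ?thesis unfolding h_junk(1) by (intro uI) (simp add: kimg_simps M_poly)
  qed
qed

end

section \<open>The maps on generators\<close>

context aiii
begin

definition near :: "nat \<Rightarrow> bool" where "near i \<longleftrightarrow> i = r - 1 \<or> i = r + 1"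

lemma r_in: "r \<in> {1..n}"
  using r2 by (simp add: n_def)

lemma near_tau_cases: assumes "near i"
  obtains "i = r - 1" "tau i = r + 1" | "i = r + 1" "tau i = r - 1"
  using assms r2 unfolding near_def by (fastforce simp: dtau_def n_def)

lemma near_iff: "near j \<longleftrightarrow> cartan r j = -1"
  using r2 by (auto simp: near_def cartan_def)

lemma near_props:
  assumes "near i"
  shows "i \<in> {1..n}" "tau i \<in> {1..n}" "near (tau i)" "tau (tau i) = i" "i \<noteq> r" "tau i \<noteq> r" "tau i \<noteq> i" "i \<noteq> tau i"
    "cartan r i = -1" "cartan i r = -1" "cartan (tau i) r = -1" "cartan r (tau i) = -1"
    "cartan i (tau i) = 0" "cartan (tau i) i = 0" "cartan k k = 2"
proof -
  \<comment> \<open>Writing r as m + 2 removes the truncated subtraction in r - 1.\<close>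
  define m where "m = r - 2"
  have m: "r = Suc (Suc m)" using r2 by (simp add: m_def)
  define t where "t = tau i"
  have "i = Suc m \<and> t = Suc (Suc (Suc m)) \<or> i = Suc (Suc (Suc m)) \<and> t = Suc m"
    using assms by (cases rule: near_tau_cases) (simp_all add: m t_def)
  then have *: "1 \<le> i \<and> i \<le> 2 * m + 3 \<and> 1 \<le> t \<and> t \<le> 2 * m + 3
    \<and> (t = Suc (Suc m) - 1 \<or> t = Suc (Suc m) + 1) \<and> i \<noteq> Suc (Suc m) \<and> t \<noteq> Suc (Suc m) \<and> t \<noteq> i
    \<and> cartan (Suc (Suc m)) i = -1 \<and> cartan i (Suc (Suc m)) = -1 \<and> cartan t (Suc (Suc m)) = -1
    \<and> cartan (Suc (Suc m)) t = -1 \<and> cartan i t = 0 \<and> cartan t i = 0"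
    by (elim disjE conjE) (simp_all add: cartan_def)
  have n: "n = 2 * m + 3" by (simp add: n_def m)
  note ** = *[unfolded t_def, folded m n]
  show 1: "i \<in> {1..n}" and "tau i \<in> {1..n}" using ** by (simp_all only: atLeastAtMost_iff simp_thms)
  show "near (tau i)" "i \<noteq> r" "tau i \<noteq> r" "tau i \<noteq> i" "i \<noteq> tau i"
    "cartan r i = -1" "cartan i r = -1" "cartan (tau i) r = -1" "cartan r (tau i) = -1"
    "cartan i (tau i) = 0" "cartan (tau i) i = 0"
    using ** unfolding near_def by metis+
  show "cartan k k = 2" by (simp add: cartan_def)
  show "tau (tau i) = i" by (rule tau_props(2)[OF 1])
qed

lemma near_pair: assumes "near i" "near j" "i \<noteq> j" shows "j = tau i"
  using assms(2,3) by (cases rule: near_tau_cases[OF assms(1)]) (auto simp: near_def)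

text \<open>The nodes j, i, r, tau i are consecutive in the diagram, read from the left or from the
  right.\<close>

lemma near_second:
  assumes "near i" "j \<in> {1..n}" "cartan i j = -1" "j \<noteq> r"
  shows "\<not> near j" "cartan r j = 0" "cartan j r = 0" "cartan (tau i) j = 0" "cartan j (tau i) = 0"
    "j \<noteq> i" "j \<noteq> tau i" "tau j \<noteq> r" "tau j \<noteq> i" "tau j \<noteq> tau i" "cartan j i = -1"
proof -
  show n: "\<not> near j"
    using near_pair[OF assms(1), of j] near_props(13,15)[OF assms(1)] assms(3) by (cases "i = j") auto
  have "cartan r j \<noteq> 2" using assms(4) by (auto simp: cartan_def)
  then show 1: "cartan r j = 0" using n unfolding near_iff by (auto simp: cartan_def split: if_splits)
  then show "cartan j r = 0" using cartan_sym[of j r] by simp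
  show 2: "cartan (tau i) j = 0"
    by (rule cartan_tau_adjacent(1)[OF near_props(1)[OF assms(1)] assms(2,3) near_props(5)[OF assms(1)] assms(4)])
  then show "cartan j (tau i) = 0" using cartan_sym[of j "tau i"] by simp
  show "j \<noteq> i" "j \<noteq> tau i" using n assms(1) near_props(3)[OF assms(1)] by auto
  then show "tau j \<noteq> i" "tau j \<noteq> tau i"
    using tau_props(2)[OF assms(2)] near_props(4)[OF assms(1)] by metis+
  show "tau j \<noteq> r" using tau_props(5)[OF assms(2)] assms(4) by simp
  show "cartan j i = -1" using cartan_sym[of j i] assms(3) by simp
qed

text \<open>The flag chooses between tau_r^- (\<open>True\<close>) and tau_r (\<open>False\<close>),
  so that both are treated together. The h_j are fixed because T_r is the identity on
  kT_theta.\<close>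

definition tgen :: "bool \<Rightarrow> kgen \<Rightarrow> (kgen, 'k) falg" where
  "tgen b g = (case g of
     KB j \<Rightarrow> if near j then (if b then fcomm q (kb r) (kb j) else fcomm q (kb j) (kb r)) else kb j
   | KH j \<Rightarrow> kh j)"

end

section \<open>Rewriting rules obtained from overlaps of the relations\<close>

locale kcomp = kideal q n r I + qideal q I
  for q :: "'k::field" and n r :: nat and I :: "(kgen, 'k) falg set"
begin

abbreviation "B i \<equiv> M (kb i)"
abbreviation "H i \<equiv> M (kh i)"

text \<open>Division by q + q^{-1}: if this were 0, then q^2 = -1 and q^4 = 1.\<close>

lemma Q_cancel: assumes "Q 1 x + Q (-1) x = Q 1 y + Q (-1) y" shows "nu x = nu y"
proof -
  have "q + inverse q \<noteq> 0"
  proof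
    assume "q + inverse q = 0"
    then have "q ^ 2 = -1" using q0 by (simp add: power2_eq_square field_simps eq_neg_iff_add_eq_0)
    then have "q ^ 4 = 1" using power_mult[of q 2 2] by simp
    then show False using q_root by (metis zero_less_numeral)
  qed
  then have c: "fconst (inverse (q + inverse q)) * (fconst q + fconst (inverse q)) = (1 :: (kgen, 'k) falg)"
    by (simp flip: fconst_simps(1,3) add: fconst_simps(6))
  have "nu z = M (fconst (inverse (q + inverse q))) (Q 1 z + Q (-1) z)" for z
    using arg_cong[OF c, of "\<lambda>x. M x z"] by (simp only: M_poly M_fconst)
  then show ?thesis using assms by simp
qed

lemma H_B: "i \<in> {1..n} \<Longrightarrow> j \<in> {1..n} \<Longrightarrow> H i (B j z) = Q (cartan (tau i) j - cartan i j) (B j (H i z))"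
  using M_eqD[OF h_b[of i j], of z] by (simp only: M_poly M_fconst)

lemma B_commute: "i \<in> {1..n} \<Longrightarrow> j \<in> {1..n} \<Longrightarrow> cartan i j = 0 \<Longrightarrow>
    B i (B j z) = B j (B i z) + (if j = tau i then C (H i z) - C (H j z) else 0)"
  using M_eqD[OF b_comm[of i j], of z] by (auto simp: M_poly M_fconst C_lin diff_eq_eq add.commute)

lemma B_serre: "i \<in> {1..n} \<Longrightarrow> j \<in> {1..n} \<Longrightarrow> cartan i j = -1 \<Longrightarrow>
    B i (B i (B j z)) = Q 1 (B i (B j (B i z))) + Q (-1) (B i (B j (B i z))) - B j (B i (B i z))
      - (if i = r then Q (-1) (B j z) else 0)"
  using M_eqD[of "fserre q (kb i) (kb j) + (if i = r then fconst (inverse q) * kb j else 0)" 0 z] b_serre[of i j]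
  by (cases "i = r") (simp_all add: M_poly M_fserre M_fconst algebra_simps)

context
  fixes i
  assumes i: "near i"
begin

lemma rules_RA:
  "B r (B r (B i z)) = Q 1 (B r (B i (B r z))) + Q (-1) (B r (B i (B r z))) - B i (B r (B r z)) - Q (-1) (B i z)"
  "B r (B i (B i z)) = Q 1 (B i (B r (B i z))) + Q (-1) (B i (B r (B i z))) - B i (B i (B r z))"
  using B_serre[OF r_in near_props(1,9)[OF i], of z] B_serre[OF near_props(1)[OF i] r_in near_props(10)[OF i], of z]
    near_props(5)[OF i] by (simp_all add: algebra_simps)

lemma rules_RA':
  "B r (B r (B (tau i) z)) = Q 1 (B r (B (tau i) (B r z))) + Q (-1) (B r (B (tau i) (B r z)))
    - B (tau i) (B r (B r z)) - Q (-1) (B (tau i) z)"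
  "B r (B (tau i) (B (tau i) z)) = Q 1 (B (tau i) (B r (B (tau i) z))) + Q (-1) (B (tau i) (B r (B (tau i) z)))
    - B (tau i) (B (tau i) (B r z))"
  using B_serre[OF r_in near_props(2,12)[OF i], of z] B_serre[OF near_props(2)[OF i] r_in near_props(11)[OF i], of z]
    near_props(6)[OF i] by (simp_all add: algebra_simps)

lemma rule_AA': "B i (B (tau i) z) = B (tau i) (B i z) + C (H i z) - C (H (tau i) z)"
  using B_commute[OF near_props(1,2,13)[OF i], of z] by simp

lemma rules_H:
  "H i (B r z) = B r (H i z)" "H (tau i) (B r z) = B r (H (tau i) z)"
  "H i (B i z) = Q (-2) (B i (H i z))" "H (tau i) (B i z) = Q 2 (B i (H (tau i) z))"
  "H i (B (tau i) z) = Q 2 (B (tau i) (H i z))" "H (tau i) (B (tau i) z) = Q (-2) (B (tau i) (H (tau i) z))"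
  "H i (H (tau i) z) = nu z" "H (tau i) (H i z) = nu z"
  using near_props[OF i] r_in M_h_inv[of i] M_h_inv'[of i] by (simp_all add: H_B Q_0 nu_M del: atLeastAtMost_iff One_nat_def)

text \<open>Write R, A, A' for b_r, b_i, b_{tau i}. The word R R A A' can be rewritten at R R A or
  at A A'. Comparing the results gives q + q^{-1} times a relation with leading word R A R
  A'.\<close>

lemma rule_RARA': "B r (B i (B r (B (tau i) z)))
   = B i (B r (B (tau i) (B r z))) + B r (B (tau i) (B r (B i z))) - B (tau i) (B r (B i (B r z)))"
proof -
  let ?x = "B r (B i (B r (B (tau i) z))) + B (tau i) (B r (B i (B r z)))"
  let ?y = "B i (B r (B (tau i) (B r z))) + B r (B (tau i) (B r (B i z)))"
  have 1: "B r (B r (B i (B (tau i) z))) = B r (B r (B (tau i) (B i z))) + C (H i (B r (B r z))) - C (H (tau i) (B r (B r z)))"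
    by (simp only: rule_AA' M_simps rules_H)
  have 2: "B i (B (tau i) (B r (B r z))) = B (tau i) (B i (B r (B r z))) + C (H i (B r (B r z))) - C (H (tau i) (B r (B r z)))"
    by (rule rule_AA')
  have "Q 1 ?x + Q (-1) ?x = Q 1 ?y + Q (-1) ?y"
    using 1 unfolding rules_RA rules_RA' using 2
    by (simp only: M_simps rules_RA rules_RA') (simp add: algebra_simps rule_AA' M_simps)
  from Q_cancel[OF this] show ?thesis by (simp add: M_simps algebra_simps)
qed

end

lemma rules_RN:
  assumes "near i" "j \<in> {1..n}" "cartan i j = -1" "j \<noteq> r"
  shows "B r (B j z) = B j (B r z)" "B (tau i) (B j z) = B j (B (tau i) z)"
    "B i (B i (B j z)) = Q 1 (B i (B j (B i z))) + Q (-1) (B i (B j (B i z))) - B j (B i (B i z))"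
    "B i (B j (B j z)) = Q 1 (B j (B i (B j z))) + Q (-1) (B j (B i (B j z))) - B j (B j (B i z))"
proof -
  note ij = near_props[OF assms(1)] near_second[OF assms]
  show "B r (B j z) = B j (B r z)"
    using B_commute[OF r_in assms(2), of z] ij tau_props(3) assms(4) by simp
  show "B (tau i) (B j z) = B j (B (tau i) z)"
    using B_commute[OF near_props(2)[OF assms(1)] assms(2), of z] ij by simp
  show "B i (B i (B j z)) = Q 1 (B i (B j (B i z))) + Q (-1) (B i (B j (B i z))) - B j (B i (B i z))"
    using B_serre[OF near_props(1)[OF assms(1)] assms(2,3), of z] ij by simp
  show "B i (B j (B j z)) = Q 1 (B j (B i (B j z))) + Q (-1) (B j (B i (B j z))) - B j (B j (B i z))"
    using B_serre[OF assms(2) near_props(1)[OF assms(1)], of z] ij assms(4) by (simp add: algebra_simps)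
qed

text \<open>With N = b_j, the overlapping word is R A A N, rewritten at R A A or at A A N; again a
  factor q + q^{-1} is divided out.\<close>

lemma rule_RANA:
  assumes "near i" "j \<in> {1..n}" "cartan i j = -1" "j \<noteq> r"
  shows "B r (B i (B j (B i z))) = B i (B r (B i (B j z))) - B i (B j (B i (B r z))) + B j (B i (B r (B i z)))"
proof -
  note rules = rules_RA[OF assms(1)] rules_RN[OF assms]
  let ?x = "B r (B i (B j (B i z))) + B i (B j (B i (B r z)))"
  let ?y = "B i (B r (B i (B j z))) + B j (B i (B r (B i z)))"
  have "B r (B i (B i (B j z))) = B r (Q 1 (B i (B j (B i z))) + Q (-1) (B i (B j (B i z))) - B j (B i (B i z)))"
    by (simp only: rules)
  then have "Q 1 ?x + Q (-1) ?x = Q 1 ?y + Q (-1) ?y"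
    unfolding rules_RA(2)[OF assms(1)] by (simp only: M_simps rules) (simp add: algebra_simps M_simps)
  from Q_cancel[OF this] show ?thesis by (simp add: M_simps algebra_simps)
qed

text \<open>The overlapping word is R R A N A, where the Serre rule for R R A competes with
  \<open>rule_RANA\<close> for R A N A. The new word R A R A N appears with coefficient 1.\<close>

lemma rule_RARAN:
  assumes "near i" "j \<in> {1..n}" "cartan i j = -1" "j \<noteq> r"
  shows "B r (B i (B r (B i (B j z)))) = Q 1 (B r (B i (B j (B r (B i z))))) + Q (-1) (B r (B i (B j (B r (B i z)))))
     - Q 1 (B i (B j (B r (B i (B r z))))) - Q (-1) (B i (B j (B r (B i (B r z)))))
     + B i (B r (B i (B j (B r z)))) + B j (B i (B r (B i (B r z)))) - B j (B r (B i (B r (B i z))))"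
proof -
  note RN = rules_RN(1)[OF assms] and RRA = rules_RA(1)[OF assms(1)]
  have "B r (B r (B i (B j (B i z)))) = Q 1 (B r (B i (B j (B r (B i z))))) + Q (-1) (B r (B i (B j (B r (B i z)))))
      - B i (B j (B r (B r (B i z)))) - Q (-1) (B i (B j (B i z)))"
    unfolding RRA[of "B j (B i z)"] RN by (rule refl)
  moreover have "B i (B j (B r (B r (B i z)))) = Q 1 (B i (B j (B r (B i (B r z))))) + Q (-1) (B i (B j (B r (B i (B r z)))))
      - B i (B j (B i (B r (B r z)))) - Q (-1) (B i (B j (B i z)))"
    by (simp only: RRA M_simps)
  moreover have "B r (B r (B i (B j (B i z)))) = B r (B i (B r (B i (B j z)))) - B r (B i (B j (B i (B r z))))
      + B j (B r (B i (B r (B i z))))"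
    unfolding rule_RANA[OF assms, of z] by (simp only: M_simps RN)
  moreover have "B r (B i (B j (B i (B r z)))) = B i (B r (B i (B j (B r z)))) - B i (B j (B i (B r (B r z))))
      + B j (B i (B r (B i (B r z))))"
    by (rule rule_RANA[OF assms])
  ultimately show ?thesis by (simp add: algebra_simps)
qed

section \<open>The images of the generators satisfy the relations\<close>

abbreviation "Y b i \<equiv> M (ev (tgen b) (kb i))"

lemma Y_near: "near i \<Longrightarrow> Y b i z = (if b then B r (B i z) - Q 1 (B i (B r z)) else B i (B r z) - Q 1 (B r (B i z)))"
  by (simp add: ev_fgen tgen_def M_fcomm)

lemma Y_far: "\<not> near i \<Longrightarrow> Y b i z = B i z"
  by (simp add: ev_fgen tgen_def)

lemma Y_serre_r:
  assumes "near i"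
  shows "Y b i (Y b i (B r z)) = Q 1 (Y b i (B r (Y b i z))) + Q (-1) (Y b i (B r (Y b i z))) - B r (Y b i (Y b i z))"
    "B r (B r (Y b i z)) = Q 1 (B r (Y b i (B r z))) + Q (-1) (B r (Y b i (B r z))) - Y b i (B r (B r z)) - Q (-1) (Y b i z)"
  by (cases b; simp add: Y_near assms M_simps rules_RA[OF assms])+

lemma Y_commute:
  assumes "near i"
  shows "Y b i (Y b (tau i) z) = Y b (tau i) (Y b i z) + C (H i z) - C (H (tau i) z)"
  using near_props(3)[OF assms]
  by (cases b; simp add: Y_near assms M_simps rules_RA[OF assms] rules_RA'[OF assms] rule_AA'[OF assms]
      rules_H[OF assms] rule_RARA'[OF assms])

lemma Y_second:
  assumes "near i" "j \<in> {1..n}" "cartan i j = -1" "j \<noteq> r"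
  shows "B j (B j (Y b i z)) = Q 1 (B j (Y b i (B j z))) + Q (-1) (B j (Y b i (B j z))) - Y b i (B j (B j z))"
  by (cases b; simp add: Y_near assms(1) M_simps rules_RN[OF assms])

lemma Y_second':
  assumes "near i" "j \<in> {1..n}" "cartan i j = -1" "j \<noteq> r"
  shows "Y b i (Y b i (B j z)) = Q 1 (Y b i (B j (Y b i z))) + Q (-1) (Y b i (B j (Y b i z))) - B j (Y b i (Y b i z))"
  by (cases b; simp add: Y_near assms(1) M_simps rules_RN[OF assms] rules_RA[OF assms(1)] rule_RANA[OF assms]
      rule_RARAN[OF assms])

text \<open>Every h_i commutes with b_r, so a q-commutator of b_j with b_r keeps the weight of
  b_j.\<close>

lemma H_Y: assumes "i \<in> {1..n}" "j \<in> {1..n}"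
  shows "H i (Y b j z) = Q (cartan (tau i) j - cartan i j) (Y b j (H i z))"
proof -
  have "cartan (tau i) r = cartan i r"
    using cartan_tau(2)[OF assms(1) r_in] by (simp add: tau_props(3))
  then have "H i (B r z) = B r (H i z)" for z using H_B[OF assms(1) r_in] by (simp add: Q_0 nu_M)
  then show ?thesis
    by (cases "near j"; cases b) (simp_all add: Y_near Y_far M_simps H_B[OF assms] add.commute del: atLeastAtMost_iff)
qed

lemma krels_tgen: assumes "x \<in> krels" shows "ev (tgen b) x \<in> I"
proof -
  have 0: "x \<in> I" if "\<And>z. M x z = 0" for x
    using M_eqI[of x 0] that by (simp add: M_poly)
  have h: "ev (tgen b) (kh j) = kh j" for j by (simp add: ev_fgen tgen_def)
  show ?thesis using assms
  proof (cases rule: krels.cases)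
    case (h_inv i)
    show ?thesis unfolding h_inv(1) ev.diff ev_mult ev_one h by (rule I_rels(1)[OF h_inv(2)])
  next
    case h_r
    show ?thesis unfolding h_r ev.diff ev_mult ev_one h by (rule I_rels(2))
  next
    case (h_comm i j)
    show ?thesis unfolding h_comm(1) ev.diff ev_mult ev_one h by (rule I_rels(3)[OF h_comm(2,3)])
  next
    case (h_b i j)
    show ?thesis unfolding h_b(1) ev.diff ev_mult ev_fconst h
      by (intro 0) (simp only: M_poly M_fconst H_Y[OF h_b(2,3)] diff_self)
  next
    case (b_comm i j)
    have neq: "i \<noteq> j" "cartan j i = 0" using b_comm cartan_sym[of i j] by (auto simp: cartan_def)
    have "Y b i (Y b j z) = Y b j (Y b i z) + (if j = tau i then C (H i z) - C (H j z) else 0)" for z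
    proof -
      \<comment> \<open>The node j is not r, which is adjacent to i, and is not adjacent to r, since
        it is not near. So b_j commutes with both b_i and b_r.\<close>
      have *: "Y b i (B j z) = B j (Y b i z)" "j \<noteq> tau i" "i \<noteq> tau j"
        if ij: "near i" "\<not> near j" "i \<in> {1..n}" "j \<in> {1..n}" "cartan i j = 0" for i j z
      proof -
        have jr: "j \<noteq> r" using ij near_props(10)[OF ij(1)] by auto
        then have rj: "cartan r j = 0" using ij(2) by (auto simp: near_iff cartan_def split: if_splits)
        show jt: "j \<noteq> tau i" using ij near_props(3)[OF ij(1)] by auto
        then show "i \<noteq> tau j" using tau_props(2)[OF ij(4)] by auto
        show "Y b i (B j z) = B j (Y b i z)"
          using B_commute[OF ij(3,4,5)] B_commute[OF r_in ij(4) rj] jt jr tau_props(3)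
          by (cases b) (simp_all add: Y_near[OF ij(1)] M_simps)
      qed
      show ?thesis
      proof (cases "near i"; cases "near j")
        assume "near i" "near j"
        then show ?thesis using Y_commute[of i b z] near_pair[of i j] neq by (simp add: add_diff_eq)
      next
        assume "near i" "\<not> near j"
        then show ?thesis using *[of i j] b_comm by (simp add: Y_far del: atLeastAtMost_iff)
      next
        assume "\<not> near i" "near j"
        then show ?thesis using *[of j i] b_comm neq by (simp add: Y_far del: atLeastAtMost_iff)
      next
        assume "\<not> near i" "\<not> near j"
        then show ?thesis using B_commute[OF b_comm(2-4)] by (simp add: Y_far)
      qed
    qed
    then show ?thesis unfolding b_comm(1)
      by (intro 0, cases "j = tau i")
        (simp_all only: ev.diff ev.zero ev_mult ev_fconst h M_poly M_fconst C_lin if_True if_False refl, simp_all)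
  next
    case (b_serre i j)
    have "Y b i (Y b i (Y b j z)) = Q 1 (Y b i (Y b j (Y b i z))) + Q (-1) (Y b i (Y b j (Y b i z))) - Y b j (Y b i (Y b i z))
      - (if i = r then Q (-1) (Y b j z) else 0)" for z
    proof -
      have nn: "\<not> (near i \<and> near j)"
        using near_pair[of i j] near_props(13,15)[of i] b_serre(4) by (cases "i = j") auto
      have ji: "cartan j i = -1" using cartan_sym[of j i] b_serre(4) by simp
      consider "near i" "j = r" | "near i" "j \<noteq> r" "\<not> near j" | "near j" "i = r" | "near j" "i \<noteq> r" "\<not> near i"
        | "\<not> near i" "\<not> near j" using nn by blast
      then show ?thesis
      proof cases
        case 1
        then have "\<not> near r" "i \<noteq> r" using near_props(5) by blast+
        then show ?thesis using Y_serre_r(1)[OF 1(1), of b z] 1(2) by (simp only: Y_far if_False diff_zero not_False_eq_True)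
      next
        case 2
        then have "i \<noteq> r" using near_props(5) by blast
        then show ?thesis using Y_second'[OF 2(1) b_serre(3,4) 2(2), of b z] 2(3)
          by (simp only: Y_far if_False diff_zero not_False_eq_True)
      next
        case 3
        then have "\<not> near r" using near_props(5) by blast
        then show ?thesis using Y_serre_r(2)[OF 3(1), of b z] 3(2) by (simp only: Y_far if_True not_False_eq_True refl)
      next
        case 4
        then show ?thesis using Y_second[OF 4(1) b_serre(2) ji 4(2), of b z]
          by (simp only: Y_far if_False diff_zero not_False_eq_True)
      next
        case 5
        then show ?thesis using B_serre[OF b_serre(2-4), of z] by (simp only: Y_far not_False_eq_True)
      qed
    qed
    moreover have "ev (tgen b) (fserre q (kb i) (kb j)) = fserre q (ev (tgen b) (kb i)) (ev (tgen b) (kb j))"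
      by (simp only: fserre_def ev.add ev.diff ev_mult ev_fconst)
    ultimately show ?thesis unfolding b_serre(1)
      by (intro 0, cases "i = r")
        (simp_all only: ev.add ev.zero ev_mult ev_fconst M_poly M_fserre M_fconst if_True if_False refl, simp_all)
  next
    case (b_junk j)
    then have "\<not> near j" using near_props(1)[of j] by auto
    then show ?thesis unfolding b_junk(1) using I_rels(7)[OF b_junk(2)] by (simp add: ev_fgen tgen_def)
  next
    case (h_junk j)
    show ?thesis unfolding h_junk(1) ev.diff ev_one h by (rule I_rels(8)[OF h_junk(2)])
  qed
qed

end

section \<open>The values of tau_i on generators and congruences modulo the ideal\<close>

context aiii
begin

text \<open>On the torus, T_i T_{tau i} multiplies K_m K_{tau m}^{-1} by K_i^e K_{tau i}^{-e} =
  h_i^e with e = a_{tau i, m} - a_{i m}, written here as one power for each Cartan entry.\<close>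

definition ugen :: "'k \<Rightarrow> nat \<Rightarrow> kgen \<Rightarrow> (kgen, 'k) falg" where
  "ugen s i g = (case g of
     KB m \<Rightarrow>
       if m \<notin> {1..n} then kb m
       else if cartan i m = -1 \<and> cartan (tau i) m \<noteq> -1 then fconst (inverse s) * fcomm q (kb m) (kb i)
       else if cartan i m \<noteq> -1 \<and> cartan (tau i) m = -1 then fconst (inverse s) * fcomm q (kb m) (kb (tau i))
       else if cartan i m = -1 \<and> cartan (tau i) m = -1
         then fconst (inverse q) * fcomm q (fcomm q (kb m) (kb i)) (kb (tau i)) + kb m * kh i
       else if m = i then fconst q * (kh (tau i) * kb (tau i))
       else if m = tau i then fconst q * (kh i * kb i)
       else kb m
   | KH m \<Rightarrow> if m \<in> {1..n} then kh m * (hpow i (- cartan i m) * hpow i (cartan (tau i) m)) else kh m)"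

end

context kcomp
begin

definition eqv :: "(kgen, 'k) falg \<Rightarrow> (kgen, 'k) falg \<Rightarrow> bool" (infix \<open>\<doteq>\<close> 50) where
  "x \<doteq> y \<longleftrightarrow> (\<forall>z. M x z = M y z)"

lemma cong_iff: "x \<doteq> y \<longleftrightarrow> x - y \<in> I"
  using M_eqI[of x y] M_eqD[of x y] by (auto simp: eqv_def)

lemma cong_refl [simp]: "x \<doteq> x"
  and cong_sym: "x \<doteq> y \<Longrightarrow> y \<doteq> x"
  and cong_trans [trans]: "x \<doteq> y \<Longrightarrow> y \<doteq> z \<Longrightarrow> x \<doteq> z"
  by (simp_all add: eqv_def)

lemma cong_add: "x \<doteq> x' \<Longrightarrow> y \<doteq> y' \<Longrightarrow> x + y \<doteq> x' + y'"
  and cong_mult: "x \<doteq> x' \<Longrightarrow> y \<doteq> y' \<Longrightarrow> x * y \<doteq> x' * y'"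
  and cong_fcomm: "x \<doteq> x' \<Longrightarrow> y \<doteq> y' \<Longrightarrow> fcomm q x y \<doteq> fcomm q x' y'"
  by (simp_all add: eqv_def M_simps)

lemma ev_cong:
  assumes "\<And>a. ev f (fgen a) \<doteq> ev g (fgen a)"
  shows "ev f x \<doteq> ev g x"
  by (induction x rule: falg_induct) (simp_all add: assms ev_fconst ev.add ev_mult cong_add cong_mult)

lemma cong_ev: "(\<And>x. x \<in> I \<Longrightarrow> ev f x \<in> I) \<Longrightarrow> x \<doteq> y \<Longrightarrow> ev f x \<doteq> ev f y"
  unfolding cong_iff ev.diff[symmetric] by blast

lemma ev_ev: "ev f (ev g x) = ev (\<lambda>a. ev f (g a)) x"
  by (induction x rule: falg_induct) (simp_all add: ev_fconst ev.add ev_mult ev_fgen)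

abbreviation "tp \<equiv> ev (tgen False)"
abbreviation "tm \<equiv> ev (tgen True)"

lemma t_simps: "ev (tgen b) (kh j) = kh j" "\<not> near j \<Longrightarrow> ev (tgen b) (kb j) = kb j"
  "near j \<Longrightarrow> tp (kb j) = fcomm q (kb j) (kb r)" "near j \<Longrightarrow> tm (kb j) = fcomm q (kb r) (kb j)"
  "ev (tgen b) (kb r) = kb r"
  using near_props(5)[of r] by (auto simp: ev_fgen tgen_def)

lemma near_inverse:
  assumes "near i"
  shows "fcomm q (kb r) (fcomm q (kb i) (kb r)) \<doteq> kb i" "fcomm q (fcomm q (kb r) (kb i)) (kb r) \<doteq> kb i"
  unfolding eqv_def by (simp_all add: M_simps rules_RA[OF assms])

lemma tp_tm: "tp (tm x) \<doteq> x" and tm_tp: "tm (tp x) \<doteq> x"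
proof -
  have *: "ev (tgen b) (ev (tgen (\<not> b)) (fgen a)) \<doteq> fgen a" for a b
  proof (cases a)
    case (KB j)
    then show ?thesis
      by (cases "near j"; cases b)
        (auto simp: t_simps ev_fcomm near_inverse simp del: One_nat_def)
  qed (simp add: t_simps)
  have id: "ev fgen x = x" for x :: "(kgen, 'k) falg"
    by (induction x rule: falg_induct) (simp_all add: ev_simps)
  show "tp (tm x) \<doteq> x" "tm (tp x) \<doteq> x"
    using ev_cong[of "\<lambda>a. ev (tgen False) (tgen True a)" fgen x] *[of False]
      ev_cong[of "\<lambda>a. ev (tgen True) (tgen False a)" fgen x] *[of True]
    by (simp_all add: ev_ev ev_fgen id)
qed

lemma tgen_hpow: "ev (tgen b) (hpow i e) = hpow i e"
proof -
  have "ev (tgen b) (kh j ^ k) = kh j ^ k" for j k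
    by (induction k) (simp_all add: ev_mult ev_one t_simps)
  then show ?thesis by (simp add: hpow_def)
qed

lemma tgen_ugen_h: "ev (tgen b) (ev (ugen s i) (kh m)) = ev (ugen s i) (kh m)"
  by (simp add: ev_fgen ugen_def ev_mult tgen_hpow tgen_def)

lemma tgen_ugen_hpow: "ev (tgen b) (ev (ugen s i) (hpow j e)) = ev (ugen s i) (hpow j e)"
proof -
  have "ev (tgen b) (ev (ugen s i) (kh j ^ k)) = ev (ugen s i) (kh j ^ k)" for j k
    by (induction k) (simp_all add: ev_mult ev_one tgen_ugen_h)
  then show ?thesis by (simp add: hpow_def)
qed

text \<open>For i = r - 1 this is the image of b_r under tau_i. The index is left free so that
  formulas can be reflected to tau i.\<close>

definition TR :: "nat \<Rightarrow> (kgen, 'k) falg" where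
  "TR i = fconst (inverse q) * fcomm q (fcomm q (kb r) (kb i)) (kb (tau i)) + kb r * kh i"

text \<open>Exchanging b_i and b_{tau i} changes the double q-commutator by (1 - q^2) b_r (h_i -
  h_{tau i})/(q - q^{-1}), and the summand b_r h_i compensates this after the factor q^{-1}.\<close>

lemma TR_sym: assumes "near i" shows "TR i \<doteq> TR (tau i)"
  unfolding eqv_def
  by (simp add: TR_def near_props(4)[OF assms] M_simps rule_AA'[OF assms] rules_H[OF assms] QC_reduce[OF q_diff])

text \<open>For i = r - 1 the left side is the image of [b_i, b_r]_q under tau_i, by
  \<open>TR_image\<close>.\<close>

lemma TR_fcomm: assumes "near i"
  shows "fcomm q (fconst q * (kh (tau i) * kb (tau i))) (TR i) \<doteq> fcomm q (kb r) (kb (tau i))"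
  unfolding eqv_def
  by (simp add: TR_def M_simps rule_AA'[OF assms] rules_RA'[OF assms] rules_H[OF assms] QC_reduce[OF q_diff])

lemma TR_fcomm': assumes "near i"
  shows "fcomm q (fconst q * (kh i * kb i)) (TR i) \<doteq> fcomm q (kb r) (kb i)"
proof -
  have "fcomm q (fconst q * (kh i * kb i)) (TR i) \<doteq> fcomm q (fconst q * (kh i * kb i)) (TR (tau i))"
    by (intro cong_fcomm cong_refl TR_sym assms)
  also have "\<dots> \<doteq> fcomm q (kb r) (kb i)"
    using TR_fcomm[OF near_props(3)[OF assms]] near_props(4)[OF assms] by simp
  finally show ?thesis .
qed

text \<open>As h_{tau i} scales b_i and b_{tau i} by inverse factors, the first summand equals
  -q^{-1} [[b_r, b_i]_q, b_{tau i}]_q h_{tau i}. It cancels in the sum and leaves b_r h_i h_{tau i}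
  = b_r.\<close>

lemma TR_inverse: assumes "near i"
  shows "fconst (inverse q) * fcomm q (fconst q * (kh (tau i) * kb (tau i))) (fcomm q (kb r) (kb i)) + TR i * kh (tau i) \<doteq> kb r"
  unfolding eqv_def
  by (simp add: TR_def M_simps rules_H[OF assms])

text \<open>With X = [b_j, b_i]_q the two sides are [[X, b_r]_q, b_{tau i}]_q and [X,
  [b_r, b_{tau i}]_q]_q, since b_j commutes with b_r. They differ by q times the commutator of X
  b_{tau i} - b_{tau i} X with b_r. That element lies in the algebra generated by b_j, h_i, h_{tau
  i}, all of which commute with b_r.\<close>

lemma second_braid:
  assumes "near i" "j \<in> {1..n}" "cartan i j = -1" "j \<noteq> r"
  shows "fcomm q (fcomm q (kb j) (fcomm q (kb i) (kb r))) (kb (tau i))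
    \<doteq> fcomm q (fcomm q (kb j) (kb i)) (fcomm q (kb r) (kb (tau i)))"
proof -
  have "cartan (tau i) j - cartan i j = 1" using near_second(4)[OF assms] assms(3) by simp
  moreover have "cartan (tau (tau i)) j - cartan (tau i) j = -1"
    using near_second(4)[OF assms] assms(3) near_props(4)[OF assms(1)] by simp
  ultimately have "H i (B j z) = Q 1 (B j (H i z))" "H (tau i) (B j z) = Q (-1) (B j (H (tau i) z))" for z
    using H_B[OF near_props(1)[OF assms(1)] assms(2)] H_B[OF near_props(2)[OF assms(1)] assms(2)] by simp_all
  then show ?thesis
    unfolding eqv_def
    by (simp add: M_simps rule_AA'[OF assms(1)] rules_H[OF assms(1)] rules_RN(1,2)[OF assms, symmetric] QC_reduce[OF q_diff])
qed

end

section \<open>Commutation and braid relations on generators\<close>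

locale braid = kcomp q n r I for q :: "'k::field" and n r :: nat and I :: "(kgen, 'k) falg set" +
  fixes s :: 'k and i :: nat
  assumes s: "s ^ 2 = q" and i: "i \<in> {1..r - 1}"
    and tgen_I: "x \<in> I \<Longrightarrow> ev (tgen b) x \<in> I" and ugen_I: "x \<in> I \<Longrightarrow> ev (ugen s i) x \<in> I"
begin

abbreviation "tu \<equiv> ev (ugen s i)"

lemma tgen_cong: "x \<doteq> y \<Longrightarrow> ev (tgen b) x \<doteq> ev (tgen b) y"
  by (rule cong_ev) (rule tgen_I)

lemma tu_cong: "x \<doteq> y \<Longrightarrow> tu x \<doteq> tu y"
  by (rule cong_ev) (rule ugen_I)

text \<open>Away from r - 1 both b_i and b_{tau i} commute with b_r, so a q-commutator with b_r and
  one with b_i or b_{tau i} may be formed in either order.\<close>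

lemma commuting:
  assumes "i \<noteq> r - 1"
  shows "tp (tu x) \<doteq> tu (tp x)"
proof -
  have i_in: "i \<in> {1..n}" "tau i \<in> {1..n}" using i by (auto simp: n_def dtau_def)
  have ti: "tau i + i = 2 * r" using i by (auto simp: n_def dtau_def)
  have "i + 2 \<le> r" using i assms by auto
  then have a: "i + 2 \<le> r" "r + 2 \<le> tau i" using ti by linarith+
  have far: "\<not> near i" "\<not> near (tau i)" "i \<noteq> r" "tau i \<noteq> r" "cartan i r = 0" "cartan (tau i) r = 0"
    using a by (auto simp: near_def cartan_def)
  have R: "tu (kb r) = kb r" using far r_in by (simp add: ev_fgen ugen_def del: atLeastAtMost_iff)
  have "tp (tu (fgen a)) \<doteq> tu (tp (fgen a))" for a
  proof (cases a)
    case (KH m)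
    then show ?thesis by (simp add: t_simps tgen_ugen_h)
  next
    case (KB m)
    show ?thesis
    proof (cases "near m")
      case False
      then have "tp (tu (kb m)) = tu (kb m)"
        by (simp add: ev_fgen[of "ugen s i"] ugen_def far ev.add ev_mult ev_fconst ev_fcomm t_simps)
      then show ?thesis using False KB by (simp add: t_simps)
    next
      case True
      have Rx: "kb r * kb x \<doteq> kb x * kb r" if "x = i \<or> x = tau i" for x
      proof -
        have "x \<in> {1..n}" "cartan r x = 0" "x \<noteq> tau r" using that i_in far cartan_sym[of r x] tau_props(3) by auto
        then show ?thesis using B_commute[OF r_in] by (simp add: eqv_def M_simps)
      qed
      have c: "fcomm q (fcomm q (kb m) (kb r)) (kb x) \<doteq> fcomm q (fcomm q (kb m) (kb x)) (kb r)"
        if "x = i \<or> x = tau i" for x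
        using Rx[OF that] by (simp add: eqv_def M_simps)
      have "tu (kb m) = kb m \<or> (\<exists>x. (x = i \<or> x = tau i) \<and> tu (kb m) = fconst (inverse s) * fcomm q (kb m) (kb x))"
      proof -
        have "m \<in> {1..n}" "m \<noteq> i" "m \<noteq> tau i" using True far near_props(1) by auto
        moreover have "\<not> (cartan i m = -1 \<and> cartan (tau i) m = -1)"
        proof
          assume "cartan i m = -1 \<and> cartan (tau i) m = -1"
          then have "m \<le> i + 1" "tau i \<le> m + 1" by (auto simp: cartan_def split: if_splits)
          then show False using a by linarith
        qed
        ultimately show ?thesis by (auto simp: ev_fgen ugen_def simp del: atLeastAtMost_iff)
      qed
      then consider "tu (kb m) = kb m" | x where "x = i \<or> x = tau i" "tu (kb m) = fconst (inverse s) * fcomm q (kb m) (kb x)"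
        by blast
      then show ?thesis
      proof cases
        case 1
        then show ?thesis using True KB by (simp add: t_simps ev_fcomm R)
      next
        case x: (2 x)
        have "\<not> near x" using x far by auto
        have "tp (tu (kb m)) = fconst (inverse s) * fcomm q (fcomm q (kb m) (kb r)) (kb x)"
          using True \<open>\<not> near x\<close> by (simp add: x(2) ev_mult ev_fconst ev_fcomm t_simps)
        moreover have "tu (tp (kb m)) \<doteq> fconst (inverse s) * fcomm q (fcomm q (kb m) (kb x)) (kb r)"
          using True by (simp add: t_simps ev_fcomm R x(2) eqv_def M_simps M_fconst_commute[of "fgen _"] M_fconst_mult)
        ultimately show ?thesis using KB c[OF x(1)]
          by (simp add: eqv_def M_poly)
      qed
    qed
  qed
  then have "ev (\<lambda>a. tp (ugen s i a)) x \<doteq> ev (\<lambda>a. tu (tgen False a)) x"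
    by - (rule ev_cong, simp add: ev_fgen)
  then show ?thesis by (simp add: ev_ev)
qed

lemma TR_image: assumes "i = r - 1"
  shows "near i" "tu (kb r) = TR i" "tu (kb i) = fconst q * (kh (tau i) * kb (tau i))"
    "tu (kb (tau i)) = fconst q * (kh i * kb i)" "tu (kh i) \<doteq> kh (tau i)" "tu (kh (tau i)) \<doteq> kh i"
proof -
  show n: "near i" using assms by (simp add: near_def)
  note p = near_props[OF n]
  note [simp del] = atLeastAtMost_iff One_nat_def
  show "tu (kb r) = TR i" using p r_in by (simp add: ev_fgen ugen_def TR_def)
  show "tu (kb i) = fconst q * (kh (tau i) * kb (tau i))" "tu (kb (tau i)) = fconst q * (kh i * kb i)"
    using p by (simp_all add: ev_fgen ugen_def)
  have "hpow i (-2) = kh (tau i) * kh (tau i)" "hpow i 2 = kh i * kh i" "hpow i 0 = 1"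
    by (simp_all add: hpow_def power2_eq_square)
  then show "tu (kh i) \<doteq> kh (tau i)" "tu (kh (tau i)) \<doteq> kh i"
    using p by (simp_all add: ev_fgen ugen_def eqv_def M_simps rules_H[OF n])
qed

lemma braid_near:
  assumes "i = r - 1"
  shows "tu (tp (tu (kb r))) \<doteq> kb r"
    and "tu (fcomm q (kb i) (kb r)) \<doteq> fcomm q (kb r) (kb (tau i))"
    and "tu (fcomm q (kb (tau i)) (kb r)) \<doteq> fcomm q (kb r) (kb i)"
proof -
  note U = TR_image[OF assms]
  have n: "near i" "near (tau i)" using U(1) near_props(3) by blast+
  show 1: "tu (fcomm q (kb i) (kb r)) \<doteq> fcomm q (kb r) (kb (tau i))"
    unfolding ev_fcomm U by (rule TR_fcomm[OF n(1)])
  show 2: "tu (fcomm q (kb (tau i)) (kb r)) \<doteq> fcomm q (kb r) (kb i)"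
    unfolding ev_fcomm U by (rule TR_fcomm'[OF n(1)])
  \<comment> \<open>By \<open>near_inverse\<close>, tau_r turns the inner [b_r, b_i]_q into b_i. The
    other factor becomes [b_{tau i}, b_r]_q, whose image under tau_{r-1} is already known.\<close>
  have "tp (TR i) = fconst (inverse q) * fcomm q (fcomm q (kb r) (fcomm q (kb i) (kb r))) (fcomm q (kb (tau i)) (kb r))
      + kb r * kh i"
    by (simp add: TR_def ev.add ev_mult ev_fconst ev_fcomm t_simps n)
  also have "\<dots> \<doteq> fconst (inverse q) * fcomm q (kb i) (fcomm q (kb (tau i)) (kb r)) + kb r * kh i"
    by (intro cong_add cong_mult cong_fcomm cong_refl near_inverse n)
  finally have "tu (tp (TR i)) \<doteq> tu (fconst (inverse q) * fcomm q (kb i) (fcomm q (kb (tau i)) (kb r)) + kb r * kh i)"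
    by (rule tu_cong)
  also have "\<dots> = fconst (inverse q) * fcomm q (tu (kb i)) (tu (fcomm q (kb (tau i)) (kb r))) + tu (kb r) * tu (kh i)"
    by (simp only: ev.add ev_mult ev_fconst ev_fcomm)
  also have "\<dots> \<doteq> fconst (inverse q) * fcomm q (fconst q * (kh (tau i) * kb (tau i))) (fcomm q (kb r) (kb i)) + TR i * kh (tau i)"
    unfolding U(2,3) by (intro cong_add cong_mult cong_fcomm cong_refl 2 U)
  also have "\<dots> \<doteq> kb r" by (rule TR_inverse[OF n(1)])
  finally show "tu (tp (tu (kb r))) \<doteq> kb r" unfolding U(2) .
qed

text \<open>The two values of e serve the two halves of the diagram, with m = r - 2 and m = r + 2.
  The square root enters both sides as the same factor s^{-2}.\<close>

lemma braid_second:
  assumes "i = r - 1" and e: "e = i \<or> e = tau i" and m: "m \<in> {1..n}" "cartan e m = -1" "m \<noteq> r"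
  shows "tp (tu (tp (tu (kb m)))) \<doteq> tu (tp (tu (tp (kb m))))"
proof -
  note U = TR_image[OF assms(1)]
  have ne: "near e" using U(1) near_props(3) e by blast
  note N = near_second[OF ne m]
  have te: "tau e = i \<or> tau e = tau i" using e near_props(4)[OF U(1)] by auto
  have ue: "tu (fcomm q (kb e) (kb r)) \<doteq> fcomm q (kb r) (kb (tau e))"
    using e braid_near(2,3)[OF assms(1)] near_props(4)[OF U(1)] by auto
  have um: "tu (kb m) = fconst (inverse s) * fcomm q (kb m) (kb e)"
    using e m N near_props(4)[OF U(1)] by (auto simp: ev_fgen ugen_def simp del: atLeastAtMost_iff One_nat_def)
  have "tp (tu (kb m)) = fconst (inverse s) * fcomm q (kb m) (fcomm q (kb e) (kb r))"
    by (simp only: um ev_mult ev_fconst ev_fcomm t_simps(2)[OF N(1)] t_simps(3)[OF ne])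
  then have "tu (tp (tu (kb m))) = fconst (inverse s) * fcomm q (tu (kb m)) (tu (fcomm q (kb e) (kb r)))"
    by (simp only: ev_mult ev_fconst ev_fcomm)
  also have "\<dots> \<doteq> fconst (inverse s) * fcomm q (tu (kb m)) (fcomm q (kb r) (kb (tau e)))"
    by (intro cong_mult cong_fcomm cong_refl ue)
  also have "\<dots> \<doteq> fconst (inverse s) * (fconst (inverse s) * fcomm q (fcomm q (kb m) (kb e)) (fcomm q (kb r) (kb (tau e))))"
    unfolding um by (simp add: eqv_def M_simps M_fconst_commute[of "fgen _"] M_fconst_mult)
  finally have z: "tu (tp (tu (kb m))) \<doteq>
    fconst (inverse s) * (fconst (inverse s) * fcomm q (fcomm q (kb m) (kb e)) (fcomm q (kb r) (kb (tau e))))" .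
  then have "tp (tu (tp (tu (kb m)))) \<doteq>
    tp (fconst (inverse s) * (fconst (inverse s) * fcomm q (fcomm q (kb m) (kb e)) (fcomm q (kb r) (kb (tau e)))))"
    by (rule tgen_cong)
  also have "\<dots> = fconst (inverse s) * (fconst (inverse s) *
      fcomm q (fcomm q (kb m) (fcomm q (kb e) (kb r))) (fcomm q (kb r) (fcomm q (kb (tau e)) (kb r))))"
    by (simp only: ev_mult ev_fconst ev_fcomm t_simps(2)[OF N(1)] t_simps(3)[OF ne] t_simps(3)[OF near_props(3)[OF ne]]
        t_simps(5))
  also have "\<dots> \<doteq> fconst (inverse s) * (fconst (inverse s) * fcomm q (fcomm q (kb m) (fcomm q (kb e) (kb r))) (kb (tau e)))"
    by (intro cong_mult cong_fcomm cong_refl near_inverse near_props(3) ne)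
  also have "\<dots> \<doteq> fconst (inverse s) * (fconst (inverse s) * fcomm q (fcomm q (kb m) (kb e)) (fcomm q (kb r) (kb (tau e))))"
    by (intro cong_mult cong_refl second_braid ne m)
  also have "\<dots> \<doteq> tu (tp (tu (kb m)))" by (rule cong_sym[OF z])
  finally show ?thesis by (simp only: t_simps(2)[OF N(1)])
qed

text \<open>Since tau_r tau_{r-1} tau_r exchanges b_i and b_{tau i} (\<open>ptp\<close>), both sides
  become the image of b_{tau e} under tau_{r-1}.\<close>

lemma braid_first:
  assumes "i = r - 1" and e: "e = i \<or> e = tau i"
  shows "tp (tu (tp (tu (kb e)))) \<doteq> tu (tp (tu (tp (kb e))))"
proof -
  note U = TR_image[OF assms(1)]
  have ptp: "tp (tu (tp (kb x))) \<doteq> kb (tau x)" if x: "x = i \<or> x = tau i" for x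
  proof -
    have nx: "near x" using U(1) near_props(3) x by blast
    have "tu (tp (kb x)) \<doteq> tm (kb (tau x))"
      using x braid_near(2,3)[OF assms(1)] near_props(3,4)[OF U(1)] U(1) by (auto simp: t_simps)
    then have "tp (tu (tp (kb x))) \<doteq> tp (tm (kb (tau x)))" by (rule tgen_cong)
    also have "\<dots> \<doteq> kb (tau x)" by (rule tp_tm)
    finally show ?thesis .
  qed
  have te: "tau e = i \<or> tau e = tau i" "tau (tau e) = e" using e near_props(4)[OF U(1)] by auto
  have ue: "tu (kb e) = fconst q * (kh (tau e) * kb (tau e))" "tu (kb (tau e)) = fconst q * (kh e * kb e)"
    and uh: "tu (kh (tau e)) \<doteq> kh e"
    using e U near_props(4)[OF U(1)] by auto
  have "tp (tu (kh (tau e))) \<doteq> kh e" using tgen_cong[OF uh, of False] by (simp add: t_simps)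
  then have "fconst q * (tp (tu (kh (tau e))) * tp (tu (tp (kb (tau e))))) \<doteq> fconst q * (kh e * kb e)"
    using ptp[OF te(1)] te(2) by (intro cong_mult cong_refl) simp_all
  then have "tp (tu (tp (tu (kb e)))) \<doteq> tu (kb (tau e))"
    unfolding ue by (simp only: ev_mult ev_fconst t_simps(1))
  also have "\<dots> \<doteq> tu (tp (tu (tp (kb e))))"
    by (intro tu_cong cong_sym[OF ptp] e)
  finally show ?thesis .
qed

lemma braid_relation:
  assumes "i = r - 1"
  shows "tu (tp (tu (tp x))) \<doteq> tp (tu (tp (tu x)))"
proof -
  note U = TR_image[OF assms]
  note p = near_props[OF U(1)]
  have "tp (tu (tp (tu (fgen a)))) \<doteq> tu (tp (tu (tp (fgen a))))" for a
  proof (cases a)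
    case (KH m)
    \<comment> \<open>The map tau_{r-1} sends each h_m to a product of h's, which tau_r fixes, so
      both sides are tau_{r-1} applied twice.\<close>
    have "tp (tu (tu (kh m))) = tu (tu (kh m))"
      by (simp add: ev_fgen[of _ "KH m"] ugen_def ev_mult tgen_hpow tgen_ugen_hpow tgen_def)
    then show ?thesis using KH by (simp add: t_simps tgen_ugen_h)
  next
    case (KB m)
    consider "m \<notin> {1..n}" | "m = r" | "m = i \<or> m = tau i"
      | "m \<in> {1..n}" "m \<noteq> r" "cartan i m = -1" | "m \<in> {1..n}" "m \<noteq> r" "cartan (tau i) m = -1"
      | "m \<in> {1..n}" "m \<noteq> r" "m \<noteq> i" "m \<noteq> tau i" "cartan i m \<noteq> -1" "cartan (tau i) m \<noteq> -1" by blast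
    then show ?thesis
    proof cases
      case 1
      then have "\<not> near m" using near_props(1) by blast
      then show ?thesis using 1 KB by (simp add: ev_fgen ugen_def tgen_def del: atLeastAtMost_iff)
    next
      case 2
      have "tp (tu (tp (tu (kb r)))) \<doteq> tp (kb r)" by (rule tgen_cong[OF braid_near(1)[OF assms]])
      then have "tp (tu (tp (tu (kb r)))) \<doteq> kb r" by (simp only: t_simps)
      also have "\<dots> \<doteq> tu (tp (tu (kb r)))" by (rule cong_sym[OF braid_near(1)[OF assms]])
      finally show ?thesis using 2 KB by (simp add: t_simps)
    next
      case 3
      then show ?thesis using braid_first[OF assms] KB by simp
    next
      case 4
      then show ?thesis using braid_second[OF assms, of i m] KB by simp
    next
      case 5
      then show ?thesis using braid_second[OF assms, of "tau i" m] KB by simp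
    next
      case 6
      then have "\<not> near m" using near_pair[OF U(1)] by blast
      then have "tp (kb m) = kb m" by (simp add: t_simps)
      moreover have "tu (kb m) = kb m" using 6 by (simp add: ev_fgen ugen_def del: atLeastAtMost_iff)
      ultimately show ?thesis using KB by simp
    qed
  qed
  from cong_sym[OF this] have "ev (\<lambda>a. tu (tp (tu (tgen False a)))) x \<doteq> ev (\<lambda>a. tp (tu (tp (ugen s i a)))) x"
    by - (rule ev_cong, simp add: ev_fgen)
  then show ?thesis by (simp add: ev_ev)
qed

end

section \<open>The coideal subalgebra inside the quantum group\<close>

context aiii
begin

abbreviation "U \<equiv> Uq q n"
abbreviation "R \<equiv> (free_alg (uq_gens n) :: (uq_gen, 'k) falg ring)"
abbreviation "cls \<equiv> uq_class q n"

sublocale U: ring U by (rule ring_Uq)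

lemma cls_hom:
  assumes "x \<in> carrier R" "y \<in> carrier R"
  shows "cls x \<in> carrier U" "cls (x * y) = cls x \<otimes>\<^bsub>U\<^esub> cls y" "cls (x + y) = cls x \<oplus>\<^bsub>U\<^esub> cls y" "cls 1 = \<one>\<^bsub>U\<^esub>"
    "cls x = cls y \<longleftrightarrow> x - y \<in> uq_ideal q n" "cls (- x) = \<ominus>\<^bsub>U\<^esub> cls x" "cls (x - y) = cls x \<ominus>\<^bsub>U\<^esub> cls y" "cls 0 = \<zero>\<^bsub>U\<^esub>"
proof -
  interpret J: ideal "uq_ideal q n" R by (rule uq_ideal)
  have ops: "monoid.mult R = (*)" "monoid.one R = 1" "ring.add R = (+)" "\<zero>\<^bsub>R\<^esub> = 0"
    by (auto simp: free_alg_def ring_of_type_algebra_def)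
  have neg: "\<ominus>\<^bsub>R\<^esub> z = - z" if "z \<in> carrier R" for z
    using that free_alg_closed(7)[of z] by (intro J.minus_equality) (auto simp: ops)
  have cls: "cls = (+>\<^bsub>R\<^esub>) (uq_ideal q n)" by (rule ext) (simp add: uq_class_def)
  interpret h: ring_hom_ring R U cls
    unfolding cls Uq_def by (intro ring_hom_ring.intro ring_hom_ring_axioms.intro J.ring_axioms J.quotient_is_ring J.rcos_ring_hom)
  show "cls x \<in> carrier U" "cls (x * y) = cls x \<otimes>\<^bsub>U\<^esub> cls y" "cls (x + y) = cls x \<oplus>\<^bsub>U\<^esub> cls y" "cls 1 = \<one>\<^bsub>U\<^esub>" "cls 0 = \<zero>\<^bsub>U\<^esub>"
    using h.hom_closed[of x] h.hom_mult[of x y] h.hom_add[of x y] h.hom_one h.hom_zero assms by (simp_all add: ops)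
  show n: "cls (- x) = \<ominus>\<^bsub>U\<^esub> cls x" using h.hom_a_inv[OF assms(1)] neg[OF assms(1)] by simp
  have m: "cls (- y) = \<ominus>\<^bsub>U\<^esub> cls y" using h.hom_a_inv[OF assms(2)] neg[OF assms(2)] by simp
  show "cls (x - y) = cls x \<ominus>\<^bsub>U\<^esub> cls y"
    using h.hom_add[of x "- y"] assms free_alg_closed(7)[OF assms(2)] by (simp add: ops m a_minus_def)
  have "x \<ominus>\<^bsub>R\<^esub> y = x - y" using neg[OF assms(2)] by (simp add: a_minus_def ops)
  then show "cls x = cls y \<longleftrightarrow> x - y \<in> uq_ideal q n"
    using J.quotient_eq_iff_same_a_r_cos[OF J.ideal_axioms assms] by (simp add: cls)
qed

lemma gens_carrier: "j \<in> {1..n} \<Longrightarrow> fgen (GE j) \<in> carrier R \<and> fgen (GF j) \<in> carrier R \<and> fgen (GK j) \<in> carrier R \<and> fgen (GKi j) \<in> carrier R"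
  by (auto simp: free_alg_closed(1) uq_gens_def)

definition pr :: "(kgen, 'k) falg \<Rightarrow> (uq_gen, 'k) falg set" where
  "pr x = cls (kimg x)"

lemma pr_hom:
  "pr x \<in> carrier U" "pr (x * y) = pr x \<otimes>\<^bsub>U\<^esub> pr y" "pr (x + y) = pr x \<oplus>\<^bsub>U\<^esub> pr y" "pr 1 = \<one>\<^bsub>U\<^esub>"
  "pr x = pr y \<longleftrightarrow> x - y \<in> kker" "pr (- x) = \<ominus>\<^bsub>U\<^esub> pr x" "pr (x - y) = pr x \<ominus>\<^bsub>U\<^esub> pr y"
  "pr (fconst c) = uscal q n c" "pr (fcomm c x y) = qcomm U (uscal q n c) (pr x) (pr y)" "pr 0 = \<zero>\<^bsub>U\<^esub>"
proof -
  have k: "kimg (x * y) = kimg x * kimg y" "kimg (x + y) = kimg x + kimg y" "kimg (x - y) = kimg x - kimg y"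
    "kimg (- x) = - kimg x" "kimg 1 = 1" "kimg (fconst c) = fconst c" "kimg 0 = 0" for x y c
    by (simp_all add: kimg_def ev_simps)
  note c = cls_hom[OF kimg_carrier kimg_carrier]
  show 1: "pr x \<in> carrier U" "pr (x * y) = pr x \<otimes>\<^bsub>U\<^esub> pr y" "pr (x + y) = pr x \<oplus>\<^bsub>U\<^esub> pr y" "pr 1 = \<one>\<^bsub>U\<^esub>"
    "pr x = pr y \<longleftrightarrow> x - y \<in> kker" "pr (- x) = \<ominus>\<^bsub>U\<^esub> pr x" "pr (x - y) = pr x \<ominus>\<^bsub>U\<^esub> pr y"
    "pr 0 = \<zero>\<^bsub>U\<^esub>" for x y
    using c by (simp_all add: pr_def k kker_def)
  show 2: "pr (fconst c) = uscal q n c" for c by (simp add: pr_def k uscal_def)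
  show "pr (fcomm c x y) = qcomm U (uscal q n c) (pr x) (pr y)"
    by (simp only: fcomm_def qcomm_def 1(2,7) 2)
qed

lemma pr_gens: "j \<in> {1..n} \<Longrightarrow> pr (kb j) = uB q n j" "j \<in> {1..n} \<Longrightarrow> pr (kh j) = uH q n j"
proof -
  assume j: "j \<in> {1..n}"
  note g = gens_carrier[OF j] gens_carrier[OF tau_props(1)[OF j]]
  have "kimg (kb j) = fgen (GF j) - fgen (GKi j) * fgen (GE (tau j))"
    and "kimg (kh j) = fgen (GK j) * fgen (GKi (tau j))"
    using j by (simp_all add: kimg_def ev_fgen kgen_img_def)
  then show "pr (kb j) = uB q n j" "pr (kh j) = uH q n j"
    using g by (simp_all add: pr_def uB_def uH_def uF_def uE_def uK_def uKi_def cls_hom free_alg_closed(8))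
qed

lemma pr_junk: "j \<notin> {1..n} \<Longrightarrow> pr (kb j) = pr 0" "j \<notin> {1..n} \<Longrightarrow> pr (kh j) = pr 1"
  by (auto simp: pr_def kimg_def ev_fgen kgen_img_def ev_simps)

lemma generated_induct:
  assumes "\<And>c. P (uscal q n c)" "\<And>s. s \<in> S \<Longrightarrow> P s" "\<And>x y. P x \<Longrightarrow> P y \<Longrightarrow> P (x \<oplus>\<^bsub>U\<^esub> y)"
    "\<And>x y. P x \<Longrightarrow> P y \<Longrightarrow> P (x \<otimes>\<^bsub>U\<^esub> y)" "\<And>x. P x \<Longrightarrow> P (\<ominus>\<^bsub>U\<^esub> x)"
    and "x \<in> gen_subalgebra U (uscal q n) S"
  shows "P x"
  using assms(6) unfolding gen_subalgebra_def
proof (induction rule: generate_ring.induct)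
  case one
  have "uscal q n 1 = \<one>\<^bsub>U\<^esub>" using pr_hom(8)[of 1] by (simp add: fconst_simps(6) pr_hom(4))
  then show ?case using assms(1)[of 1] by simp
qed (use assms in auto)

lemma Uk_eq: "Uk q n = range pr"
proof
  show "Uk q n \<subseteq> range pr"
  proof
    fix x assume "x \<in> Uk q n"
    then show "x \<in> range pr"
      unfolding Uk_def
    proof (rule generated_induct[rotated -1])
      show "uscal q n c \<in> range pr" for c using pr_hom(8)[of c, symmetric] by simp
      show "s \<in> range pr" if "s \<in> uB q n ` {1..n} \<union> uH q n ` {1..n}" for s
      proof -
        obtain j where j: "j \<in> {1..n}" "s = uB q n j \<or> s = uH q n j" using \<open>s \<in> _\<close> by blast
        show ?thesis using j(2) pr_gens[OF j(1)] by (metis rangeI)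
      qed
    qed (auto simp flip: pr_hom(2,3,6))
  qed
  show "range pr \<subseteq> Uk q n"
  proof clarify
    fix x
    have S: "uscal q n c \<in> Uk q n" for c
      unfolding Uk_def gen_subalgebra_def by (rule generate_ring.incl) simp
    have Z: "pr 0 \<in> Uk q n" "pr 1 \<in> Uk q n"
      using S[of 0] S[of 1] by (simp_all flip: pr_hom(8) add: fconst_simps(5,6))
    show "pr x \<in> Uk q n"
    proof (induction x rule: falg_induct)
      case (const c)
      then show ?case using S by (simp add: pr_hom)
    next
      case (gen g)
      have "pr (kb j) \<in> Uk q n \<and> pr (kh j) \<in> Uk q n" for j
      proof (cases "j \<in> {1..n}")
        case True
        then show ?thesis
          unfolding Uk_def gen_subalgebra_def by (auto intro!: generate_ring.incl simp: pr_gens simp del: atLeastAtMost_iff)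
      next
        case False
        then show ?thesis using Z by (simp add: pr_junk del: atLeastAtMost_iff)
      qed
      then show ?case by (cases g) auto
    next
      case (add x y)
      then show ?case unfolding Uk_def gen_subalgebra_def by (simp add: pr_hom generate_ring.eng_add)
    next
      case (mult x y)
      then show ?case unfolding Uk_def gen_subalgebra_def by (simp add: pr_hom generate_ring.eng_mult)
    qed
  qed
qed

lemma alg_aut_hom:
  assumes "f \<in> alg_auts U (uscal q n) V" "x \<in> V" "y \<in> V"
  shows "f x \<in> V" "f (x \<otimes>\<^bsub>U\<^esub> y) = f x \<otimes>\<^bsub>U\<^esub> f y" "f (x \<oplus>\<^bsub>U\<^esub> y) = f x \<oplus>\<^bsub>U\<^esub> f y" "f \<one>\<^bsub>U\<^esub> = \<one>\<^bsub>U\<^esub>"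
    "f (uscal q n c) = uscal q n c"
proof -
  have h: "f \<in> ring_iso (U\<lparr>carrier := V\<rparr>) (U\<lparr>carrier := V\<rparr>)" and c: "f (uscal q n c) = uscal q n c"
    using assms(1) by (auto simp: alg_auts_def)
  show "f (uscal q n c) = uscal q n c" by (rule c)
  show "f x \<in> V" "f (x \<otimes>\<^bsub>U\<^esub> y) = f x \<otimes>\<^bsub>U\<^esub> f y" "f (x \<oplus>\<^bsub>U\<^esub> y) = f x \<oplus>\<^bsub>U\<^esub> f y" "f \<one>\<^bsub>U\<^esub> = \<one>\<^bsub>U\<^esub>"
    using ring_iso_memE(1)[OF h] ring_iso_memE(2)[OF h] ring_iso_memE(3)[OF h] ring_iso_memE(4)[OF h] assms(2,3)
    by simp_all
qed

text \<open>Members of \<open>alg_auts\<close> respect sums, products and scalars by definition;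
  negation is reduced to a product with a scalar.\<close>

lemma uminus_scal: "pr (- x) = uscal q n (-1) \<otimes>\<^bsub>U\<^esub> pr x"
proof -
  have "pr (- x) = pr (fconst (-1) * x)" by (simp add: fconst_simps(4,6))
  then show ?thesis by (simp only: pr_hom)
qed

lemma Uk_aut_ev:
  assumes f: "f \<in> Uk_auts q n" and g: "\<And>a. f (pr (fgen a)) = pr (g a)"
  shows "f (pr x) = pr (ev g x)"
proof -
  have V: "pr x \<in> Uk q n" for x by (simp add: Uk_eq)
  note h = alg_aut_hom[OF f V V]
  show ?thesis
    by (induction x rule: falg_induct) (simp_all add: pr_hom h g ev_fgen ev_fconst ev.add ev_mult)
qed

text \<open>An automorphism that already exists forces the substitution describing it to preserve
  \<open>kker\<close>. This spares checking any relation for tau_1, ..., tau_{r-1}.\<close>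

lemma Uk_aut_kker:
  assumes f: "f \<in> Uk_auts q n" and g: "\<And>a. f (pr (fgen a)) = pr (g a)" and x: "x \<in> kker"
  shows "ev g x \<in> kker"
proof -
  have "pr x = pr 0" using x by (simp add: pr_hom(5))
  then have "pr (ev g x) = pr (ev g 0)" using Uk_aut_ev[OF f g] by metis
  then show ?thesis by (simp add: pr_hom(5) ev.zero)
qed

lemma Uk_aut_ext:
  assumes "f \<in> Uk_auts q n" "f' \<in> Uk_auts q n" "\<And>a. f (pr (fgen a)) = pr (g a)" "\<And>a. f' (pr (fgen a)) = pr (g a)"
  shows "f = f'"
proof (rule extensionalityI[of _ "Uk q n"])
  show "f \<in> extensional (Uk q n)" "f' \<in> extensional (Uk q n)" using assms by (auto simp: alg_auts_def)
  fix u assume "u \<in> Uk q n"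
  then obtain x where "u = pr x" by (auto simp: Uk_eq)
  then show "f u = f' u" using Uk_aut_ev[OF assms(1,3)] Uk_aut_ev[OF assms(2,4)] by simp
qed

section \<open>From substitutions preserving \<open>kker\<close> to automorphisms of the coideal
  subalgebra\<close>

definition lift :: "(kgen \<Rightarrow> (kgen, 'k) falg) \<Rightarrow> (uq_gen, 'k) falg set \<Rightarrow> (uq_gen, 'k) falg set" where
  "lift g = restrict (\<lambda>u. pr (ev g (SOME x. pr x = u))) (Uk q n)"

lemma lift_pr:
  assumes "\<And>x. x \<in> kker \<Longrightarrow> ev g x \<in> kker"
  shows "lift g (pr x) = pr (ev g x)"
proof -
  have "pr (SOME y. pr y = pr x) = pr x" by (rule someI) (rule refl)
  then have "pr (ev g (SOME y. pr y = pr x)) = pr (ev g x)"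
    using assms by (simp add: pr_hom(5) flip: ev.diff)
  then show ?thesis by (simp add: lift_def Uk_eq)
qed

lemma lift_aut:
  assumes g: "\<And>x. x \<in> kker \<Longrightarrow> ev g x \<in> kker" and g': "\<And>x. x \<in> kker \<Longrightarrow> ev g' x \<in> kker"
    and inv: "\<And>x. ev g (ev g' x) - x \<in> kker" "\<And>x. ev g' (ev g x) - x \<in> kker"
  shows "lift g \<in> Uk_auts q n" "aut_inverse (Uk q n) (lift g) = lift g'"
proof -
  note l = lift_pr[of g, OF g] lift_pr[of g', OF g']
  have i: "lift g (lift g' (pr x)) = pr x" "lift g' (lift g (pr x)) = pr x" for x
    using inv[of x] by (simp_all add: l pr_hom(5))
  have "inj_on (lift g) (Uk q n)"
    by (rule inj_on_inverseI[of _ "lift g'"]) (auto simp: Uk_eq i)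
  moreover have "lift g ` Uk q n = Uk q n"
  proof -
    have "pr x \<in> lift g ` range pr" for x
      using i(1)[of x] l(2)[of x] by (metis rangeI image_eqI)
    then show ?thesis by (auto simp: Uk_eq l)
  qed
  ultimately have b: "bij_betw (lift g) (Uk q n) (Uk q n)" by (simp add: bij_betw_def)
  have "lift g \<in> ring_iso (U\<lparr>carrier := Uk q n\<rparr>) (U\<lparr>carrier := Uk q n\<rparr>)"
    using b by (intro ring_iso_memI) (auto simp: Uk_eq l ev_simps simp flip: pr_hom(2,3,4))
  moreover have "lift g (uscal q n c) = uscal q n c" for c
    using l(1)[of "fconst c"] by (simp add: ev_fconst pr_hom)
  ultimately show "lift g \<in> Uk_auts q n" by (simp add: alg_auts_def lift_def)
  show "aut_inverse (Uk q n) (lift g) = lift g'"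
  proof (rule extensionalityI[of _ "Uk q n"])
    fix u assume "u \<in> Uk q n"
    then obtain x where x: "u = pr x" by (auto simp: Uk_eq)
    have "inv_into (Uk q n) (lift g) u = lift g' u"
      using i(1)[of x] l(2)[of x] b by (intro inv_into_f_eq) (auto simp: x bij_betw_def Uk_eq)
    then show "aut_inverse (Uk q n) (lift g) u = lift g' u"
      using \<open>u \<in> Uk q n\<close> by (simp add: aut_inverse_def)
  qed (simp_all add: aut_inverse_def lift_def)
qed

section \<open>The Lusztig automorphisms on the torus\<close>

definition kpow :: "nat \<Rightarrow> int \<Rightarrow> (uq_gen, 'k) falg" where
  "kpow i e = (if 0 \<le> e then fgen (GK i) ^ nat e else fgen (GKi i) ^ nat (- e))"

lemma kpow_carrier: assumes "i \<in> {1..n}" shows "kpow i e \<in> carrier R"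
proof -
  have "x ^ k \<in> carrier R" if "x \<in> carrier R" for x k
    using that by (induction k) (simp_all add: free_alg_closed)
  then show ?thesis using gens_carrier[OF assms] by (simp add: kpow_def)
qed

lemma cls_kpow: assumes "i \<in> {1..n}" shows "cls (kpow i e) = uKpow q n i e"
proof -
  have "cls (x ^ k) = cls x [^]\<^bsub>U\<^esub> k \<and> x ^ k \<in> carrier R" if x: "x \<in> carrier R" for x k
  proof (induction k)
    case 0
    show ?case using cls_hom(4)[OF x x] by (simp add: free_alg_closed)
  next
    case (Suc k)
    have "x ^ Suc k = x ^ k * x" by (rule power_Suc2)
    then show ?case using Suc x by (simp add: cls_hom(2) free_alg_closed(8) U.nat_pow_Suc del: power_Suc)
  qed
  then show ?thesis using gens_carrier[OF assms] by (simp add: kpow_def uKpow_def uK_def uKi_def)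
qed

lemma ev_upart: assumes "x \<in> carrier R" shows "ev upart x = x"
proof -
  have "prod_list (map upart (letters w)) = fword (letters w)" if "w \<in> Poly_Mapping.keys x" for w
  proof -
    have "set (letters w) \<subseteq> uq_gens n" using assms that by (auto simp: free_alg_def)
    then have "map upart (letters w) = map fgen (letters w)" by (intro map_cong) (auto simp: upart_def)
    then show ?thesis by (rule arg_cong)
  qed
  then have "ev upart x = ev fgen x" by (simp add: ev_def lext_def)
  also have "ev fgen x = x" by (induction x rule: falg_induct) (simp_all add: ev_simps)
  finally show ?thesis .
qed

lemma cls_eqI:
  assumes "x \<in> carrier R" "y \<in> carrier R" "\<And>z. two_sided.M uker x z = two_sided.M uker y z"
  shows "cls x = cls y"
proof -
  interpret two_sided uker by (rule two_sided_uker)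
  have "x - y \<in> uker" using assms(3) by (rule M_eqI)
  then have "x - y \<in> uq_ideal q n"
    using ev_upart[of "x - y"] assms(1,2) by (simp add: uker_def free_alg_closed)
  then show ?thesis using cls_hom(5)[OF assms(1,2)] by simp
qed

lemma uideal_uker: "uideal q n r uker"
proof -
  interpret two_sided uker by (rule two_sided_uker)
  show ?thesis by unfold_locales (use uq_rels_uker in auto)
qed

end

context uideal
begin

abbreviation "P i e \<equiv> M (kpow i e)"

lemma power_M_commute:
  assumes "\<And>z. M x (M y z) = M y (M x z)"
  shows "M x (M (y ^ k) z) = M (y ^ k) (M x z)"
proof (induction k arbitrary: z)
  case 0
  show ?case by (simp add: M_poly nu_M M_nu)
next
  case (Suc k)
  then show ?case by (simp only: power_Suc M_poly(6) assms)
qed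

lemma P_commute:
  assumes "i \<in> {1..n}" "j \<in> {1..n}"
  shows "K i (P j e z) = P j e (K i z)" "K' i (P j e z) = P j e (K' i z)" "P i d (P j e z) = P j e (P i d z)"
proof -
  have 1: "K i (P j e z) = P j e (K i z)" "K' i (P j e z) = P j e (K' i z)" if "i \<in> {1..n}" "j \<in> {1..n}" for i j e z
    unfolding kpow_def
    using power_M_commute[of "fgen (GK i)" "fgen (GK j)"] power_M_commute[of "fgen (GK i)" "fgen (GKi j)"]
      power_M_commute[of "fgen (GKi i)" "fgen (GK j)"] power_M_commute[of "fgen (GKi i)" "fgen (GKi j)"]
      K_commute[OF that] K'_commute[OF that] K'_commute(1)[OF that(2,1)] by simp_all
  show "K i (P j e z) = P j e (K i z)" "K' i (P j e z) = P j e (K' i z)" using 1 assms by blast+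
  have "P j e (P i d z) = P i d (P j e z)"
    unfolding kpow_def[of i]
    using power_M_commute[of "kpow j e" "fgen (GK i)"] power_M_commute[of "kpow j e" "fgen (GKi i)"] 1[OF assms] by simp
  then show "P i d (P j e z) = P j e (P i d z)" by simp
qed

lemma power_M_inverse:
  assumes "\<And>z. M x (M y z) = nu z"
  shows "M (x ^ k) (M (y ^ k) z) = nu z"
proof (induction k arbitrary: z)
  case 0
  show ?case by (simp add: M_poly nu_nu)
next
  case (Suc k)
  have "M (x ^ Suc k) (M (y ^ Suc k) z) = M (x ^ k) (M x (M y (M (y ^ k) z)))"
    by (simp only: power_Suc2[of x] power_Suc[of y] M_poly(6))
  then show ?case using Suc by (simp add: assms M_nu)
qed

lemma P_inverse: assumes "i \<in> {1..n}" shows "P i e (P i (- e) z) = nu z"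
  using power_M_inverse[of "fgen (GK i)" "fgen (GKi i)" "nat e" z] power_M_inverse[of "fgen (GKi i)" "fgen (GK i)" "nat (- e)" z]
    K_inv[OF assms] by (cases "e = 0") (auto simp: kpow_def M_poly nu_nu)

lemma kimg_hpow:
  assumes "i \<in> {1..n}" shows "M (kimg (hpow i e)) z = P i e (P (tau i) (- e) z)"
proof -
  have j: "tau i \<in> {1..n}" "tau (tau i) = i" using tau_props assms by blast+
  have kh: "kimg (kh j) = fgen (GK j) * fgen (GKi (tau j))" if "j \<in> {1..n}" for j
    using that by (simp add: kimg_def ev_fgen kgen_img_def)
  have pow: "M (kimg (kh j ^ k)) z = M (fgen (GK j) ^ k) (M (fgen (GKi (tau j)) ^ k) z)" if "j \<in> {1..n}" "tau j \<in> {1..n}" for j k z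
  proof (induction k arbitrary: z)
    case 0
    show ?case by (simp add: kimg_def ev_one M_poly nu_nu)
  next
    case (Suc k)
    have c: "M (fgen (GKi (tau j))) (M (fgen (GK j) ^ k) z) = M (fgen (GK j) ^ k) (M (fgen (GKi (tau j))) z)" for z
      using K'_commute(1)[OF that(2,1)] by (rule power_M_commute)
    have "kimg (kh j ^ Suc k) = kimg (kh j) * kimg (kh j ^ k)" by (simp add: kimg_def ev_mult)
    then show ?case by (simp only: kh[OF that(1)] M_poly(6) Suc c power_Suc)
  qed
  have comm: "M (fgen (GK (tau i)) ^ k) (M (fgen (GKi i) ^ k) z) = M (fgen (GKi i) ^ k) (M (fgen (GK (tau i)) ^ k) z)" for k
  proof -
    have "M (fgen (GKi i)) (M (fgen (GK (tau i)) ^ k) z) = M (fgen (GK (tau i)) ^ k) (M (fgen (GKi i)) z)" for z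
      using K'_commute(1)[OF assms j(1)] by (rule power_M_commute)
    then show ?thesis by (rule power_M_commute[OF sym])
  qed
  show ?thesis
    using pow[OF assms j(1)] pow[OF j(1)] j assms comm
    by (cases "e = 0") (auto simp: hpow_def kpow_def kimg_def ev_one M_poly nu_nu simp del: atLeastAtMost_iff)
qed

end

context aiii
begin

context
  fixes i f
  assumes f: "is_lusztig_aut q n i f" and i: "i \<in> {1..n}"
begin

interpretation uideal q n r uker by (rule uideal_uker)

lemma T_hom:
  "x \<in> carrier R \<Longrightarrow> y \<in> carrier R \<Longrightarrow> f (cls (x * y)) = f (cls x) \<otimes>\<^bsub>U\<^esub> f (cls y)" "f \<one>\<^bsub>U\<^esub> = \<one>\<^bsub>U\<^esub>"
proof -
  have a: "f \<in> alg_auts U (uscal q n) (carrier U)" using f by (simp add: is_lusztig_aut_def Let_def)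
  show "x \<in> carrier R \<Longrightarrow> y \<in> carrier R \<Longrightarrow> f (cls (x * y)) = f (cls x) \<otimes>\<^bsub>U\<^esub> f (cls y)"
    using alg_aut_hom(2)[OF a cls_hom(1)[of x x] cls_hom(1)[of y y]] by (simp add: cls_hom(2))
  show "f \<one>\<^bsub>U\<^esub> = \<one>\<^bsub>U\<^esub>" using alg_aut_hom(4)[OF a U.one_closed U.one_closed] .
qed

lemma T_closed: "x \<in> carrier U \<Longrightarrow> f x \<in> carrier U"
  using alg_aut_hom(1)[of f "carrier U" x x] f by (simp add: is_lusztig_aut_def Let_def)

lemma T_K: assumes "j \<in> {1..n}" shows "f (cls (fgen (GK j))) = cls (fgen (GK j) * kpow i (- cartan i j))"
proof -
  have "f (uK q n j) = uK q n j \<otimes>\<^bsub>U\<^esub> uKpow q n i (- cartan i j)"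
    using f assms by (simp add: is_lusztig_aut_def Let_def del: atLeastAtMost_iff)
  then show ?thesis
    using gens_carrier[OF assms] kpow_carrier[OF i] by (simp add: uK_def cls_hom(2) cls_kpow[OF i])
qed

text \<open>\<open>is_lusztig_aut\<close> prescribes f on K_j only; the image of K_j^{-1} is
  determined as the inverse of the image of K_j.\<close>

lemma T_K': assumes "j \<in> {1..n}" shows "f (cls (fgen (GKi j))) = cls (fgen (GKi j) * kpow i (cartan i j))"
proof -
  note g = gens_carrier[OF assms] kpow_carrier[OF i]
  let ?x = "fgen (GK j) * kpow i (- cartan i j)" and ?w = "fgen (GKi j) * kpow i (cartan i j)"
  have c: "?x \<in> carrier R" "?w \<in> carrier R" using g by (simp_all add: free_alg_closed(8))
  have "cls (fgen (GKi j) * fgen (GK j)) = cls 1"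
    using g by (intro cls_eqI) (simp_all add: free_alg_closed M_poly K_inv(2)[OF assms])
  then have "f (cls (fgen (GKi j))) \<otimes>\<^bsub>U\<^esub> cls ?x = \<one>\<^bsub>U\<^esub>"
    using T_hom(1)[of "fgen (GKi j)" "fgen (GK j)"] T_hom(2) g T_K[OF assms] cls_hom(4)[OF c] by simp
  moreover have "cls (?x * ?w) = cls 1"
    using c K_inv[OF assms] P_commute[OF assms i] P_inverse[OF i, of "- cartan i j"]
    by (intro cls_eqI) (simp_all add: free_alg_closed M_poly nu_M nu_nu flip: P_commute(2)[OF assms i])
  then have "cls ?x \<otimes>\<^bsub>U\<^esub> cls ?w = \<one>\<^bsub>U\<^esub>" using cls_hom(2,4)[OF c] by simp
  moreover have "f (cls (fgen (GKi j))) \<in> carrier U" using g by (intro T_closed cls_hom(1)) auto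
  moreover have "cls ?x \<in> carrier U" "cls ?w \<in> carrier U" using cls_hom(1)[OF c(1,1)] cls_hom(1)[OF c(2,2)] by auto
  ultimately show ?thesis by (metis U.m_assoc U.l_one U.r_one)
qed

lemma T_kpow: assumes "j \<in> {1..n}" "cartan i j = 0" shows "f (cls (kpow j e)) = cls (kpow j e)"
proof -
  have pow: "f (cls (x ^ k)) = cls (x ^ k) \<and> x ^ k \<in> carrier R" if "x \<in> carrier R" "f (cls x) = cls x" for x k
  proof (induction k)
    case 0
    show ?case using T_hom(2) cls_hom(4)[OF that(1,1)] by (simp add: free_alg_closed)
  next
    case (Suc k)
    then show ?case using that T_hom(1)[of x "x ^ k"] by (simp add: cls_hom(2) free_alg_closed(8))
  qed
  show ?thesis
    using pow[of "fgen (GK j)"] pow[of "fgen (GKi j)"] gens_carrier[OF assms(1)] T_K[OF assms(1)] T_K'[OF assms(1)] assms(2)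
    by (simp add: kpow_def)
qed

text \<open>As tau fixes r, the Cartan entries of r with j and tau j agree, so the powers of K_r
  coming from K_j and K_{tau j}^{-1} cancel.\<close>

lemma T_uH_fixed: assumes "i = r" "j \<in> {1..n}" shows "f (uH q n j) = uH q n j"
proof -
  note t = tau_props(1)[OF assms(2)]
  note g = gens_carrier[OF assms(2)] gens_carrier[OF t] kpow_carrier[OF i]
  have eq: "cartan i (tau j) = cartan i j" using cartan_tau(2)[OF i assms(2)] assms(1) tau_props(3) by simp
  have "uH q n j = cls (fgen (GK j) * fgen (GKi (tau j)))"
    using g by (simp add: uH_def uK_def uKi_def cls_hom(2))
  moreover have "f (cls (fgen (GK j) * fgen (GKi (tau j)))) =
      cls (fgen (GK j) * kpow i (- cartan i j) * (fgen (GKi (tau j)) * kpow i (cartan i j)))"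
    using g T_hom(1)[of "fgen (GK j)" "fgen (GKi (tau j))"] T_K[OF assms(2)] T_K'[OF t]
    by (simp add: eq cls_hom(2)[symmetric] free_alg_closed(8))
  moreover have "cls (fgen (GK j) * kpow i (- cartan i j) * (fgen (GKi (tau j)) * kpow i (cartan i j)))
      = cls (fgen (GK j) * fgen (GKi (tau j)))"
    using g P_inverse[OF i, of "- cartan i j"]
    by (intro cls_eqI) (simp_all add: free_alg_closed M_poly M_nu P_commute(2)[OF t i])
  ultimately show ?thesis by simp
qed

end

text \<open>The powers of K_{tau i} produced by the inner automorphism are fixed by the outer one,
  because a_{i, tau i} = 0.\<close>

lemma TT_uH:
  assumes f: "is_lusztig_aut q n i f" and f': "is_lusztig_aut q n (tau i) f'" and i: "i \<in> {1..n}" "i \<noteq> r" and m: "m \<in> {1..n}"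
  shows "f (f' (uH q n m)) = pr (kh m * (hpow i (- cartan i m) * hpow i (cartan (tau i) m)))"
proof -
  interpret uideal q n r uker by (rule uideal_uker)
  note i' = tau_props(1)[OF i(1)] and m' = tau_props(1)[OF m]
  note g = gens_carrier[OF m] gens_carrier[OF m'] kpow_carrier[OF i(1)] kpow_carrier[OF i']
  have c0: "cartan i (tau i) = 0" using cartan_tau_self[OF i] cartan_sym[of i "tau i"] by simp
  have cc: "cartan (tau i) (tau m) = cartan i m" "cartan i (tau m) = cartan (tau i) m" using cartan_tau[OF i(1) m] by auto
  let ?K = "fgen (GK m) :: (uq_gen, 'k) falg" and ?K' = "fgen (GKi (tau m)) :: (uq_gen, 'k) falg"
  have "f' (uH q n m) = cls ((?K * kpow (tau i) (- cartan (tau i) m)) * (?K' * kpow (tau i) (cartan i m)))"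
    using T_hom(1)[OF f' i', of ?K ?K'] T_K[OF f' i' m] T_K'[OF f' i' m'] g
    by (simp add: uH_def uK_def uKi_def cls_hom(2) cc free_alg_closed(8))
  then have "f (f' (uH q n m)) = (f (cls ?K) \<otimes>\<^bsub>U\<^esub> cls (kpow (tau i) (- cartan (tau i) m)))
      \<otimes>\<^bsub>U\<^esub> (f (cls ?K') \<otimes>\<^bsub>U\<^esub> cls (kpow (tau i) (cartan i m)))"
    using g by (simp add: T_hom(1)[OF f i(1)] T_kpow[OF f i(1) i' c0] free_alg_closed(8))
  also have "\<dots> = cls ((?K * kpow i (- cartan i m)) * kpow (tau i) (- cartan (tau i) m)
      * ((?K' * kpow i (cartan (tau i) m)) * kpow (tau i) (cartan i m)))"
    using g by (simp add: T_K[OF f i(1) m] T_K'[OF f i(1) m'] cc cls_hom(2) free_alg_closed(8))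
  also have "\<dots> = pr (kh m * (hpow i (- cartan i m) * hpow i (cartan (tau i) m)))"
    unfolding pr_def
  proof (rule cls_eqI)
    fix z
    have k: "kimg (kh m * (x * y)) = ?K * ?K' * (kimg x * kimg y)" for x y
      using m by (simp add: kimg_def ev_simps(5) ev_fgen kgen_img_def)
    show "M (?K * kpow i (- cartan i m) * kpow (tau i) (- cartan (tau i) m)
      * (?K' * kpow i (cartan (tau i) m) * kpow (tau i) (cartan i m))) z
      = M (kimg (kh m * (hpow i (- cartan i m) * hpow i (cartan (tau i) m)))) z"
      unfolding k M_poly(6) kimg_hpow[OF i(1)] minus_minus
      by (simp only: P_commute(2)[OF m' i(1)] P_commute(2)[OF m' i'] P_commute(3)[OF i(1) i'] P_commute(3)[OF i(1,1)] P_commute(3)[OF i' i'])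
  qed (use g kimg_carrier in \<open>auto intro!: free_alg_closed(8)\<close>)
  finally show ?thesis .
qed

text \<open>Since T_r fixes kT_theta pointwise, the conditions on kT_theta and on the B_j amount to
  prescribed values on all generators, the form in which \<open>Uk_aut_ext\<close> and
  \<open>lift\<close> apply.\<close>

lemma tau_r_characterization:
  assumes lusztig: "is_lusztig_aut q n r (T r)"
  shows "(if b then is_tau_r_minus q n r T f else is_tau_r q n r T f) \<longleftrightarrow>
    f \<in> Uk_auts q n \<and> (\<forall>a. f (pr (fgen a)) = pr (tgen b a))"
proof -
  have near: "near j \<longleftrightarrow> j = r - 1 \<or> j = r + 1" for j by (simp add: near_def)
  have B: "pr (tgen b (KB j)) = (if j = r - 1 \<or> j = r + 1 then
      (if b then qcomm U (uscal q n q) (uB q n r) (uB q n j) else qcomm U (uscal q n q) (uB q n j) (uB q n r))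
      else uB q n j)" if "j \<in> {1..n}" for j
    by (simp only: tgen_def kgen.case near if_distrib[of pr] pr_hom(9) pr_gens(1)[OF that] pr_gens(1)[OF r_in])
  have T: "\<forall>x\<in>kTtheta q n. f x = T r x" if f: "f \<in> Uk_auts q n" and H: "\<And>j. j \<in> {1..n} \<Longrightarrow> f (uH q n j) = uH q n j"
  proof
    fix x assume "x \<in> kTtheta q n"
    have t: "T r \<in> alg_auts U (uscal q n) (carrier U)" using lusztig by (simp add: is_lusztig_aut_def Let_def)
    note hf = alg_aut_hom[OF f] and ht = alg_aut_hom[OF t]
    have "x \<in> Uk q n \<and> x \<in> carrier U \<and> f x = x \<and> T r x = x"
      using \<open>x \<in> kTtheta q n\<close> unfolding kTtheta_def
    proof (rule generated_induct[rotated -1])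
      have pU: "pr x \<in> Uk q n" for x by (simp add: Uk_eq)
      have S: "uscal q n c = pr (fconst c)" for c by (simp add: pr_hom)
      show S': "uscal q n c \<in> Uk q n \<and> uscal q n c \<in> carrier U \<and> f (uscal q n c) = uscal q n c \<and> T r (uscal q n c) = uscal q n c" for c
        using hf(5)[OF pU pU] ht(5)[OF pr_hom(1) pr_hom(1)] pU[of "fconst c"] pr_hom(1)[of "fconst c"] by (simp add: S)
      show "s \<in> Uk q n \<and> s \<in> carrier U \<and> f s = s \<and> T r s = s" if "s \<in> uH q n ` {1..n}" for s
      proof -
        obtain j where j: "j \<in> {1..n}" "s = uH q n j" using \<open>s \<in> uH q n ` {1..n}\<close> by blast
        show ?thesis
          using pU[of "kh j"] pr_hom(1)[of "kh j"] H[OF j(1)] T_uH_fixed[OF lusztig r_in refl j(1)]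
          by (simp only: j(2) pr_gens[OF j(1)])
      qed
      fix x y assume xy: "x \<in> Uk q n \<and> x \<in> carrier U \<and> f x = x \<and> T r x = x" "y \<in> Uk q n \<and> y \<in> carrier U \<and> f y = y \<and> T r y = y"
      then obtain x' y' where x': "x = pr x'" "y = pr y'" by (auto simp: Uk_eq)
      have "x \<oplus>\<^bsub>U\<^esub> y \<in> Uk q n" "x \<otimes>\<^bsub>U\<^esub> y \<in> Uk q n" by (simp_all add: x' Uk_eq flip: pr_hom)
      then show "x \<oplus>\<^bsub>U\<^esub> y \<in> Uk q n \<and> x \<oplus>\<^bsub>U\<^esub> y \<in> carrier U \<and> f (x \<oplus>\<^bsub>U\<^esub> y) = x \<oplus>\<^bsub>U\<^esub> y \<and> T r (x \<oplus>\<^bsub>U\<^esub> y) = x \<oplus>\<^bsub>U\<^esub> y"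
        and m: "x \<otimes>\<^bsub>U\<^esub> y \<in> Uk q n \<and> x \<otimes>\<^bsub>U\<^esub> y \<in> carrier U \<and> f (x \<otimes>\<^bsub>U\<^esub> y) = x \<otimes>\<^bsub>U\<^esub> y \<and> T r (x \<otimes>\<^bsub>U\<^esub> y) = x \<otimes>\<^bsub>U\<^esub> y"
        using xy hf(2,3)[of x y] ht(2,3)[of x y] by auto
    next
      fix x assume x: "x \<in> Uk q n \<and> x \<in> carrier U \<and> f x = x \<and> T r x = x"
      then obtain x' where x': "x = pr x'" by (auto simp: Uk_eq)
      have eq: "\<ominus>\<^bsub>U\<^esub> x = uscal q n (-1) \<otimes>\<^bsub>U\<^esub> x" using uminus_scal[of x'] by (simp add: x' pr_hom(6))
      have S: "uscal q n c = pr (fconst c)" for c by (simp add: pr_hom)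
      have s: "uscal q n (-1) \<in> Uk q n" "uscal q n (-1) \<in> carrier U" "f (uscal q n (-1)) = uscal q n (-1)"
        "T r (uscal q n (-1)) = uscal q n (-1)"
        using pr_hom(1)[of "fconst (-1)"] hf(5)[of x x "-1"] ht(5)[of x x "-1"] x by (auto simp: S Uk_eq)
      have "\<ominus>\<^bsub>U\<^esub> x \<in> Uk q n" "\<ominus>\<^bsub>U\<^esub> x \<in> carrier U"
        by (simp_all add: x' Uk_eq pr_hom(1) flip: pr_hom(6))
      then show "\<ominus>\<^bsub>U\<^esub> x \<in> Uk q n \<and> \<ominus>\<^bsub>U\<^esub> x \<in> carrier U \<and> f (\<ominus>\<^bsub>U\<^esub> x) = \<ominus>\<^bsub>U\<^esub> x \<and> T r (\<ominus>\<^bsub>U\<^esub> x) = \<ominus>\<^bsub>U\<^esub> x"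
        using x s hf(2)[of "uscal q n (-1)" x] ht(2)[of "uscal q n (-1)" x] by (simp add: eq)
    qed
    then show "f x = T r x" by simp
  qed
  have Hmem: "uH q n j \<in> kTtheta q n" if "j \<in> {1..n}" for j
    unfolding kTtheta_def gen_subalgebra_def using that by (intro generate_ring.incl) auto
  have "(\<forall>x\<in>kTtheta q n. f x = T r x) \<and> (\<forall>j\<in>{1..n}. f (uB q n j) = pr (tgen b (KB j)))
      \<longleftrightarrow> (\<forall>a. f (pr (fgen a)) = pr (tgen b a))" if f: "f \<in> Uk_auts q n"
  proof
    assume l: "(\<forall>x\<in>kTtheta q n. f x = T r x) \<and> (\<forall>j\<in>{1..n}. f (uB q n j) = pr (tgen b (KB j)))"
    show "\<forall>a. f (pr (fgen a)) = pr (tgen b a)"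
    proof
      fix a
      have pU: "pr x \<in> Uk q n" for x by (simp add: Uk_eq)
      have c: "f (pr (fconst c)) = pr (fconst c)" for c
        using alg_aut_hom(5)[OF f pU pU] by (simp add: pr_hom)
      show "f (pr (fgen a)) = pr (tgen b a)"
      proof (cases a)
        case (KB j)
        show ?thesis
        proof (cases "j \<in> {1..n}")
          case True
          then show ?thesis using l KB by (simp add: pr_gens)
        next
          case False
          then have "\<not> near j" using near_props(1) by blast
          then show ?thesis using KB False c[of 0] by (simp add: pr_junk tgen_def fconst_simps(5) del: atLeastAtMost_iff)
        qed
      next
        case (KH j)
        show ?thesis
        proof (cases "j \<in> {1..n}")
          case True
          then show ?thesis using l KH Hmem[OF True] T_uH_fixed[OF lusztig r_in refl True] by (simp add: pr_gens tgen_def)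
        next
          case False
          then show ?thesis using KH c[of 1] by (simp add: pr_junk tgen_def fconst_simps(6) del: atLeastAtMost_iff)
        qed
      qed
    qed
  next
    assume g: "\<forall>a. f (pr (fgen a)) = pr (tgen b a)"
    have "f (uH q n j) = uH q n j" if "j \<in> {1..n}" for j
      using g[rule_format, of "KH j"] pr_gens[OF that] by (simp add: tgen_def)
    then show "(\<forall>x\<in>kTtheta q n. f x = T r x) \<and> (\<forall>j\<in>{1..n}. f (uB q n j) = pr (tgen b (KB j)))"
    proof (intro conjI)
      show "\<forall>x\<in>kTtheta q n. f x = T r x" using T[OF f] \<open>\<And>j. j \<in> {1..n} \<Longrightarrow> f (uH q n j) = uH q n j\<close> by blast
      show "\<forall>j\<in>{1..n}. f (uB q n j) = pr (tgen b (KB j))"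
      proof
        fix j assume "j \<in> {1..n}"
        then show "f (uB q n j) = pr (tgen b (KB j))"
          using g[rule_format, of "KB j"] pr_gens(1)[of j] by simp
      qed
    qed
  qed
  then have E: "f \<in> Uk_auts q n \<and> (\<forall>x\<in>kTtheta q n. f x = T r x) \<and> (\<forall>j\<in>{1..n}. f (uB q n j) = pr (tgen b (KB j)))
      \<longleftrightarrow> f \<in> Uk_auts q n \<and> (\<forall>a. f (pr (fgen a)) = pr (tgen b a))" by (rule conj_cong[OF refl])
  show ?thesis
  proof (cases b)
    case True
    then have b: "b = True" by simp
    have "is_tau_r_minus q n r T f \<longleftrightarrow> f \<in> Uk_auts q n \<and> (\<forall>x\<in>kTtheta q n. f x = T r x)
        \<and> (\<forall>j\<in>{1..n}. f (uB q n j) = pr (tgen b (KB j)))"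
      unfolding is_tau_r_minus_def by (intro conj_cong refl ball_cong) (simp only: B[unfolded b] b if_True)
    then show ?thesis using E b by (simp only: if_True)
  next
    case False
    then have b: "b = False" by simp
    have "is_tau_r q n r T f \<longleftrightarrow> f \<in> Uk_auts q n \<and> (\<forall>x\<in>kTtheta q n. f x = T r x)
        \<and> (\<forall>j\<in>{1..n}. f (uB q n j) = pr (tgen b (KB j)))"
      unfolding is_tau_r_def by (intro conj_cong refl ball_cong) (simp only: B[unfolded b] b if_False)
    then show ?thesis using E b by (simp only: if_False)
  qed
qed

lemma is_tau_ugen:
  assumes i: "i \<in> {1..r - 1}" and lusztig: "is_lusztig_aut q n i (T i)" "is_lusztig_aut q n (tau i) (T (tau i))"
    and f: "is_tau q s n T i f"
  shows "f \<in> Uk_auts q n" "f (pr (fgen a)) = pr (ugen s i a)"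
proof -
  have in': "i \<in> {1..n}" "i \<noteq> r" using i r2 by (auto simp: n_def)
  note t = tau_props(1)[OF in'(1)] and tt = tau_props(2)[OF in'(1)]
  show f_aut: "f \<in> Uk_auts q n" using f by (simp add: is_tau_def Let_def)
  have pU: "pr x \<in> Uk q n" for x by (simp add: Uk_eq)
  have c: "f (pr (fconst c)) = pr (fconst c)" for c
    using alg_aut_hom(5)[OF f_aut pU pU] by (simp add: pr_hom)
  show "f (pr (fgen a)) = pr (ugen s i a)"
  proof (cases a)
    case (KB m)
    show ?thesis
    proof (cases "m \<in> {1..n}")
      case True
      have Kc: "uK q n j \<in> carrier U" "uKi q n j \<in> carrier U" if "j \<in> {1..n}" for j
        using gens_carrier[OF that] cls_hom(1) by (auto simp: uK_def uKi_def)
      have Bc: "uB q n j \<in> carrier U" if "j \<in> {1..n}" for j using pr_hom(1)[of "kb j"] pr_gens(1)[OF that] by simp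
      have Sc: "uscal q n c \<in> carrier U" for c using pr_hom(1)[of "fconst c"] by (simp add: pr_hom(8))
      have a1: "uscal q n c \<otimes>\<^bsub>U\<^esub> uK q n j \<otimes>\<^bsub>U\<^esub> uKi q n (tau j) \<otimes>\<^bsub>U\<^esub> uB q n j
          = uscal q n c \<otimes>\<^bsub>U\<^esub> (uH q n j \<otimes>\<^bsub>U\<^esub> uB q n j)" if "j \<in> {1..n}" for c j
        using Kc[OF that] Kc[OF tau_props(1)[OF that]] Bc[OF that] Sc by (simp add: uH_def U.m_assoc)
      have a2: "uB q n m \<otimes>\<^bsub>U\<^esub> uK q n i \<otimes>\<^bsub>U\<^esub> uKi q n (tau i) = uB q n m \<otimes>\<^bsub>U\<^esub> uH q n i"
        using Kc[OF in'(1)] Kc[OF t] Bc[OF True] by (simp add: uH_def U.m_assoc)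
      have "f (uB q n m) =
         (if cartan i m = -1 \<and> cartan (tau i) m \<noteq> -1 then
            uscal q n (inverse s) \<otimes>\<^bsub>U\<^esub> qcomm U (uscal q n q) (uB q n m) (uB q n i)
          else if cartan i m \<noteq> -1 \<and> cartan (tau i) m = -1 then
            uscal q n (inverse s) \<otimes>\<^bsub>U\<^esub> qcomm U (uscal q n q) (uB q n m) (uB q n (tau i))
          else if cartan i m = -1 \<and> cartan (tau i) m = -1 then
            (uscal q n (inverse q) \<otimes>\<^bsub>U\<^esub> qcomm U (uscal q n q) (qcomm U (uscal q n q) (uB q n m) (uB q n i)) (uB q n (tau i)))
              \<oplus>\<^bsub>U\<^esub> (uB q n m \<otimes>\<^bsub>U\<^esub> uK q n i \<otimes>\<^bsub>U\<^esub> uKi q n (tau i))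
          else if m = i then uscal q n q \<otimes>\<^bsub>U\<^esub> uK q n (tau i) \<otimes>\<^bsub>U\<^esub> uKi q n i \<otimes>\<^bsub>U\<^esub> uB q n (tau i)
          else if m = tau i then uscal q n q \<otimes>\<^bsub>U\<^esub> uK q n i \<otimes>\<^bsub>U\<^esub> uKi q n (tau i) \<otimes>\<^bsub>U\<^esub> uB q n i
          else uB q n m)"
        using f True unfolding is_tau_def Let_def by blast
      then have "f (uB q n m) = pr (ugen s i (KB m))"
        using a1[OF t, of q] a1[OF in'(1), of q] True
        by (simp only: ugen_def kgen.case if_distrib[of pr] pr_hom(2,3,8,9) pr_gens[OF True] pr_gens[OF in'(1)] pr_gens[OF t]
            tt a2 not_not not_True_eq_False if_False)
      then show ?thesis using KB pr_gens(1)[OF True] by simp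
    next
      case False
      then show ?thesis using KB c[of 0] by (simp add: pr_junk ugen_def fconst_simps(5) del: atLeastAtMost_iff)
    qed
  next
    case (KH m)
    show ?thesis
    proof (cases "m \<in> {1..n}")
      case True
      have "uH q n m \<in> kTtheta q n"
        unfolding kTtheta_def gen_subalgebra_def using True by (intro generate_ring.incl) auto
      then have "f (uH q n m) = T i (T (tau i) (uH q n m))" using f unfolding is_tau_def Let_def by blast
      also have "\<dots> = pr (ugen s i (KH m))"
        using TT_uH[OF lusztig in' True] True by (simp add: ugen_def)
      finally show ?thesis using KH pr_gens(2)[OF True] by simp
    next
      case False
      then show ?thesis using KH c[of 1] by (simp add: pr_junk ugen_def fconst_simps(6) del: atLeastAtMost_iff)
    qed
  qed
qed

section \<open>Existence of the automorphisms and assembly of the theorem\<close>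

lemma kcomp_kker: "kcomp q n r kker"
proof -
  interpret two_sided kker by (rule two_sided_kker)
  show ?thesis by unfold_locales (rule krels_kker)
qed

text \<open>The sandwich \<open>krels\<close> \<subseteq> \<open>J\<close> \<subseteq>
  \<open>kker\<close>: its first inclusion combines \<open>krels_kker\<close> with
  \<open>krels_tgen\<close>, and \<open>kker_subset\<close> closes it.\<close>

lemma tgen_kker:
  assumes "x \<in> kker"
  shows "ev (tgen b) x \<in> kker"
proof -
  interpret kcomp q n r kker by (rule kcomp_kker)
  define J where "J = {x \<in> kker. ev (tgen b) x \<in> kker}"
  interpret J: two_sided J
    by unfold_locales (auto simp: J_def ev_simps(1,4,5) zero add lmult rmult)
  interpret J: kideal q n r J
    by unfold_locales (use krels_kker krels_tgen in \<open>auto simp: J_def\<close>)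
  have "kker \<subseteq> J" by (rule J.kker_subset) (auto simp: J_def)
  then show ?thesis using assms by (auto simp: J_def)
qed

lemma tgen_inverse: "ev (tgen b) (ev (tgen (\<not> b)) x) - x \<in> kker"
proof -
  interpret kcomp q n r kker by (rule kcomp_kker)
  show ?thesis using tp_tm[of x] tm_tp[of x] by (cases b) (simp_all add: cong_iff)
qed

end

theorem theorem4p4:
  fixes q s :: "'k::field" and n r :: nat
    and T :: "nat \<Rightarrow> (uq_gen fmon \<Rightarrow>\<^sub>0 'k) set \<Rightarrow> (uq_gen fmon \<Rightarrow>\<^sub>0 'k) set"
  assumes q_nonzero: "q \<noteq> 0"
    and q_not_root_of_unity: "\<forall>m::nat. m > 0 \<longrightarrow> q ^ m \<noteq> 1"
    and s_sqrt: "s ^ 2 = q"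
    and r: "r \<ge> 2"
    and n: "n = 2 * r - 1"
    and lusztig: "\<forall>i\<in>{1..n}. is_lusztig_aut q n i (T i)"
  shows
    "(\<exists>!f. is_tau_r_minus q n r T f) \<and>
     (\<forall>\<tau>\<^sub>r\<^sub>m. is_tau_r_minus q n r T \<tau>\<^sub>r\<^sub>m \<longrightarrow>
        (let \<tau>\<^sub>r = aut_inverse (Uk q n) \<tau>\<^sub>r\<^sub>m in
          (is_tau_r q n r T \<tau>\<^sub>r \<and> (\<forall>f. is_tau_r q n r T f \<longrightarrow> f = \<tau>\<^sub>r)) \<and>
          (\<forall>\<tau>. (\<forall>i\<in>{1..r - 1}. is_tau q s n T i (\<tau> i)) \<longrightarrow>
             (\<forall>x\<in>Uk q n. \<tau> (r - 1) (\<tau>\<^sub>r (\<tau> (r - 1) (\<tau>\<^sub>r x))) = \<tau>\<^sub>r (\<tau> (r - 1) (\<tau>\<^sub>r (\<tau> (r - 1) x)))) \<and>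
             (\<forall>j\<in>{1..r - 2}. \<forall>x\<in>Uk q n. \<tau>\<^sub>r (\<tau> j x) = \<tau> j (\<tau>\<^sub>r x)))))"
proof -
  interpret aiii q n r by unfold_locales (use assms in auto)
  interpret kcomp q n r kker by (rule kcomp_kker)
  have Tr: "is_lusztig_aut q n r (T r)" using lusztig r_in by blast
  note char_m = tau_r_characterization[where T = T and b = True, OF Tr, simplified if_True]
  note char_p = tau_r_characterization[where T = T and b = False, OF Tr, simplified if_False]
  have lift: "lift (tgen b) \<in> Uk_auts q n" "aut_inverse (Uk q n) (lift (tgen b)) = lift (tgen (\<not> b))" for b
    using lift_aut[of "tgen b" "tgen (\<not> b)"] tgen_kker tgen_inverse[of b] tgen_inverse[of "\<not> b"] by simp_all
  have lift_pr: "lift (tgen b) (pr x) = pr (ev (tgen b) x)" for b x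
    by (rule lift_pr) (rule tgen_kker)
  have m: "is_tau_r_minus q n r T (lift (tgen True))" and p: "is_tau_r q n r T (lift (tgen False))"
    unfolding char_m char_p using lift(1) by (simp_all add: lift_pr ev_fgen)
  have unique_m: "f = lift (tgen True)" if "is_tau_r_minus q n r T f" for f
    using that m unfolding char_m by (intro Uk_aut_ext[where g = "tgen True"]) auto
  have unique_p: "f = lift (tgen False)" if "is_tau_r q n r T f" for f
    using that p unfolding char_p by (intro Uk_aut_ext[where g = "tgen False"]) auto
  have braid: "braid q n r kker s i" and tau_pr: "\<tau> i (pr x) = pr (ev (ugen s i) x)"
    if \<tau>: "\<forall>i\<in>{1..r - 1}. is_tau q s n T i (\<tau> i)" and i: "i \<in> {1..r - 1}" for \<tau> i x
  proof -
    have i_in: "i \<in> {1..n}" using i by (auto simp: n)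
    have l: "is_lusztig_aut q n i (T i)" "is_lusztig_aut q n (tau i) (T (tau i))"
      using lusztig i_in tau_props(1)[OF i_in] by blast+
    note u = is_tau_ugen[OF i l \<tau>[rule_format, OF i]]
    show "\<tau> i (pr x) = pr (ev (ugen s i) x)" by (rule Uk_aut_ev[OF u])
    \<comment> \<open>Invariance of \<open>kker\<close> under tau_r comes from the presentation,
      invariance under tau_i from the given automorphism.\<close>
    show "braid q n r kker s i"
      using s_sqrt i by unfold_locales (assumption | rule tgen_kker Uk_aut_kker[OF u])+
  qed
  have A: "\<tau> (r - 1) (lift (tgen False) (\<tau> (r - 1) (lift (tgen False) x)))
      = lift (tgen False) (\<tau> (r - 1) (lift (tgen False) (\<tau> (r - 1) x)))"
    if \<tau>: "\<forall>i\<in>{1..r - 1}. is_tau q s n T i (\<tau> i)" and x: "x \<in> Uk q n" for \<tau> x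
  proof -
    have ir: "r - 1 \<in> {1..r - 1}" using r by auto
    interpret braid q n r kker s "r - 1" by (rule braid[OF \<tau> ir])
    obtain y where "x = pr y" using x by (auto simp: Uk_eq)
    then show ?thesis
      using braid_relation[OF refl, of y] by (simp only: tau_pr[OF \<tau> ir] lift_pr pr_hom(5) cong_iff)
  qed
  have B: "lift (tgen False) (\<tau> j x) = \<tau> j (lift (tgen False) x)"
    if \<tau>: "\<forall>i\<in>{1..r - 1}. is_tau q s n T i (\<tau> i)" and j: "j \<in> {1..r - 2}" and x: "x \<in> Uk q n" for \<tau> j x
  proof -
    have jr: "j \<in> {1..r - 1}" "j \<noteq> r - 1" using j r by auto
    interpret braid q n r kker s j by (rule braid[OF \<tau> jr(1)])
    obtain y where "x = pr y" using x by (auto simp: Uk_eq)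
    then show ?thesis
      using commuting[OF jr(2), of y] by (simp only: tau_pr[OF \<tau> jr(1)] lift_pr pr_hom(5) cong_iff)
  qed
  show ?thesis
  proof (intro conjI allI impI)
    show "\<exists>!f. is_tau_r_minus q n r T f" using m unique_m by (rule ex1I)
  next
    fix \<tau>\<^sub>r\<^sub>m assume "is_tau_r_minus q n r T \<tau>\<^sub>r\<^sub>m"
    then have eq: "aut_inverse (Uk q n) \<tau>\<^sub>r\<^sub>m = lift (tgen False)"
      using unique_m[of \<tau>\<^sub>r\<^sub>m] lift(2)[of True] by simp
    show "let \<tau>\<^sub>r = aut_inverse (Uk q n) \<tau>\<^sub>r\<^sub>m in
          (is_tau_r q n r T \<tau>\<^sub>r \<and> (\<forall>f. is_tau_r q n r T f \<longrightarrow> f = \<tau>\<^sub>r)) \<and>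
          (\<forall>\<tau>. (\<forall>i\<in>{1..r - 1}. is_tau q s n T i (\<tau> i)) \<longrightarrow>
             (\<forall>x\<in>Uk q n. \<tau> (r - 1) (\<tau>\<^sub>r (\<tau> (r - 1) (\<tau>\<^sub>r x))) = \<tau>\<^sub>r (\<tau> (r - 1) (\<tau>\<^sub>r (\<tau> (r - 1) x)))) \<and>
             (\<forall>j\<in>{1..r - 2}. \<forall>x\<in>Uk q n. \<tau>\<^sub>r (\<tau> j x) = \<tau> j (\<tau>\<^sub>r x)))"
      unfolding Let_def eq by (intro conjI allI impI p, erule unique_p, (intro ballI, rule A, assumption, assumption),
          (intro ballI, rule B, assumption+))
  qed
qed

end
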